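(* Let $k$ be an algebraically closed field and let $A$ be a $k$-algebra with a finite-dimensional filtration $V=\{V_n : n\in\mathbb{N}\}$ such that the associated graded algebra $\mathrm{gr}_V(A)$ is a (not necessarily commutative) domain. Let $n\in\mathbb{N}$ and let $a\in V_n$ be nonzero. Then, up to multiplication of factors by central units, $a$ has at most $$\frac{n}{4}\cdot 4^{g_V(n)}$$ distinct factorizations into two elements, and at most $$2^{n\cdot g_V(n)}$$ distinct factorizations in total (with any number of factors).
   Context: $\mathbb{N}$ includes $0$. Algebras are associative and unital, not necessarily commutative. A filtration on a $k$-algebra $A$ is a family $V=\{V_n : n\in\mathbb{N}\}$ of $k$-subspaces with $A=\bigcup_n V_n$, $V_n\subseteq V_m$ whenever $n\le m$, and $V_nV_m\subseteq V_{n+m}$ for all $n,m\ge 0$. It is finite-dimensional if each $V_n$ is a finite-dimensional $k$-vector space. The associated graded algebra is $\mathrm{gr}_V(A)=\bigoplus_{n\ge 0}V_n/V_{n-1}$ with $V_{-1}=\{0\}$, with the multiplication induced from $A$. The growth function of $A$ with respect to $V$ is $g_V(n)=\dim_k(V_n)$. A factorization of $a$ is an ordered expression $a=a_1\cdots a_m$ ($m\ge 1$) with all $a_i$ non-units of $A$; a factorization into two elements is one with $m=2$. Two factorizations with the same number of factors are identified if corresponding factors differ by multiplication by central units of $A$. *)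

theory Defs
  imports
    "HOL-Algebra.Ring"
    "HOL-Algebra.Product_Groups"
    "HOL-Computational_Algebra.Formal_Power_Series"
    "HOL-Computational_Algebra.Polynomial"
begin

section \<open>Algebras and filtrations\<close>

text \<open>
  The locale \<^verbatim>\<open>algebra\<close> of HOL-Algebra is restricted to commutative algebras. Here an algebra is a
  type of class \<^class>\<open>ring_1\<close> together with a scalar multiplication. The axiom \<open>0 \<noteq> 1\<close> of that
  class only excludes the zero algebra, all of whose associated graded algebras are zero.
\<close>

locale assoc_algebra = vector_space scale
  for scale :: "'k::field \<Rightarrow> 'a::ring_1 \<Rightarrow> 'a" +
  assumes scale_mult_left: "scale c x * y = scale c (x * y)"
    and scale_mult_right: "x * scale c y = scale c (x * y)"

locale algebra_filtration = assoc_algebra scale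
  for scale :: "'k::field \<Rightarrow> 'a::ring_1 \<Rightarrow> 'a" +
  fixes V :: "nat \<Rightarrow> 'a set"
  assumes subspace_V: "subspace (V n)"
    and Union_V: "(\<Union>n. V n) = UNIV"
    and V_mono: "n \<le> m \<Longrightarrow> V n \<subseteq> V m"
    and V_mult: "x \<in> V n \<Longrightarrow> y \<in> V m \<Longrightarrow> x * y \<in> V (n + m)"
begin

definition growth :: "nat \<Rightarrow> nat" where
  "growth n = dim (V n)"

end

locale fd_algebra_filtration = algebra_filtration +
  assumes finite_dim_V: "\<exists>B. finite B \<and> span B = V n"


section \<open>The associated graded ring\<close>

definition below :: "(nat \<Rightarrow> 'a::zero set) \<Rightarrow> nat \<Rightarrow> 'a set" where
  "below V n = (case n of 0 \<Rightarrow> {0} | Suc m \<Rightarrow> V m)"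

definition add_group :: "'a::ring_1 set \<Rightarrow> 'a monoid" where
  "add_group S = \<lparr>carrier = S, monoid.mult = (+), one = 0\<rparr>"

definition gr_coset :: "(nat \<Rightarrow> 'a::ring_1 set) \<Rightarrow> nat \<Rightarrow> 'a \<Rightarrow> 'a set" where
  "gr_coset V n x = below V n #>\<^bsub>add_group (V n)\<^esub> x"

definition gr_piece :: "(nat \<Rightarrow> 'a::ring_1 set) \<Rightarrow> nat \<Rightarrow> 'a set monoid" where
  "gr_piece V n = add_group (V n) Mod below V n"

text \<open>
  The product of a class of degree \<open>i\<close> and a class of degree \<open>j\<close>, written as a union over all pairs of
  representatives. All cosets in the union coincide (lemma \<open>gr_times_coset\<close> below).
\<close>

definition gr_times :: "(nat \<Rightarrow> 'a::ring_1 set) \<Rightarrow> nat \<Rightarrow> nat \<Rightarrow> 'a set \<Rightarrow> 'a set \<Rightarrow> 'a set" where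
  "gr_times V i j S T = (\<Union>x\<in>S. \<Union>y\<in>T. gr_coset V (i + j) (x * y))"

text \<open>
  The additive group is the direct sum of the groups \<open>V n / V (n - 1)\<close>. Since these groups are
  written multiplicatively, \<open>finprod\<close> is the sum of the homogeneous products that contribute to
  degree \<open>n\<close>.
\<close>

definition gr :: "(nat \<Rightarrow> 'a::ring_1 set) \<Rightarrow> (nat \<Rightarrow> 'a set) ring" where
  "gr V = \<lparr>carrier = carrier (sum_group UNIV (gr_piece V)),
           monoid.mult = (\<lambda>f g n. finprod (gr_piece V n) (\<lambda>i. gr_times V i (n - i) (f i) (g (n - i))) {..n}),
           one = (\<lambda>n. if n = 0 then gr_coset V 0 1 else \<one>\<^bsub>gr_piece V n\<^esub>),
           zero = \<one>\<^bsub>sum_group UNIV (gr_piece V)\<^esub>,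
           add = monoid.mult (sum_group UNIV (gr_piece V))\<rparr>"

text \<open>HOL-Algebra's \<^locale>\<open>domain\<close> without commutativity.\<close>

locale nc_domain = ring R for R (structure) +
  assumes one_not_zero: "\<one> \<noteq> \<zero>"
    and integral: "\<lbrakk>x \<otimes> y = \<zero>; x \<in> carrier R; y \<in> carrier R\<rbrakk> \<Longrightarrow> x = \<zero> \<or> y = \<zero>"

text \<open>
  The associated graded ring of a filtration with \<open>1 \<in> V 0\<close> is indeed a ring. A family of representatives
  is encoded as a formal power series, so that the Cauchy product represents the product in \<open>gr V\<close>.
\<close>

context algebra_filtration
begin

lemma V_zero: "0 \<in> V n" and V_add: "x \<in> V n \<Longrightarrow> y \<in> V n \<Longrightarrow> x + y \<in> V n"
  and V_uminus: "x \<in> V n \<Longrightarrow> - x \<in> V n"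
  and V_diff: "x \<in> V n \<Longrightarrow> y \<in> V n \<Longrightarrow> x - y \<in> V n"
  by (rule subspace_0[OF subspace_V], rule subspace_add[OF subspace_V],
      assumption, assumption, rule subspace_neg[OF subspace_V], assumption,
      rule subspace_diff[OF subspace_V], assumption, assumption)

lemma below_zero: "0 \<in> below V n" and below_add: "x \<in> below V n \<Longrightarrow> y \<in> below V n \<Longrightarrow> x + y \<in> below V n"
  and below_uminus: "x \<in> below V n \<Longrightarrow> - x \<in> below V n"
  and below_V: "x \<in> below V n \<Longrightarrow> x \<in> V n"
  using V_zero V_add V_uminus V_mono[of "n - 1" n] by (auto simp: below_def split: nat.splits)

lemma below_diff: "x \<in> below V n \<Longrightarrow> y \<in> below V n \<Longrightarrow> x - y \<in> below V n"
  using below_add[of x n "- y"] below_uminus[of y n] by simp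

lemma below_mult_right: "x \<in> V i \<Longrightarrow> y \<in> below V j \<Longrightarrow> x * y \<in> below V (i + j)"
proof (cases j)
  case 0
  assume "x \<in> V i" "y \<in> below V j"
  with 0 show ?thesis using below_zero by (simp add: below_def)
next
  case (Suc m)
  assume "x \<in> V i" "y \<in> below V j"
  with Suc show ?thesis using V_mult[of x i y m] by (simp add: below_def)
qed

lemma below_mult_left: "x \<in> below V i \<Longrightarrow> y \<in> V j \<Longrightarrow> x * y \<in> below V (i + j)"
proof (cases i)
  case 0
  assume "x \<in> below V i" "y \<in> V j"
  with 0 show ?thesis using below_zero by (simp add: below_def)
next
  case (Suc m)
  assume "x \<in> below V i" "y \<in> V j"
  with Suc show ?thesis using V_mult[of x m y j] by (simp add: below_def)
qed

lemma gr_coset_mem: "z \<in> gr_coset V n x \<longleftrightarrow> z - x \<in> below V n"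
  unfolding gr_coset_def r_coset_def add_group_def by (auto intro!: bexI[of _ "z - x"])

lemma gr_coset_eq_iff: "gr_coset V n x = gr_coset V n y \<longleftrightarrow> x - y \<in> below V n"
proof
  assume "gr_coset V n x = gr_coset V n y"
  moreover have "x \<in> gr_coset V n x" by (simp add: gr_coset_mem below_zero)
  ultimately show "x - y \<in> below V n" by (simp add: gr_coset_mem)
next
  assume *: "x - y \<in> below V n"
  show "gr_coset V n x = gr_coset V n y"
  proof (rule Set.set_eqI)
    fix z
    show "z \<in> gr_coset V n x \<longleftrightarrow> z \<in> gr_coset V n y"
      using below_add[of "z - x" n "x - y"] below_diff[of "z - y" n "x - y"] *
      by (auto simp: gr_coset_mem)
  qed
qed

lemma comm_group_add_group: "comm_group (add_group (V n))"
proof (rule comm_groupI)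
  fix x assume "x \<in> carrier (add_group (V n))"
  then show "\<exists>y\<in>carrier (add_group (V n)). y \<otimes>\<^bsub>add_group (V n)\<^esub> x = \<one>\<^bsub>add_group (V n)\<^esub>"
    using V_uminus by (intro bexI[of _ "- x"]) (auto simp: add_group_def)
qed (auto simp: add_group_def V_add V_zero algebra_simps)

lemma subgroup_below: "subgroup (below V n) (add_group (V n))"
proof -
  interpret comm_group "add_group (V n)" by (rule comm_group_add_group)
  show ?thesis
  proof (rule subgroupI)
    fix x assume x: "x \<in> below V n"
    have "inv\<^bsub>add_group (V n)\<^esub> x = - x"
      using below_V[OF x] V_uminus by (intro inv_equality) (auto simp: add_group_def)
    then show "inv\<^bsub>add_group (V n)\<^esub> x \<in> below V n" using below_uminus[OF x] by simp
  qed (use below_V below_zero[of n] below_add in \<open>auto simp: add_group_def\<close>)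
qed

lemma comm_group_gr_piece: "comm_group (gr_piece V n)"
  unfolding gr_piece_def
  using comm_group.abelian_FactGroup[OF comm_group_add_group subgroup_below] .

lemma group_gr_piece: "group (gr_piece V n)"
  using comm_group_gr_piece comm_group.axioms(2) by blast

lemma carrier_gr_piece: "carrier (gr_piece V n) = gr_coset V n ` V n"
  by (auto simp: gr_piece_def carrier_FactGroup gr_coset_def add_group_def)

lemma one_gr_piece: "\<one>\<^bsub>gr_piece V n\<^esub> = gr_coset V n 0"
  by (auto simp: gr_piece_def gr_coset_mem)

lemma mult_gr_piece: "gr_coset V n x \<otimes>\<^bsub>gr_piece V n\<^esub> gr_coset V n y = gr_coset V n (x + y)"
proof (rule Set.set_eqI)
  fix z
  have "z \<in> gr_coset V n x \<otimes>\<^bsub>gr_piece V n\<^esub> gr_coset V n y \<longleftrightarrow>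
      (\<exists>u v. u - x \<in> below V n \<and> v - y \<in> below V n \<and> z = u + v)"
    by (simp add: gr_piece_def set_mult_def add_group_def gr_coset_mem Bex_def)
  also have "\<dots> \<longleftrightarrow> z - (x + y) \<in> below V n"
  proof
    assume "\<exists>u v. u - x \<in> below V n \<and> v - y \<in> below V n \<and> z = u + v"
    then obtain u v where "u - x \<in> below V n" "v - y \<in> below V n" "z = u + v" by blast
    then show "z - (x + y) \<in> below V n"
      using below_add[of "u - x" n "v - y"] by (simp add: algebra_simps)
  next
    assume "z - (x + y) \<in> below V n"
    then show "\<exists>u v. u - x \<in> below V n \<and> v - y \<in> below V n \<and> z = u + v"
      by (intro exI[of _ "z - y"] exI[of _ y]) (auto simp: below_zero algebra_simps)
  qed
  finally show "z \<in> gr_coset V n x \<otimes>\<^bsub>gr_piece V n\<^esub> gr_coset V n y \<longleftrightarrow> z \<in> gr_coset V n (x + y)"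
    by (simp add: gr_coset_mem)
qed

lemma gr_times_coset:
  assumes x: "x \<in> V i" and y: "y \<in> V j"
  shows "gr_times V i j (gr_coset V i x) (gr_coset V j y) = gr_coset V (i + j) (x * y)"
proof -
  have "gr_coset V (i + j) (u * v) = gr_coset V (i + j) (x * y)"
    if "u \<in> gr_coset V i x" "v \<in> gr_coset V j y" for u v
  proof -
    have u: "u - x \<in> below V i" and v: "v - y \<in> below V j"
      using that by (simp_all add: gr_coset_mem)
    have "v \<in> V j" using V_add[OF below_V[OF v] y] by simp
    then have "(u - x) * v + x * (v - y) \<in> below V (i + j)"
      using below_add below_mult_left[OF u] below_mult_right[OF x v] by blast
    then show ?thesis by (simp add: gr_coset_eq_iff algebra_simps)
  qed
  moreover have "x \<in> gr_coset V i x" "y \<in> gr_coset V j y"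
    by (simp_all add: gr_coset_mem below_zero)
  ultimately show ?thesis unfolding gr_times_def by blast
qed

lemma finprod_gr_piece:
  assumes "finite I" "\<And>i. i \<in> I \<Longrightarrow> x i \<in> V n"
  shows "finprod (gr_piece V n) (\<lambda>i. gr_coset V n (x i)) I = gr_coset V n (\<Sum>i\<in>I. x i)"
  using assms
proof (induction I rule: finite_induct)
  interpret comm_group "gr_piece V n" by (rule comm_group_gr_piece)
  { case empty then show ?case by (simp add: one_gr_piece) }
  { case (insert i I)
    then show ?case
      by (subst finprod_insert) (auto simp: carrier_gr_piece mult_gr_piece) }
qed

definition reps :: "'a fps set" where
  "reps = {F. (\<forall>n. fps_nth F n \<in> V n) \<and> finite {n. fps_nth F n \<noteq> 0}}"

definition gr_of :: "'a fps \<Rightarrow> nat \<Rightarrow> 'a set" where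
  "gr_of F n = gr_coset V n (fps_nth F n)"

lemma carrier_gr: "carrier (gr V) = gr_of ` reps"
proof (intro equalityI subsetI)
  fix f assume "f \<in> carrier (gr V)"
  then have f: "\<And>n. f n \<in> carrier (gr_piece V n)" "finite {n. f n \<noteq> \<one>\<^bsub>gr_piece V n\<^esub>}"
    by (auto simp: gr_def carrier_sum_group group_gr_piece)
  then have "\<forall>n. \<exists>x\<in>V n. f n = gr_coset V n x \<and> (f n = \<one>\<^bsub>gr_piece V n\<^esub> \<longrightarrow> x = 0)"
    unfolding carrier_gr_piece one_gr_piece using V_zero by blast
  then obtain x where x: "\<And>n. x n \<in> V n" "\<And>n. f n = gr_coset V n (x n)"
    "\<And>n. f n = \<one>\<^bsub>gr_piece V n\<^esub> \<Longrightarrow> x n = 0" by metis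
  have "finite {n. x n \<noteq> 0}" by (rule finite_subset[OF _ f(2)]) (use x(3) in auto)
  then have "Abs_fps x \<in> reps" using x(1) by (simp add: reps_def)
  moreover have "f = gr_of (Abs_fps x)" using x(2) by (auto simp: gr_of_def)
  ultimately show "f \<in> gr_of ` reps" by blast
next
  fix f assume "f \<in> gr_of ` reps"
  then obtain F where F: "F \<in> reps" "f = gr_of F" by blast
  have "finite {n. f n \<noteq> \<one>\<^bsub>gr_piece V n\<^esub>}"
    by (rule finite_subset[of _ "{n. fps_nth F n \<noteq> 0}"])
      (use F in \<open>auto simp: reps_def gr_of_def one_gr_piece\<close>)
  then show "f \<in> carrier (gr V)"
    using F by (auto simp: gr_def carrier_sum_group group_gr_piece carrier_gr_piece gr_of_def reps_def)
qed

lemma zero_gr: "\<zero>\<^bsub>gr V\<^esub> = gr_of 0"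
  by (auto simp: gr_def gr_of_def one_gr_piece)

lemma one_gr: "\<one>\<^bsub>gr V\<^esub> = gr_of 1"
  by (rule ext) (simp add: gr_def gr_of_def one_gr_piece)

lemma add_gr: "gr_of F \<oplus>\<^bsub>gr V\<^esub> gr_of G = gr_of (F + G)"
  by (auto simp: gr_def gr_of_def mult_gr_piece)

lemma mult_gr:
  assumes "F \<in> reps" "G \<in> reps"
  shows "gr_of F \<otimes>\<^bsub>gr V\<^esub> gr_of G = gr_of (F * G)"
proof
  fix n
  interpret comm_group "gr_piece V n" by (rule comm_group_gr_piece)
  have FG: "fps_nth F i * fps_nth G (n - i) \<in> V n" if "i \<le> n" for i
    using assms that V_mult[of "fps_nth F i" i "fps_nth G (n - i)" "n - i"] by (auto simp: reps_def)
  have "(gr_of F \<otimes>\<^bsub>gr V\<^esub> gr_of G) n =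
      finprod (gr_piece V n) (\<lambda>i. gr_times V i (n - i) (gr_of F i) (gr_of G (n - i))) {..n}"
    by (simp add: gr_def)
  also have "\<dots> = finprod (gr_piece V n) (\<lambda>i. gr_coset V n (fps_nth F i * fps_nth G (n - i))) {..n}"
  proof (rule finprod_cong', goal_cases)
    case 1 show ?case ..
  next
    case 2 show ?case using FG by (auto simp: carrier_gr_piece)
  next
    case (3 i)
    then show ?case
      using assms gr_times_coset[of "fps_nth F i" i "fps_nth G (n - i)" "n - i"]
      by (auto simp: reps_def gr_of_def)
  qed
  also have "\<dots> = gr_of (F * G) n"
    using FG by (subst finprod_gr_piece) (auto simp: gr_of_def fps_mult_nth atLeast0AtMost)
  finally show "(gr_of F \<otimes>\<^bsub>gr V\<^esub> gr_of G) n = gr_of (F * G) n" .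
qed

lemma reps_zero: "0 \<in> reps" and reps_one: "1 \<in> V 0 \<Longrightarrow> 1 \<in> reps"
  using V_zero by (auto simp: reps_def)

lemma reps_uminus: "F \<in> reps \<Longrightarrow> - F \<in> reps"
  using V_uminus by (auto simp: reps_def)

lemma reps_add:
  assumes "F \<in> reps" "G \<in> reps" shows "F + G \<in> reps"
proof -
  have "finite {n. fps_nth (F + G) n \<noteq> 0}"
    by (rule finite_subset[of _ "{n. fps_nth F n \<noteq> 0} \<union> {n. fps_nth G n \<noteq> 0}"])
      (use assms in \<open>auto simp: reps_def\<close>)
  then show ?thesis using assms V_add by (auto simp: reps_def)
qed

lemma reps_mult:
  assumes "F \<in> reps" "G \<in> reps" shows "F * G \<in> reps"
proof -
  let ?S = "\<lambda>F. {n. fps_nth F n \<noteq> (0::'a)}"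
  have "?S (F * G) \<subseteq> (\<lambda>(i, j). i + j) ` (?S F \<times> ?S G)"
  proof
    fix n assume "n \<in> ?S (F * G)"
    then obtain i where "i \<le> n" "fps_nth F i * fps_nth G (n - i) \<noteq> 0"
      by (auto simp: fps_mult_nth elim: sum.not_neutral_contains_not_neutral)
    then show "n \<in> (\<lambda>(i, j). i + j) ` (?S F \<times> ?S G)"
      by (intro image_eqI[of _ _ "(i, n - i)"]) auto
  qed
  then have "finite (?S (F * G))"
    by (rule finite_subset) (use assms in \<open>auto simp: reps_def\<close>)
  moreover have "fps_nth (F * G) n \<in> V n" for n
    unfolding fps_mult_nth
  proof (rule subspace_sum[OF subspace_V])
    fix i assume "i \<in> {0..n}"
    then show "fps_nth F i * fps_nth G (n - i) \<in> V n"
      using assms V_mult[of "fps_nth F i" i "fps_nth G (n - i)" "n - i"] by (auto simp: reps_def)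
  qed
  ultimately show ?thesis by (auto simp: reps_def)
qed

lemma ring_gr:
  assumes "1 \<in> V 0"
  shows "ring (gr V)"
proof (rule ringI)
  show "abelian_group (gr V)"
  proof (rule abelian_groupI)
    fix x assume "x \<in> carrier (gr V)"
    then obtain F where F: "F \<in> reps" "x = gr_of F" by (auto simp: carrier_gr)
    then show "\<exists>y\<in>carrier (gr V). y \<oplus>\<^bsub>gr V\<^esub> x = \<zero>\<^bsub>gr V\<^esub>"
      by (intro bexI[of _ "gr_of (- F)"]) (auto simp: add_gr zero_gr carrier_gr reps_uminus)
  qed (auto simp: carrier_gr add_gr zero_gr reps_zero reps_add algebra_simps)
  show "Group.monoid (gr V)"
    by (rule monoidI) (auto simp: carrier_gr mult_gr one_gr reps_one[OF assms] reps_mult mult.assoc)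
qed (auto simp: carrier_gr add_gr mult_gr reps_add reps_mult algebra_simps)

end


section \<open>Factorizations\<close>

definition unit :: "'a::ring_1 \<Rightarrow> bool" where
  "unit u \<longleftrightarrow> (\<exists>v. u * v = 1 \<and> v * u = 1)"

definition central_unit :: "'a::ring_1 \<Rightarrow> bool" where
  "central_unit u \<longleftrightarrow> unit u \<and> (\<forall>x. u * x = x * u)"

definition factorizations :: "'a::ring_1 \<Rightarrow> 'a list set" where
  "factorizations a = {xs. xs \<noteq> [] \<and> (\<forall>x\<in>set xs. \<not> unit x) \<and> prod_list xs = a}"

definition factorizations2 :: "'a::ring_1 \<Rightarrow> 'a list set" where
  "factorizations2 a = {xs \<in> factorizations a. length xs = 2}"

definition fact_equiv :: "('a::ring_1 list \<times> 'a list) set" where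
  "fact_equiv = {(xs, ys). list_all2 (\<lambda>x y. \<exists>u. central_unit u \<and> y = u * x) xs ys}"

lemma equiv_fact_equiv: "equiv UNIV (fact_equiv :: ('a::ring_1 list \<times> 'a list) set)"
proof -
  let ?R = "\<lambda>x y. \<exists>u::'a. central_unit u \<and> y = u * x"
  have refl: "?R x x" for x
    by (intro exI[of _ 1]) (auto simp: central_unit_def unit_def)
  have sym: "?R y x" if xy: "?R x y" for x y
  proof -
    obtain u v where u: "\<And>z. u * z = z * u" "u * v = 1" "v * u = 1" "y = u * x"
      using xy by (auto simp: central_unit_def unit_def)
    have "v * z = z * v" for z
    proof -
      have "v * z = v * (z * u) * v" using u(2) by (simp add: mult.assoc)
      also have "\<dots> = (v * u) * z * v" using u(1)[of z] by (simp add: mult.assoc)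
      finally show ?thesis using u(3) by simp
    qed
    moreover have "x = v * y" using u(3,4) by (simp flip: mult.assoc)
    ultimately show ?thesis using u(2,3) unfolding central_unit_def unit_def by blast
  qed
  have trans: "?R x z" if xy: "?R x y" and yz: "?R y z" for x y z
  proof -
    obtain u u' where u: "\<And>z. u * z = z * u" "u * u' = 1" "u' * u = 1" "y = u * x"
      using xy by (auto simp: central_unit_def unit_def)
    obtain v v' where v: "\<And>z. v * z = z * v" "v * v' = 1" "v' * v = 1" "z = v * y"
      using yz by (auto simp: central_unit_def unit_def)
    have "(v * u) * w = w * (v * u)" for w using u(1) v(1) by (metis mult.assoc)
    moreover have "(v * u) * (u' * v') = 1" "(u' * v') * (v * u) = 1"
      using u(2,3) v(2,3) by (metis mult.assoc mult_1_right)+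
    moreover have "z = (v * u) * x" using u(4) v(4) by (simp add: mult.assoc)
    ultimately show ?thesis unfolding central_unit_def unit_def by blast
  qed
  show ?thesis
  proof (rule equivI)
    show "refl (fact_equiv :: ('a list \<times> 'a list) set)"
      using refl by (auto simp: refl_on_def fact_equiv_def list_all2_conv_all_nth)
    show "sym (fact_equiv :: ('a list \<times> 'a list) set)"
      using sym by (auto simp: sym_def fact_equiv_def list_all2_conv_all_nth)
    show "trans (fact_equiv :: ('a list \<times> 'a list) set)"
      using list_all2_trans[of ?R ?R ?R] trans unfolding trans_def fact_equiv_def by blast
  qed simp
qed

text \<open>
  The quotient of a set of factorizations is taken by the restriction of \<open>fact_equiv\<close> to that
  set, so that its classes contain only factorizations of the given element.
\<close>

definition fact_classes :: "'a::ring_1 list set \<Rightarrow> 'a list set set" where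
  "fact_classes S = S // (fact_equiv \<inter> S \<times> S)"

end

(*
  Let x in V i and y in V j with x y = a. Up to scalars, the pair (x, y) is a point of a product of
  two projective spaces at which all but one of the bilinear forms given by the coordinates of the
  product vanish. All of these forms together have no common zero, because A is a domain.

  Consider the polynomial ring in p + q variables, bigraded by the degrees in the first p and the
  last q variables, and bilinear forms without a common zero. Projection from a generic point
  replaces them by p + q - 1 linear combinations that still have no common zero. By induction on
  p + q, the Hilbert function of the quotient is then at most that of a complete intersection: after
  all but the last form, linear forms of bidegree (1, 0) and (0, 1) are nonzerodivisors that cut the
  system down to fewer variables. Algebraic closedness enters because a pencil of linear maps
  between spaces of the same positive dimension has a singular member. Evaluations at the points
  above are independent functionals on the quotient by the vanishing forms in large degree, so there
  are at most 2^(p + q - 2) points, where p = dim V i and q = dim V j. Finally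
  dim V i + dim V j <= dim V (i + j) + 1.

  Longer factorizations are counted by recursion on the degree, splitting off the first factor.
*)
theory Submission
  imports Defs "HOL-Library.Function_Algebras"
begin

section \<open>Finite-dimensional subspaces\<close>

text \<open>Dimension theory is replaced by inequalities between Hilbert functions. Adding a form
  \<open>u\<close> to an ideal lowers the Hilbert function by at most its value at the degree
  shifted by that of \<open>u\<close>, and by exactly that much iff \<open>u\<close> acts
  injectively on the quotient there. So the known values for linear forms and an upper bound after
  all but one bilinear form determine what lies between, and equality of counts yields regularity.

  The obstacle is that zeros at which a whole block of variables vanishes are allowed. Off the
  diagonal the expected Hilbert function can be negative, so the estimates run along the staircase
  (0,0), (1,0), (1,1), (2,1), .... Injectivity of the last form is known at first only in large
  degree, where the full quotient vanishes, and is brought down by multiplying with a linear form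
  from each block.

  The constant comes from the expected series (1 - X Y)^t / ((1 - X)^p (1 - Y)^q): splitting 1 - X Y
  = (1 - X) + X (1 - Y) once per form doubles the number of terms. As p + q \<le> g + 1, where g is
  the growth at n, each degree of the first factor contributes at most 2^(g - 1).\<close>

locale lin_space = vector_space scale
  for scale :: "'a::field \<Rightarrow> 'b::ab_group_add \<Rightarrow> 'b"
begin

text \<open>The ambient spaces may be infinite-dimensional, and \<open>dim\<close> is monotone only
  below sets of this kind.\<close>

definition fin_dim :: "'b set \<Rightarrow> bool" where
  "fin_dim W \<longleftrightarrow> (\<exists>B. finite B \<and> W \<subseteq> span B)"

lemma fin_dim_mono: "fin_dim W \<Longrightarrow> V \<subseteq> span W \<Longrightarrow> fin_dim V"
  unfolding fin_dim_def by (metis span_mono span_span subset_trans)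

lemma fin_dim_finite: "finite B \<Longrightarrow> fin_dim B"
  unfolding fin_dim_def using span_superset by blast

lemma fin_dim_span: "fin_dim W \<Longrightarrow> fin_dim (span W)"
  by (rule fin_dim_mono) auto

lemma fin_dim_Un: "fin_dim V \<Longrightarrow> fin_dim W \<Longrightarrow> fin_dim (V \<union> W)"
proof -
  assume "fin_dim V" "fin_dim W"
  then obtain B C where "finite B" "V \<subseteq> span B" "finite C" "W \<subseteq> span C"
    unfolding fin_dim_def by blast
  then show ?thesis
    unfolding fin_dim_def by (intro exI[of _ "B \<union> C"]) (use span_mono in blast)
qed

lemma fin_dim_basis:
  assumes "fin_dim W"
  obtains B where "B \<subseteq> W" "independent B" "finite B" "W \<subseteq> span B" "card B = dim W"
proof -
  obtain C where C: "finite C" "W \<subseteq> span C" using assms fin_dim_def by blast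
  obtain B where B: "B \<subseteq> W" "independent B" "W \<subseteq> span B" "card B = dim W"
    using basis_exists by blast
  have "finite B" using independent_span_bound[of C B] B C by blast
  then show ?thesis using that B by blast
qed

lemma dim_mono_fin: "V \<subseteq> span W \<Longrightarrow> fin_dim W \<Longrightarrow> dim V \<le> dim W"
  by (metis dim_le_card fin_dim_basis span_mono span_span subset_trans)

lemma dim_insert_fin:
  assumes "fin_dim S" "v \<notin> span S"
  shows "dim (insert v S) = Suc (dim S)"
proof -
  obtain B where B: "B \<subseteq> S" "independent B" "finite B" "S \<subseteq> span B" "card B = dim S"
    using fin_dim_basis[OF assms(1)] .
  have sp: "span B = span S" using span_mono[OF B(1)] span_mono[OF B(4)] unfolding span_span by blast
  have "v \<notin> span B" using assms sp by simp
  then have "independent (insert v B)" "v \<notin> B" using B independent_insertI span_base by auto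
  then have "dim (insert v B) = Suc (dim S)" using B by (simp add: dim_eq_card_independent)
  moreover have "span (insert v B) = span (insert v S)"
    by (metis sp span_insert)
  ultimately show ?thesis by (metis span_eq_dim)
qed

lemma subspace_eq_if_dim_le:
  assumes "subspace V" "V \<subseteq> W" "fin_dim W" "dim W \<le> dim V"
  shows "V = W"
proof (rule ccontr)
  assume "V \<noteq> W"
  then obtain w where w: "w \<in> W" "w \<notin> span V" using assms(2) iffD2[OF span_eq_iff assms(1)] by auto
  have fV: "fin_dim V" using assms fin_dim_mono span_superset by blast
  have "Suc (dim V) = dim (insert w V)" using dim_insert_fin[OF fV w(2)] by simp
  also have "\<dots> \<le> dim W" by (rule dim_mono_fin) (use assms w span_superset in auto)
  finally show False using assms by simp
qed

text \<open>This is rank-nullity for the map that \<open>\<phi>\<close> induces into the quotient by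
  \<open>U\<close>, without forming the quotient: the first dimension is that of \<open>U\<close>
  plus the rank, the second that of the kernel.\<close>

lemma dim_Un_image_basis:
  assumes "Vector_Spaces.linear scale scale \<phi>" "fin_dim U" "subspace U" "finite B" "independent B"
  shows "dim (U \<union> \<phi> ` span B) + dim {w \<in> span B. \<phi> w \<in> U} = dim U + card B"
  using assms(4,5)
proof (induction B rule: finite_induct)
  interpret \<phi>: Vector_Spaces.linear scale scale \<phi> by fact
  case empty
  have "dim (U \<union> {0}) = dim U"
    by (rule span_eq_dim) (use assms subspace_0 in \<open>simp add: insert_absorb\<close>)
  moreover have "dim {0} = 0" using dim_span[of "{}"] dim_eq_card_independent[OF independent_empty]
    by (metis card.empty span_empty)
  moreover have "{w \<in> {0}. \<phi> w \<in> U} = {0}" using assms subspace_0 by auto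
  ultimately show ?case by simp
next
  interpret \<phi>: Vector_Spaces.linear scale scale \<phi> by fact
  case (insert b B)
  then have iB: "independent B" and b: "b \<notin> span B"
    using independent_insert[of b B] by auto
  define S where "S = U \<union> \<phi> ` span B"
  define K where "K = {w \<in> span B. \<phi> w \<in> U}"
  define K' where "K' = {w \<in> span (insert b B). \<phi> w \<in> U}"
  have IH: "dim S + dim K = dim U + card B" using insert.IH[OF iB] by (simp add: S_def K_def)
  have fS: "fin_dim S" unfolding S_def
  proof (rule fin_dim_Un)
    have "fin_dim (\<phi> ` B)" using insert by (simp add: fin_dim_finite)
    then show "fin_dim (\<phi> ` span B)"
      by (rule fin_dim_mono) (simp add: \<phi>.span_image)
  qed fact
  have fK: "fin_dim K" by (rule fin_dim_mono[OF fin_dim_finite[of B]]) (use insert K_def in auto)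
  have sub: "subspace (\<phi> ` span B)" by (simp add: \<phi>.subspace_image)
  have spS: "span S = {x + y |x y. x \<in> U \<and> y \<in> \<phi> ` span B}"
    unfolding S_def span_Un using assms(3) sub by (metis span_eq_iff)
  have subK: "subspace K" unfolding K_def
    using assms(3) by (intro subspaceI)
      (auto simp: span_zero span_add span_scale \<phi>.add \<phi>.scale \<phi>.zero subspace_0 subspace_add subspace_scale)
  have "span (U \<union> \<phi> ` span (insert b B)) = span (insert (\<phi> b) S)"
  proof (subst span_eq, intro conjI)
    show "U \<union> \<phi> ` span (insert b B) \<subseteq> span (insert (\<phi> b) S)"
    proof
      fix x assume "x \<in> U \<union> \<phi> ` span (insert b B)"
      then consider "x \<in> U" | w where "x = \<phi> w" "w \<in> span (insert b B)" by blast
      then show "x \<in> span (insert (\<phi> b) S)"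
      proof cases
        case 1 then show ?thesis unfolding S_def by (simp add: span_base)
      next
        case 2
        then obtain k where "w - scale k b \<in> span B" by (auto simp: span_insert)
        then have "\<phi> (w - scale k b) \<in> span S" unfolding S_def by (simp add: span_base)
        then show ?thesis using 2 by (auto simp: span_insert \<phi>.diff \<phi>.scale)
      qed
    qed
    show "insert (\<phi> b) S \<subseteq> span (U \<union> \<phi> ` span (insert b B))"
      unfolding S_def using span_base[of b "insert b B"] span_mono[of B "insert b B"]
      by (auto intro!: span_base)
  qed
  then have d: "dim (U \<union> \<phi> ` span (insert b B)) = dim (insert (\<phi> b) S)" by (rule span_eq_dim)
  \<comment> \<open>A new basis vector \<open>b\<close> raises exactly one of the two dimensions:
    the image grows if \<open>\<phi> b\<close> is new, and otherwise the kernel gains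
    \<open>b - w\<close> for a suitable \<open>w\<close> in the span of \<open>B\<close>.\<close>
  have "dim (insert (\<phi> b) S) + dim K' = Suc (dim S + dim K)"
  proof (cases "\<phi> b \<in> span S")
    case True
    then obtain u w where uw: "u \<in> U" "w \<in> span B" "\<phi> b = u + \<phi> w" using spS by auto
    have "b - w \<notin> span B" using b uw(2) span_add[of "b - w" B w] by auto
    then have nK: "b - w \<notin> span K" unfolding iffD2[OF span_eq_iff subK] by (simp add: K_def)
    have "span (insert (b - w) K) = K'"
    proof (rule span_subspace)
      show "subspace K'" unfolding K'_def
        using assms(3) by (intro subspaceI)
         (auto simp: span_zero span_add span_scale \<phi>.add \<phi>.scale \<phi>.zero subspace_0 subspace_add subspace_scale)
      have "b - w \<in> span (insert b B)" "span B \<subseteq> span (insert b B)"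
        using uw span_mono[of B "insert b B"] by (auto intro!: span_diff intro: span_base)
      then show "insert (b - w) K \<subseteq> K'" using uw by (auto simp: K'_def K_def \<phi>.diff)
      show "K' \<subseteq> span (insert (b - w) K)"
      proof
        fix v assume v: "v \<in> K'"
        then obtain k where k: "v - scale k b \<in> span B" by (auto simp: K'_def span_insert)
        have 0: "v - scale k (b - w) = (v - scale k b) + scale k w" by (simp add: scale_right_diff_distrib)
        have 1: "v - scale k (b - w) \<in> span B"
          by (subst 0) (rule span_add[OF k span_scale[OF uw(2)]])
        have "\<phi> (v - scale k (b - w)) = \<phi> v - scale k u" using uw by (simp add: \<phi>.diff \<phi>.scale)
        then have "\<phi> (v - scale k (b - w)) \<in> U"
          using v uw assms(3) by (simp add: K'_def subspace_diff subspace_scale)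
        then have "v - scale k (b - w) \<in> span K" using 1 by (simp add: K_def span_base)
        then show "v \<in> span (insert (b - w) K)" by (auto simp: span_insert)
      qed
    qed
    then have "dim K' = dim (insert (b - w) K)" by (metis dim_span)
    then have "dim K' = Suc (dim K)" using dim_insert_fin[OF fK nK] by simp
    moreover have "dim (insert (\<phi> b) S) = dim S"
      using True by (intro span_eq_dim) (simp add: span_redundant)
    ultimately show ?thesis by simp
  next
    case False
    have "K' = K"
    proof (intro equalityI subsetI)
      fix v assume v: "v \<in> K'"
      then obtain k where k: "v - scale k b \<in> span B" by (auto simp: K'_def span_insert)
      have "k = 0"
      proof (rule ccontr)
        assume "k \<noteq> 0"
        have "\<phi> (v - scale k b) \<in> span S" using k unfolding S_def by (simp add: span_base)
        moreover have "\<phi> v \<in> span S" using v unfolding S_def K'_def by (simp add: span_base)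
        ultimately have "\<phi> v - \<phi> (v - scale k b) \<in> span S" by (rule span_diff[rotated])
        then have "scale k (\<phi> b) \<in> span S" by (simp add: \<phi>.diff \<phi>.scale)
        from span_scale[OF this, of "inverse k"]
        show False using False \<open>k \<noteq> 0\<close> by simp
      qed
      then show "v \<in> K" using v k by (simp add: K_def K'_def)
    qed (use span_mono[of B "insert b B"] in \<open>auto simp: K_def K'_def\<close>)
    then show ?thesis using dim_insert_fin[OF fS False] by simp
  qed
  then show ?case using IH insert d by (simp add: K'_def)
qed

lemma dim_Un_image:
  assumes "Vector_Spaces.linear scale scale \<phi>" "fin_dim U" "subspace U" "fin_dim W" "subspace W"
  shows "dim (U \<union> \<phi> ` W) + dim {w \<in> W. \<phi> w \<in> U} = dim U + dim W"
proof -
  obtain B where B: "B \<subseteq> W" "independent B" "finite B" "W \<subseteq> span B" "card B = dim W"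
    using fin_dim_basis[OF assms(4)] .
  have "span B = W" using B assms(5) by (intro span_subspace)
  then show ?thesis using dim_Un_image_basis[OF assms(1-3) B(3,2)] B(5) by simp
qed

text \<open>Independence modulo \<open>U\<close> of one vector more than
  \<open>dim W - dim U\<close> would exceed \<open>dim W\<close>. The least dependent index is taken
  because \<open>shift_eigenvector\<close> also needs the independence of the earlier
  vectors.\<close>

lemma first_dependency:
  fixes w :: "nat \<Rightarrow> 'b"
  assumes "fin_dim W" "subspace W" "subspace U" "U \<subseteq> W"
    and w: "\<And>i. i \<le> dim W - dim U \<Longrightarrow> w i \<in> W"
  obtains t where "t \<le> dim W - dim U" "w t \<in> span (U \<union> w ` {..<t})"
    "\<And>i. i < t \<Longrightarrow> w i \<notin> span (U \<union> w ` {..<i})"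
proof -
  define T where "T = dim W - dim U"
  have fU: "fin_dim U" using assms fin_dim_mono span_superset by blast
  have "\<exists>t\<le>T. w t \<in> span (U \<union> w ` {..<t})"
  proof (rule ccontr)
    assume "\<not> ?thesis"
    then have n: "\<And>t. t \<le> T \<Longrightarrow> w t \<notin> span (U \<union> w ` {..<t})" by auto
    have "dim (U \<union> w ` {..<t}) = dim U + t" if "t \<le> Suc T" for t
      using that
    proof (induction t)
      case (Suc t)
      have "U \<union> w ` {..<Suc t} = insert (w t) (U \<union> w ` {..<t})" by (auto simp: lessThan_Suc)
      moreover have "fin_dim (U \<union> w ` {..<t})" by (simp add: fU fin_dim_Un fin_dim_finite)
      ultimately show ?case using Suc n dim_insert_fin by simp
    qed simp
    then have "dim (U \<union> w ` {..<Suc T}) = dim U + Suc T" by blast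
    moreover have "dim (U \<union> w ` {..<Suc T}) \<le> dim W"
    proof (rule dim_mono_fin)
      have "U \<union> w ` {..<Suc T} \<subseteq> W" using assms(4) w by (auto simp: T_def)
      then show "U \<union> w ` {..<Suc T} \<subseteq> span W" using span_superset by blast
    qed fact
    ultimately show False by (simp add: T_def)
  qed
  then have ex: "\<exists>t. t \<le> T \<and> w t \<in> span (U \<union> w ` {..<t})" by blast
  define t where "t = (LEAST t. t \<le> T \<and> w t \<in> span (U \<union> w ` {..<t}))"
  have t: "t \<le> T \<and> w t \<in> span (U \<union> w ` {..<t})" unfolding t_def by (rule LeastI_ex[OF ex])
  have "w i \<notin> span (U \<union> w ` {..<i})" if "i < t" for i
    using not_less_Least[OF that[unfolded t_def]] that t by simp
  then show ?thesis using that t T_def by blast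
qed

lemma in_span_Un_image_lessThan:
  fixes t :: nat
  assumes "x \<in> span (U \<union> w ` {..<t})" "subspace U"
  obtains c where "x - (\<Sum>i<t. scale (c i) (w i)) \<in> U"
proof -
  have "\<exists>c. x - (\<Sum>i<t. scale (c i) (w i)) \<in> U"
    using assms(1)
  proof (induction t arbitrary: x)
    case 0 then show ?case using assms(2) by (metis image_empty lessThan_0 Un_empty_right span_eq_iff sum.empty diff_zero)
  next
    case (Suc t)
    have "U \<union> w ` {..<Suc t} = insert (w t) (U \<union> w ` {..<t})" by (auto simp: lessThan_Suc)
    then obtain k where "x - scale k (w t) \<in> span (U \<union> w ` {..<t})"
      using Suc.prems by (auto simp: span_insert)
    then obtain c where "x - scale k (w t) - (\<Sum>i<t. scale (c i) (w i)) \<in> U" using Suc.IH by blast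
    then show ?case by (intro exI[of _ "c(t := k)"]) (simp add: algebra_simps)
  qed
  then show ?thesis using that by blast
qed

lemma dependency:
  fixes w :: "nat \<Rightarrow> 'b"
  assumes "fin_dim W" "subspace W" "subspace U" "U \<subseteq> W" "dim W < T + dim U"
    and w: "\<And>i. i < T \<Longrightarrow> w i \<in> W"
  obtains c where "(\<Sum>i<T. scale (c i) (w i)) \<in> U" "\<exists>i<T. c i \<noteq> 0"
proof -
  have "dim U \<le> dim W" using assms span_superset by (intro dim_mono_fin) auto
  then have T: "dim W - dim U < T" using assms by simp
  obtain t where t: "t \<le> dim W - dim U" "w t \<in> span (U \<union> w ` {..<t})"
    using first_dependency[OF assms(1-4), of w] w T by (metis order.strict_trans1)
  obtain c where c: "w t - (\<Sum>i<t. scale (c i) (w i)) \<in> U"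
    using in_span_Un_image_lessThan[OF t(2) assms(3)] .
  define c' where "c' i = (if i < t then - c i else if i = t then 1 else 0)" for i
  have "t < T" using t T by simp
  have "(\<Sum>i<T. scale (c' i) (w i)) = (\<Sum>i<Suc t. scale (c' i) (w i))"
    using \<open>t < T\<close> by (intro sum.mono_neutral_right) (auto simp: c'_def)
  also have "\<dots> = w t - (\<Sum>i<t. scale (c i) (w i))"
    by (simp add: c'_def sum_negf)
  finally have "(\<Sum>i<T. scale (c' i) (w i)) \<in> U" using c by simp
  moreover have "c' t \<noteq> 0" by (simp add: c'_def)
  ultimately show ?thesis using that \<open>t < T\<close> by blast
qed

end

text \<open>Here \<open>c\<close> lists the lower coefficients of a monic polynomial of degree
  \<open>t\<close>, \<open>\<tau>\<close> is a root, and \<open>d\<close> lists the coefficients of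
  the quotient by X - \<open>\<tau>\<close>.\<close>

lemma monic_root_factor:
  fixes t :: nat and c :: "nat \<Rightarrow> 'k::alg_closed_field"
  assumes "0 < t"
  obtains \<tau> d where "d (t - 1) = 1" "c 0 = - \<tau> * d 0"
    "\<And>i. 0 < i \<Longrightarrow> i < t \<Longrightarrow> c i = d (i - 1) - \<tau> * d i"
proof -
  define p where "p = monom 1 t + (\<Sum>i<t. monom (c i) i)"
  have cp: "coeff p i = (if i = t then 1 else if i < t then c i else 0)" for i
    by (simp add: p_def coeff_sum)
  have dp: "degree p = t"
    by (rule antisym) (auto intro!: degree_le le_degree simp: cp)
  then obtain \<tau> where "poly p \<tau> = 0" using alg_closed_imp_poly_has_root assms by blast
  then obtain q where q: "p = [:- \<tau>, 1:] * q" by (metis dvdE poly_eq_0_iff_dvd)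
  have cq: "coeff p i = (if i = 0 then 0 else coeff q (i - 1)) - \<tau> * coeff q i" for i
    by (simp add: q coeff_pCons split: nat.splits)
  have "q \<noteq> 0" using dp q assms by auto
  then have "degree p = Suc (degree q)" unfolding q by (subst degree_mult_eq) auto
  then have "coeff q t = 0" using dp by (simp add: coeff_eq_0)
  then have "coeff q (t - 1) = 1" using cq[of t] cp[of t] assms by simp
  moreover have "c 0 = - \<tau> * coeff q 0" using cq[of 0] cp[of 0] assms by simp
  moreover have "c i = coeff q (i - 1) - \<tau> * coeff q i" if "0 < i" "i < t" for i
    using cq[of i] cp[of i] that by simp
  ultimately show ?thesis using that by blast
qed

text \<open>If \<open>w\<close> is the orbit of \<open>w 0\<close> under a linear map, this produces
  an eigenvector modulo \<open>U\<close> from the minimal polynomial of \<open>w 0\<close>. The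
  argument only uses the sequence, so the shift need not come from a linear map. Since
  \<open>d (t - 1) = 1\<close> and \<open>t\<close> is the first dependent index, the combination is
  not in \<open>U\<close>. Algebraic closedness enters as the last assumption, which
  \<open>monic_root_factor\<close> supplies.\<close>

lemma (in lin_space) shift_eigenvector:
  fixes w :: "nat \<Rightarrow> 'b"
  assumes "fin_dim W" "subspace W" "subspace U" "U \<subseteq> W" "\<And>i. w i \<in> W" "w 0 \<notin> U"
    and ac: "\<And>(t::nat) c. 0 < t \<Longrightarrow> \<exists>\<tau> d. d (t - 1) = (1::'a) \<and> c 0 = - \<tau> * d 0 \<and>
        (\<forall>i. 0 < i \<longrightarrow> i < t \<longrightarrow> c i = d (i - 1) - \<tau> * d i)"
  obtains \<tau> d t where "(\<Sum>i<t. scale (d i) (w i)) \<notin> U"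
    "(\<Sum>i<t. scale (d i) (w (Suc i) - scale \<tau> (w i))) \<in> U"
proof -
  obtain t where t: "w t \<in> span (U \<union> w ` {..<t})"
      "\<And>i. i < t \<Longrightarrow> w i \<notin> span (U \<union> w ` {..<i})"
    using first_dependency[OF assms(1-4), of w] assms(5) by metis
  have "t \<noteq> 0" using t(1) assms(3,6) by (metis image_empty lessThan_0 Un_empty_right span_eq_iff)
  then obtain s where s: "t = Suc s" by (cases t) auto
  obtain c where c: "w t - (\<Sum>i<t. scale (c i) (w i)) \<in> U"
    using in_span_Un_image_lessThan[OF t(1) assms(3)] .
  obtain \<tau> d where d: "d s = 1" "- c 0 = - \<tau> * d 0"
    "\<And>i. 0 < i \<Longrightarrow> i < t \<Longrightarrow> - c i = d (i - 1) - \<tau> * d i"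
    using ac[of t "\<lambda>i. - c i"] s by auto
  have "(\<Sum>i<t. scale (d i) (w (Suc i) - scale \<tau> (w i))) = w t - (\<Sum>i<t. scale (c i) (w i))"
  proof -
    have "(\<Sum>i<t. scale (d i) (w (Suc i) - scale \<tau> (w i))) =
        (\<Sum>i<t. scale (d i) (w (Suc i))) - (\<Sum>i<t. scale (\<tau> * d i) (w i))"
      by (simp add: scale_right_diff_distrib sum_subtractf mult.commute)
    also have "(\<Sum>i<t. scale (d i) (w (Suc i))) = w t + (\<Sum>i<s. scale (d i) (w (Suc i)))"
      using d(1) by (simp add: s)
    also have "(\<Sum>i<t. scale (\<tau> * d i) (w i)) =
        scale (\<tau> * d 0) (w 0) + (\<Sum>i<s. scale (\<tau> * d (Suc i)) (w (Suc i)))"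
      by (simp add: s sum.lessThan_Suc_shift del: sum.lessThan_Suc)
    finally have 1: "(\<Sum>i<t. scale (d i) (w (Suc i) - scale \<tau> (w i))) =
       w t - scale (\<tau> * d 0) (w 0) + (\<Sum>i<s. scale (d i - \<tau> * d (Suc i)) (w (Suc i)))"
      by (simp add: algebra_simps sum_subtractf)
    have "(\<Sum>i<s. scale (d i - \<tau> * d (Suc i)) (w (Suc i))) = (\<Sum>i<s. scale (- c (Suc i)) (w (Suc i)))"
      by (rule sum.cong) (use d(3) s in \<open>auto simp: d(3)\<close>)
    then show ?thesis using 1 d(2) by (simp add: s sum.lessThan_Suc_shift sum_negf del: sum.lessThan_Suc)
  qed
  then have "(\<Sum>i<t. scale (d i) (w (Suc i) - scale \<tau> (w i))) \<in> U" using c by simp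
  moreover have "(\<Sum>i<t. scale (d i) (w i)) \<notin> U"
  proof
    assume "(\<Sum>i<t. scale (d i) (w i)) \<in> U"
    then have "(\<Sum>i<t. scale (d i) (w i)) \<in> span (U \<union> w ` {..<s})" by (simp add: span_base)
    moreover have "(\<Sum>i<s. scale (d i) (w i)) \<in> span (U \<union> w ` {..<s})"
      by (intro span_sum span_scale span_base) auto
    ultimately have "(\<Sum>i<t. scale (d i) (w i)) - (\<Sum>i<s. scale (d i) (w i)) \<in> span (U \<union> w ` {..<s})"
      by (rule span_diff)
    then show False using t(2)[of s] d(1) by (simp add: s)
  qed
  ultimately show ?thesis using that by blast
qed


section \<open>Bigraded algebras\<close>

text \<open>The number of monomials of degree \<open>e\<close> in \<open>p\<close> variables;
  truncated subtraction makes the case \<open>p = 0\<close> come out right.\<close>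

definition nmon :: "nat \<Rightarrow> nat \<Rightarrow> nat" where
  "nmon p e = (e + p - 1) choose e"

lemma nmon_simps [simp]:
  "nmon 0 0 = 1" "nmon 0 (Suc e) = 0" "nmon p 0 = 1" "nmon p (Suc 0) = p"
  "nmon (Suc p) (Suc e) = nmon p (Suc e) + nmon (Suc p) e"
  by (simp_all add: nmon_def)

lemma nmon_1 [simp]: "nmon (Suc 0) e = 1"
  by (simp add: nmon_def)

text \<open>What matters is the exponent, one less than the number of variables: it decides the
  comparison of growth rates in \<open>point_off_image\<close>.\<close>

lemma nmon_le: "nmon (Suc p) e \<le> (e + 1) ^ p"
proof (induction p arbitrary: e)
  case (Suc p)
  show ?case
  proof (induction e)
    case (Suc e)
    have "nmon (Suc (Suc p)) (Suc e) \<le> (Suc e + 1) ^ p + (e + 1) ^ Suc p"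
      using Suc Suc.prems \<open>\<And>e. nmon (Suc p) e \<le> (e + 1) ^ p\<close>[of "Suc e"] by simp
    also have "(e + 1) ^ Suc p \<le> (e + 1) * (Suc e + 1) ^ p"
      unfolding power_Suc by (intro mult_left_mono power_mono) auto
    also have "(Suc e + 1) ^ p + (e + 1) * (Suc e + 1) ^ p = (Suc e + 1) ^ Suc p" by simp
    finally show ?case by simp
  qed simp
qed simp

text \<open>
  The bigraded Hilbert function that a regular sequence of \<open>t\<close> forms of bidegree \<open>(1, 1)\<close> in
  \<open>p + q\<close> variables would have.
\<close>

fun ehilb :: "nat \<Rightarrow> nat \<Rightarrow> nat \<Rightarrow> nat \<Rightarrow> nat \<Rightarrow> int" where
  "ehilb 0 p q e f = int (nmon p e * nmon q f)"
| "ehilb (Suc t) p q (Suc e) (Suc f) = ehilb t p q (Suc e) (Suc f) - ehilb t p q e f"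
| "ehilb (Suc t) p q 0 f = ehilb t p q 0 f"
| "ehilb (Suc t) p q e 0 = ehilb t p q e 0"

section \<open>Identities and bounds for the expected Hilbert function\<close>

lemma ehilb_Suc_0 [simp]: "ehilb (Suc t) p q e 0 = ehilb t p q e 0"
  by (cases e) auto

lemma ehilb_0 [simp]: "ehilb t p q e 0 = int (nmon p e)" "ehilb t p q 0 f = int (nmon q f)"
  by (induction t) auto

text \<open>The series changes by a factor 1 - Y, which is the effect of a regular linear form in
  the second block.\<close>

lemma ehilb_right: "ehilb t p (Suc q) e (Suc f) = ehilb t p q e (Suc f) + ehilb t p (Suc q) e f"
proof (induction t arbitrary: e f)
  case 0 show ?case by (simp add: algebra_simps)
next
  case (Suc t)
  show ?case
  proof (cases e)
    case e: (Suc e')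
    show ?thesis using Suc[of "Suc e'" f] Suc[of e'] by (cases f) (simp_all add: e)
  qed simp
qed

lemma ehilb_commute: "ehilb t p q e f = ehilb t q p f e"
proof (induction t arbitrary: e f)
  case (Suc t) then show ?case by (cases e; cases f) auto
qed simp

lemma ehilb_left: "ehilb t (Suc p) q (Suc e) f = ehilb t p q (Suc e) f + ehilb t (Suc p) q e f"
  using ehilb_right[of t q p f e] by (simp add: ehilb_commute[of t q])

text \<open>On the series (1 - X Y)^t / ((1 - X)^p (1 - Y)^q) this is the identity 1 - X Y = (1 - X)
  + X (1 - Y).\<close>

lemma ehilb_split: "ehilb (Suc t) (Suc p) (Suc q) (Suc e) (Suc f) =
    ehilb t p (Suc q) (Suc e) (Suc f) + ehilb t (Suc p) q e (Suc f)"
  by (simp add: ehilb_left[of t p "Suc q" e "Suc f"] ehilb_right[of t "Suc p" q e f])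

lemma ehilb_zero_left: "t < e \<Longrightarrow> t < f \<Longrightarrow> ehilb t 0 q e f = 0"
proof (induction t arbitrary: e f)
  case 0 then show ?case by (cases e) auto
next
  case (Suc t) then show ?case by (cases e; cases f) auto
qed

lemma ehilb_zero_right: "t < e \<Longrightarrow> t < f \<Longrightarrow> ehilb t p 0 e f = 0"
  using ehilb_zero_left[of t f e p] by (simp add: ehilb_commute[of t p])

lemma ehilb_eq_0: "p + q \<le> Suc t \<Longrightarrow> t < e \<Longrightarrow> t < f \<Longrightarrow> ehilb t p q e f = 0"
proof (induction t arbitrary: p q e f)
  case 0
  then have "p = 0 \<or> q = 0" by auto
  then show ?case using ehilb_zero_left[of 0 e f q] ehilb_zero_right[of 0 e f p] 0 by auto
next
  case (Suc t)
  show ?case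
  proof (cases "p = 0 \<or> q = 0")
    case True then show ?thesis using ehilb_zero_left ehilb_zero_right Suc.prems by auto
  next
    case False
    then obtain p' q' where pq: "p = Suc p'" "q = Suc q'" by (metis not0_implies_Suc)
    obtain e' f' where ef: "e = Suc e'" "f = Suc f'" using Suc.prems by (cases e; cases f) auto
    show ?thesis using Suc.prems Suc.IH[of p' q e f] Suc.IH[of p q' e' f]
      unfolding pq ef by (subst ehilb_split) simp
  qed
qed

text \<open>\<open>ehilb_split\<close> trades one form and one variable for two terms; with no form
  left the value is at most 1. The degrees must exceed \<open>t\<close> so that they are still
  positive whenever a block runs out of variables.\<close>

lemma ehilb_le: "p + q \<le> t + 2 \<Longrightarrow> t < e \<Longrightarrow> t < f \<Longrightarrow> ehilb t p q e f \<le> 2 ^ t"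
proof (induction t arbitrary: p q e f)
  case 0
  show ?case
  proof (cases "p = 0 \<or> q = 0")
    case True then show ?thesis using ehilb_zero_left[of 0 e f q] ehilb_zero_right[of 0 e f p] 0 by auto
  next
    case False
    then have "p = Suc 0" "q = Suc 0" using 0 by auto
    then show ?thesis by simp
  qed
next
  case (Suc t)
  show ?case
  proof (cases "p = 0 \<or> q = 0")
    case True
    then have "ehilb (Suc t) p q e f = 0" using ehilb_zero_left ehilb_zero_right Suc.prems by auto
    then show ?thesis by simp
  next
    case False
    then obtain p' q' where pq: "p = Suc p'" "q = Suc q'" by (metis not0_implies_Suc)
    obtain e' f' where ef: "e = Suc e'" "f = Suc f'" using Suc.prems by (cases e; cases f) auto
    show ?thesis using Suc.prems Suc.IH[of p' q e f] Suc.IH[of p q' e' f]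
      unfolding pq ef by (subst ehilb_split) simp
  qed
qed

text \<open>For \<open>f \<le> e\<close> the factor 1 / (1 - X) collects every power of X that can
  occur, as if X = 1, and what remains is (1 - Y)^t / (1 - Y)^q.\<close>

lemma ehilb_1_left: "f \<le> e \<Longrightarrow> t \<le> q \<Longrightarrow> ehilb t (Suc 0) q e f = int (nmon (q - t) f)"
proof (induction t arbitrary: e f)
  case (Suc t)
  show ?case
  proof (cases f)
    case (Suc f')
    then obtain e' where e: "e = Suc e'" using Suc.prems by (cases e) auto
    obtain r where "q - t = Suc r" using Suc.prems by (cases "q - t") auto
    moreover from this have "q - Suc t = r" by simp
    ultimately show ?thesis using Suc.IH[of f e] Suc.IH[of f' e'] Suc.prems e \<open>f = Suc f'\<close> by simp
  qed simp
qed simp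

lemma ehilb_1_right: "e \<le> f \<Longrightarrow> t \<le> p \<Longrightarrow> ehilb t p (Suc 0) e f = int (nmon (p - t) e)"
  using ehilb_1_left[of e f t p] by (simp add: ehilb_commute[of t p])

text \<open>Division of the series by 1 - X Y; the sum telescopes.\<close>

lemma sum_ehilb_diag: "(\<Sum>i\<le>f. ehilb (Suc t) p q i i) = ehilb t p q f f"
  by (induction f) auto

text \<open>The bound at \<open>M\<close> is carried down to all \<open>t\<close> by adding
  \<open>h t f\<close>, for which the bound is already known. Then the bound at 0 is carried up:
  here \<open>h t f\<close> is subtracted, so the upper bound just obtained is what is
  needed.\<close>

lemma difference_sandwich:
  fixes h E :: "nat \<Rightarrow> nat \<Rightarrow> int"
  assumes h0: "\<And>t. t < M \<Longrightarrow> h t 0 \<le> h (Suc t) 0"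
    and hS: "\<And>t f. t < M \<Longrightarrow> h t (Suc f) \<le> h (Suc t) (Suc f) + h t f"
    and E0: "\<And>t. E (Suc t) 0 = E t 0"
    and ES: "\<And>t f. E (Suc t) (Suc f) = E t (Suc f) - E t f"
    and top: "\<And>f. h M f \<le> E M f" and bot: "\<And>f. E 0 f \<le> h 0 f"
    and t: "t \<le> M"
  shows "h t f = E t f"
proof -
  have le: "h t f \<le> E t f" if "t \<le> M" for t f
    using that
  proof (induction arbitrary: f rule: inc_induct)
    case base show ?case by (rule top)
  next
    case (step t)
    show ?case
    proof (induction f)
      case 0 show ?case using h0[of t] E0[of t] step(3)[of 0] step(2) by simp
    next
      case (Suc f) then show ?case using hS[of t f] ES[of t f] step(3)[of "Suc f"] step(2) by simp
    qed
  qed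
  have "E t f \<le> h t f" if "t \<le> M" for t f
    using that
  proof (induction t arbitrary: f)
    case 0 show ?case by (rule bot)
  next
    case (Suc t)
    show ?case
    proof (cases f)
      case 0 then show ?thesis using h0[of t] E0[of t] Suc.IH[of 0] Suc.prems by simp
    next
      case (Suc f')
      then show ?thesis using hS[of t f'] ES[of t f'] Suc.IH[of f] Suc.prems le[of t f'] by simp
    qed
  qed
  then show ?thesis using le t by (simp add: antisym)
qed

text \<open>An axiomatic polynomial ring with two blocks of \<open>P\<close> and \<open>Q\<close>
  variables. General dimensions are only bounded below; generation by linear forms gives the
  matching upper bounds in \<open>hilb_le_nmon\<close>. The points are the evaluations, and
  \<open>points_ex\<close> says that linear forms take arbitrary prescribed values.\<close>

locale bigraded_algebra = lin_space scale
  for scale :: "'k::alg_closed_field \<Rightarrow> 'r::comm_ring_1 \<Rightarrow> 'r" +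
  fixes R :: "nat \<Rightarrow> nat \<Rightarrow> 'r set" and P Q :: nat and points :: "('r \<Rightarrow> 'k) set"
  assumes scale_mult: "scale c x * y = scale c (x * y)"
    and subspace_R: "subspace (R e f)"
    and fin_dim_R: "fin_dim (R e f)"
    and one_R: "1 \<in> R 0 0" and R_0_0: "R 0 0 \<subseteq> span {1}"
    and R_mult: "x \<in> R e f \<Longrightarrow> y \<in> R e' f' \<Longrightarrow> x * y \<in> R (e + e') (f + f')"
    and R_Suc_left: "R (Suc e) f \<subseteq> span {u * g |u g. u \<in> R 1 0 \<and> g \<in> R e f}"
    and R_Suc_right: "R e (Suc f) \<subseteq> span {v * g |v g. v \<in> R 0 1 \<and> g \<in> R e f}"
    and dim_R_ge: "nmon P e * nmon Q f \<le> dim (R e f)"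
    and dim_R_1_0: "dim (R 1 0) \<le> P" and dim_R_0_1: "dim (R 0 1) \<le> Q"
    and points_add: "h \<in> points \<Longrightarrow> h (x + y) = h x + h y"
    and points_scale: "h \<in> points \<Longrightarrow> h (scale c x) = c * h x"
    and points_mult: "h \<in> points \<Longrightarrow> h (x * y) = h x * h y"
    and points_one: "h \<in> points \<Longrightarrow> h 1 = 1"
    and points_ex: "Vector_Spaces.linear scale (*) \<phi> \<Longrightarrow> Vector_Spaces.linear scale (*) \<psi> \<Longrightarrow>
      \<exists>h\<in>points. (\<forall>u\<in>R 1 0. h u = \<phi> u) \<and> (\<forall>v\<in>R 0 1. h v = \<psi> v)"
begin

section \<open>Graded pieces of ideals and their Hilbert functions\<close>

lemma scale_mult_right: "x * scale c y = scale c (x * y)"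
  using scale_mult[of c y x] by (simp add: mult.commute)

lemma linear_mult: "Vector_Spaces.linear scale scale ((*) u)"
  by (unfold_locales) (simp_all add: algebra_simps scale_mult_right)

lemma points_zero: "h \<in> points \<Longrightarrow> h 0 = 0"
  using points_scale[of h 0 0] by simp

lemma points_diff: "h \<in> points \<Longrightarrow> h (x - y) = h x - h y"
  using points_add[of h "x - y" y] by simp

lemma points_sum: "h \<in> points \<Longrightarrow> h (sum g S) = (\<Sum>i\<in>S. h (g i))"
  by (induction S rule: infinite_finite_induct) (simp_all add: points_zero points_add)

lemma points_span:
  assumes "h \<in> points" "\<And>x. x \<in> S \<Longrightarrow> h x = 0" "x \<in> span S" shows "h x = 0"
  using assms(3) by (induction rule: span_induct_alt)
    (simp_all add: assms points_zero points_add points_scale)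

text \<open>The part in bidegree \<open>(e, f)\<close> of the ideal generated by \<open>G\<close>.
  Generators carry their bidegree because an element such as 0 does not determine it.\<close>

definition component :: "(nat \<times> nat \<times> 'r) set \<Rightarrow> nat \<Rightarrow> nat \<Rightarrow> 'r set" where
  "component G e f = span {g * r |i j g r. (i, j, g) \<in> G \<and> i \<le> e \<and> j \<le> f \<and> r \<in> R (e - i) (f - j)}"

definition homogeneous :: "(nat \<times> nat \<times> 'r) set \<Rightarrow> bool" where
  "homogeneous G \<longleftrightarrow> (\<forall>i j g. (i, j, g) \<in> G \<longrightarrow> g \<in> R i j)"

definition hilb :: "(nat \<times> nat \<times> 'r) set \<Rightarrow> nat \<Rightarrow> nat \<Rightarrow> int" where
  "hilb G e f = int (dim (R e f)) - int (dim (component G e f))"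

lemma subspace_component: "subspace (component G e f)"
  by (simp add: component_def)

lemma component_base: "(i, j, g) \<in> G \<Longrightarrow> r \<in> R e f \<Longrightarrow> g * r \<in> component G (e + i) (f + j)"
  unfolding component_def by (intro span_base) force

lemma component_gen: "(i, j, g) \<in> G \<Longrightarrow> g \<in> component G i j"
  using component_base[of i j g G 1 0 0] one_R by simp

lemma component_subset: "homogeneous G \<Longrightarrow> component G e f \<subseteq> R e f"
  unfolding component_def
proof (rule span_minimal)
  assume G: "homogeneous G"
  show "{g * r |i j g r. (i, j, g) \<in> G \<and> i \<le> e \<and> j \<le> f \<and> r \<in> R (e - i) (f - j)} \<subseteq> R e f"
  proof clarify
    fix i j g r assume *: "(i, j, g) \<in> G" "i \<le> e" "j \<le> f" "r \<in> R (e - i) (f - j)"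
    then show "g * r \<in> R e f" using R_mult[of g i j r "e - i" "f - j"] G
      by (simp add: homogeneous_def)
  qed
qed (rule subspace_R)

lemma fin_dim_component: "homogeneous G \<Longrightarrow> fin_dim (component G e f)"
  using fin_dim_R component_subset by (meson fin_dim_mono order_trans span_superset)

lemma hilb_nonneg: "homogeneous G \<Longrightarrow> 0 \<le> hilb G e f"
  unfolding hilb_def using dim_mono_fin[OF order_trans[OF component_subset span_superset] fin_dim_R, of G e f]
  by simp

lemma hilb_le_0D: "homogeneous G \<Longrightarrow> hilb G e f \<le> 0 \<Longrightarrow> component G e f = R e f"
  unfolding hilb_def
  by (rule subspace_eq_if_dim_le) (auto simp: subspace_component component_subset fin_dim_R)

lemma component_mult:
  assumes "x \<in> component G e f" "r \<in> R e' f'"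
  shows "r * x \<in> component G (e + e') (f + f')"
  using assms(1) unfolding component_def
proof (induction rule: span_induct_alt)
  case (step c x y)
  then obtain i j g s where s: "x = g * s" "(i, j, g) \<in> G" "i \<le> e" "j \<le> f" "s \<in> R (e - i) (f - j)" by blast
  have "g * (r * s) \<in> component G (e' + (e - i) + i) (f' + (f - j) + j)"
    using component_base[OF s(2) R_mult[OF assms(2) s(5)]] .
  then have "r * x \<in> component G (e + e') (f + f')" using s by (simp add: add.commute mult.left_commute)
  then show ?case using step unfolding component_def
    by (simp add: distrib_left scale_mult_right span_add span_scale)
qed (simp add: span_zero)

lemma component_mono:
  assumes "\<And>i j g. (i, j, g) \<in> G \<Longrightarrow> g \<in> component G' i j"
  shows "component G e f \<subseteq> component G' e f"
  unfolding component_def[of G]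
proof (rule span_minimal)
  show "{g * r |i j g r. (i, j, g) \<in> G \<and> i \<le> e \<and> j \<le> f \<and> r \<in> R (e - i) (f - j)} \<subseteq> component G' e f"
  proof clarify
    fix i j g r assume *: "(i, j, g) \<in> G" "i \<le> e" "j \<le> f" "r \<in> R (e - i) (f - j)"
    show "g * r \<in> component G' e f"
      using component_mult[OF assms[OF *(1)] *(4)] * by (simp add: mult.commute)
  qed
qed (rule subspace_component)

lemma hilb_antimono:
  assumes "homogeneous G'" "\<And>i j g. (i, j, g) \<in> G \<Longrightarrow> g \<in> component G' i j"
  shows "hilb G' e f \<le> hilb G e f"
  unfolding hilb_def using dim_mono_fin[OF _ fin_dim_component[OF assms(1)], of "component G e f" e f]
    order_trans[OF component_mono[OF assms(2)] span_superset, of G e f] by simp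

lemma component_insert:
  "component (insert (i, j, u) G) (e + i) (f + j) = span (component G (e + i) (f + j) \<union> (*) u ` R e f)"
proof -
  let ?S = "{g * r |i' j' g r. (i', j', g) \<in> G \<and> i' \<le> e + i \<and> j' \<le> f + j \<and> r \<in> R (e + i - i') (f + j - j')}"
  have "component (insert (i, j, u) G) (e + i) (f + j) = span (?S \<union> (*) u ` R e f)"
    unfolding component_def
  proof (intro arg_cong[of _ _ span] equalityI subsetI)
    fix x assume "x \<in> {g * r |i' j' g r. (i', j', g) \<in> insert (i, j, u) G \<and> i' \<le> e + i \<and> j' \<le> f + j \<and>
      r \<in> R (e + i - i') (f + j - j')}"
    then obtain i' j' g r where *: "x = g * r" "(i', j', g) \<in> insert (i, j, u) G" "i' \<le> e + i" "j' \<le> f + j"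
      "r \<in> R (e + i - i') (f + j - j')" by blast
    show "x \<in> ?S \<union> (*) u ` R e f"
    proof (cases "(i', j', g) \<in> G")
      case True then show ?thesis using * by blast
    next
      case False then show ?thesis using * by auto
    qed
  next
    fix x assume "x \<in> ?S \<union> (*) u ` R e f"
    then show "x \<in> {g * r |i' j' g r. (i', j', g) \<in> insert (i, j, u) G \<and> i' \<le> e + i \<and> j' \<le> f + j \<and>
      r \<in> R (e + i - i') (f + j - j')}"
    proof
      assume "x \<in> (*) u ` R e f"
      then obtain r where "x = u * r" "r \<in> R e f" by blast
      then show ?thesis by (intro CollectI exI[of _ i] exI[of _ j] exI[of _ u] exI[of _ r]) auto
    qed blast
  qed
  also have "\<dots> = span (component G (e + i) (f + j) \<union> (*) u ` R e f)"
    unfolding component_def span_Un span_span ..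
  finally show ?thesis .
qed

lemma component_insert_low:
  assumes "\<not> (i \<le> e \<and> j \<le> f)"
  shows "component (insert (i, j, u) G) e f = component G e f"
  unfolding component_def using assms by (intro arg_cong[of _ _ span]) auto

lemma hilb_insert_low: "\<not> (i \<le> e \<and> j \<le> f) \<Longrightarrow> hilb (insert (i, j, u) G) e f = hilb G e f"
  by (simp add: hilb_def component_insert_low)

text \<open>Rank-nullity for multiplication by \<open>u\<close> into the quotient by the ideal. The
  set at the end is its kernel; comparing it with \<open>component G e f\<close> gives the
  inequality and the injectivity criteria that follow.\<close>

lemma hilb_insert:
  assumes "homogeneous G"
  shows "hilb (insert (i, j, u) G) (e + i) (f + j) =
    hilb G (e + i) (f + j) - int (dim (R e f)) + int (dim {r \<in> R e f. u * r \<in> component G (e + i) (f + j)})"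
  using dim_Un_image[where \<phi> = "(*) u" and U = "component G (e + i) (f + j)" and W = "R e f",
      OF linear_mult fin_dim_component[OF assms] subspace_component fin_dim_R subspace_R]
  by (simp add: hilb_def component_insert)

lemma component_subset_kernel:
  assumes "homogeneous G" "u \<in> R i j"
  shows "component G e f \<subseteq> {r \<in> R e f. u * r \<in> component G (e + i) (f + j)}"
  using component_subset[OF assms(1)] component_mult[OF _ assms(2)] by auto

lemma fin_dim_kernel: "fin_dim {r \<in> R e f. S r}"
  by (rule fin_dim_mono[OF fin_dim_R[of e f]]) (use span_superset in auto)

lemma hilb_insert_le:
  assumes "homogeneous G" "u \<in> R i j"
  shows "hilb G (e + i) (f + j) \<le> hilb (insert (i, j, u) G) (e + i) (f + j) + hilb G e f"
proof -
  let ?K = "{r \<in> R e f. u * r \<in> component G (e + i) (f + j)}"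
  have "dim (component G e f) \<le> dim ?K"
    by (rule dim_mono_fin[OF _ fin_dim_kernel])
      (use component_subset_kernel[OF assms, of e f] span_superset in blast)
  then show ?thesis using hilb_insert[OF assms(1), of i j u e f] by (simp add: hilb_def)
qed

lemma hilb_insert_injD:
  assumes "homogeneous G" "u \<in> R i j"
    and "hilb (insert (i, j, u) G) (e + i) (f + j) + hilb G e f \<le> hilb G (e + i) (f + j)"
    and "r \<in> R e f" "u * r \<in> component G (e + i) (f + j)"
  shows "r \<in> component G e f"
proof -
  let ?K = "{r \<in> R e f. u * r \<in> component G (e + i) (f + j)}"
  have "component G e f = ?K"
    using assms(3) hilb_insert[OF assms(1), of i j u e f]
    by (intro subspace_eq_if_dim_le[OF subspace_component component_subset_kernel[OF assms(1,2)] fin_dim_kernel])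
      (simp add: hilb_def)
  then show ?thesis using assms(4,5) by auto
qed

lemma hilb_insert_inj:
  assumes "homogeneous G" "u \<in> R i j"
    and "\<And>r. r \<in> R e f \<Longrightarrow> u * r \<in> component G (e + i) (f + j) \<Longrightarrow> r \<in> component G e f"
  shows "hilb (insert (i, j, u) G) (e + i) (f + j) = hilb G (e + i) (f + j) - hilb G e f"
proof -
  have "{r \<in> R e f. u * r \<in> component G (e + i) (f + j)} = component G e f"
    using assms(3) component_subset_kernel[OF assms(1,2)] by blast
  then show ?thesis using hilb_insert[OF assms(1), of i j u e f] by (simp add: hilb_def)
qed

end


section \<open>Systems of linear and bilinear forms\<close>

lemma infinite_UNIV_alg_closed: "infinite (UNIV :: 'k::alg_closed_field set)"
proof
  assume fin: "finite (UNIV :: 'k set)"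
  define p :: "'k poly" where "p = (\<Prod>a\<in>UNIV. [:- a, 1:]) + 1"
  have "degree (\<Prod>a\<in>(UNIV::'k set). [:- a, 1:]) = card (UNIV :: 'k set)"
    by (subst degree_prod_eq_sum_degree) auto
  moreover have "card (UNIV :: 'k set) > 0" using fin by (simp add: card_gt_0_iff)
  ultimately have "degree p > 0" unfolding p_def by (subst degree_add_eq_left) auto
  then obtain x where "poly p x = 0" using alg_closed_imp_poly_has_root by blast
  moreover have "poly p x = 1"
    using prod_zero[OF fin, of "\<lambda>a. poly [:- a, 1:] x"] by (auto simp: p_def poly_prod)
  ultimately show False by simp
qed

lemma (in lin_space) functional_ex:
  assumes "subspace C" "v \<notin> C"
  shows "\<exists>\<phi>. Vector_Spaces.linear scale (*) \<phi> \<and> (\<forall>x\<in>C. \<phi> x = 0) \<and> \<phi> v = 1"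
proof -
  interpret vs: vector_space "(*) :: 'a \<Rightarrow> 'a \<Rightarrow> 'a"
    by unfold_locales (simp_all add: algebra_simps)
  interpret pair: vector_space_pair scale "(*) :: 'a \<Rightarrow> 'a \<Rightarrow> 'a" ..
  obtain B where B: "B \<subseteq> C" "independent B" "C \<subseteq> span B" using basis_exists[of C] by metis
  have sp: "span B = C" by (rule span_subspace[OF B(1,3) assms(1)])
  have ind: "independent (insert v B)" by (rule independent_insertI[OF _ B(2)]) (simp add: sp assms(2))
  then obtain g where g: "Vector_Spaces.linear scale (*) g" "\<forall>x\<in>insert v B. g x = (if x = v then 1 else 0)"
    using pair.linear_independent_extend[OF ind, of "\<lambda>x. if x = v then 1 else 0"] by (elim exE conjE)
  interpret g: Vector_Spaces.linear scale "(*)" g by (rule g)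
  have gB: "g x = 0" if "x \<in> B" for x 
  proof -
    have "x \<noteq> v" using that B(1) assms(2) by blast
    then show ?thesis using bspec[OF g(2), of x] that by simp
  qed
  have "g x = 0" if "x \<in> C" for x
    by (rule g.eq_0_on_span[of B]) (use gB that sp in simp_all)
  then show ?thesis using g by (intro exI[of _ g]) simp
qed

text \<open>
  The exponents are the digits of \<open>\<nu>\<close> in base \<open>M + 1\<close>, and the exponent of \<open>x 0\<close> makes the degree
  independent of \<open>\<nu>\<close>. Substituting powers \<open>z ^ (M + 1) ^ i\<close> then separates these monomials.
\<close>

definition digit_monomial :: "nat \<Rightarrow> (nat \<Rightarrow> 'b) \<Rightarrow> nat \<Rightarrow> nat \<Rightarrow> 'b::comm_ring_1" where
  "digit_monomial M x N \<nu> =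
    (\<Prod>i<N. x (Suc i) ^ (\<nu> div (M + 1) ^ i mod (M + 1)) * x 0 ^ (M - \<nu> div (M + 1) ^ i mod (M + 1)))"

lemma sum_digits: "(\<Sum>i<N. b ^ i * (\<nu> div b ^ i mod b)) = \<nu> mod b ^ N" for b :: nat
proof (induction N)
  case (Suc N)
  then show ?case using mod_mult2_eq[of \<nu> "b ^ N" b] by (simp add: mult.commute)
qed simp

lemma digit_monomial_kronecker:
  assumes "\<nu> < (M + 1) ^ N"
  shows "digit_monomial M (\<lambda>i. case i of 0 \<Rightarrow> 1 | Suc i \<Rightarrow> s ^ ((M + 1) ^ i)) N \<nu> = s ^ \<nu>"
proof -
  define b where "b = M + 1"
  have "digit_monomial M (\<lambda>i. case i of 0 \<Rightarrow> 1 | Suc i \<Rightarrow> s ^ (b ^ i)) N \<nu> =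
      (\<Prod>i<N. s ^ (b ^ i * (\<nu> div b ^ i mod b)))"
    unfolding digit_monomial_def b_def[symmetric] by (simp only: nat.case power_one mult_1_right power_mult)
  also have "\<dots> = s ^ (\<Sum>i<N. b ^ i * (\<nu> div b ^ i mod b))" by (simp only: power_sum)
  also have "\<dots> = s ^ \<nu>" using assms by (simp only: sum_digits b_def mod_less)
  finally show ?thesis by (simp only: b_def)
qed

lemma digit_monomial_scale: "digit_monomial M (\<lambda>i. \<tau> * x i) N \<nu> = \<tau> ^ (N * M) * digit_monomial M x N \<nu>"
proof -
  have "d \<le> M \<Longrightarrow> (\<tau> * y) ^ d * (\<tau> * z) ^ (M - d) = \<tau> ^ M * (y ^ d * z ^ (M - d))" for d y z
    using power_add[of \<tau> d "M - d"] by (simp add: power_mult_distrib mult_ac)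
  moreover have "\<nu> div (M + 1) ^ i mod (M + 1) \<le> M" for i
    using mod_less_divisor[of "M + 1" "\<nu> div (M + 1) ^ i"] by linarith
  ultimately have "digit_monomial M (\<lambda>i. \<tau> * x i) N \<nu> = (\<Prod>i<N. \<tau> ^ M) * digit_monomial M x N \<nu>"
    unfolding digit_monomial_def prod.distrib[symmetric] by (intro prod.cong) simp_all
  then show ?thesis by (simp add: power_mult[symmetric] mult.commute)
qed

context bigraded_algebra
begin

definition sys :: "'r set \<Rightarrow> 'r set \<Rightarrow> 'r set \<Rightarrow> (nat \<times> nat \<times> 'r) set" where
  "sys A B L = (\<lambda>u. (1, 0, u)) ` A \<union> (\<lambda>v. (0, 1, v)) ` B \<union> (\<lambda>l. (1, 1, l)) ` L"

text \<open>Hyperplane sections stay inside one ring: instead of eliminating variables, linear forms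
  are added to the ideal, and \<open>p\<close> and \<open>q\<close> count the variables that remain
  free.\<close>

definition linear_system :: "nat \<Rightarrow> nat \<Rightarrow> 'r set \<Rightarrow> 'r set \<Rightarrow> bool" where
  "linear_system p q A B \<longleftrightarrow> A \<subseteq> R 1 0 \<and> B \<subseteq> R 0 1 \<and> finite A \<and> finite B \<and> independent A \<and> independent B \<and>
    card A + p = P \<and> card B + q = Q"

text \<open>Points live in affine space. A common zero with a vanishing block is not a point of the
  product of projective spaces and is therefore tolerated.\<close>

definition nonsingular :: "'r set \<Rightarrow> 'r set \<Rightarrow> 'r set \<Rightarrow> bool" where
  "nonsingular A B L \<longleftrightarrow> (\<forall>h\<in>points. (\<forall>u\<in>A \<union> B \<union> L. h u = 0) \<longrightarrow>
    (\<forall>u\<in>R 1 0. h u = 0) \<or> (\<forall>v\<in>R 0 1. h v = 0))"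

lemma sys_insert:
  "sys (insert x A) B L = insert (1, 0, x) (sys A B L)"
  "sys A (insert y B) L = insert (0, 1, y) (sys A B L)"
  "sys A B (insert l L) = insert (1, 1, l) (sys A B L)"
  by (auto simp: sys_def)

lemma homogeneous_sys: "linear_system p q A B \<Longrightarrow> L \<subseteq> R 1 1 \<Longrightarrow> homogeneous (sys A B L)"
  by (auto simp: homogeneous_def sys_def linear_system_def)

lemma linear_systemD:
  assumes "linear_system p q A B"
  shows "A \<subseteq> R 1 0" "B \<subseteq> R 0 1" "finite A" "finite B" "dim A + p = P" "dim B + q = Q"
  using assms by (auto simp: linear_system_def dim_eq_card_independent)

section \<open>Ideals generated by linear forms\<close>

lemma dim_R_linear: "P \<le> dim (R 1 0)" "Q \<le> dim (R 0 1)"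
  using dim_R_ge[of 1 0] dim_R_ge[of 0 1] by simp_all

lemma ex_left: "linear_system (Suc p) q A B \<Longrightarrow> \<exists>x\<in>R 1 0. x \<notin> span A"
proof (rule ccontr)
  assume ls: "linear_system (Suc p) q A B" and "\<not> (\<exists>x\<in>R 1 0. x \<notin> span A)"
  then have "dim (R 1 0) \<le> dim A"
    using linear_systemD(3)[OF ls] by (intro dim_mono_fin fin_dim_finite) auto
  then show False using dim_R_linear(1) linear_systemD(5)[OF ls] by simp
qed

lemma ex_right: "linear_system p (Suc q) A B \<Longrightarrow> \<exists>y\<in>R 0 1. y \<notin> span B"
proof (rule ccontr)
  assume ls: "linear_system p (Suc q) A B" and "\<not> (\<exists>y\<in>R 0 1. y \<notin> span B)"
  then have "dim (R 0 1) \<le> dim B"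
    using linear_systemD(4)[OF ls] by (intro dim_mono_fin fin_dim_finite) auto
  then show False using dim_R_linear(2) linear_systemD(6)[OF ls] by simp
qed

lemma linear_system_insert_left:
  "linear_system (Suc p) q A B \<Longrightarrow> x \<in> R 1 0 \<Longrightarrow> x \<notin> span A \<Longrightarrow> linear_system p q (insert x A) B"
  using independent_insertI[of x A] contra_subsetD[OF span_superset, of x A]
  by (auto simp: linear_system_def card_insert_disjoint)

lemma linear_system_insert_right:
  "linear_system p (Suc q) A B \<Longrightarrow> y \<in> R 0 1 \<Longrightarrow> y \<notin> span B \<Longrightarrow> linear_system p q A (insert y B)"
  using independent_insertI[of y B] contra_subsetD[OF span_superset, of y B]
  by (auto simp: linear_system_def card_insert_disjoint)

lemma span_left: "linear_system 0 q A B \<Longrightarrow> span A = R 1 0"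
  using linear_systemD[of 0 q A B] dim_R_1_0
  by (intro subspace_eq_if_dim_le span_minimal subspace_R) (simp_all add: fin_dim_R)

lemma span_right: "linear_system p 0 A B \<Longrightarrow> span B = R 0 1"
  using linear_systemD[of p 0 A B] dim_R_0_1
  by (intro subspace_eq_if_dim_le span_minimal subspace_R) (simp_all add: fin_dim_R)

lemma span_subset_component:
  "span A \<subseteq> component (sys A B L) 1 0" "span B \<subseteq> component (sys A B L) 0 1" "span L \<subseteq> component (sys A B L) 1 1"
  by (rule span_minimal[OF _ subspace_component], force intro: component_gen simp: sys_def)+

lemma component_full_left:
  assumes "R 1 0 \<subseteq> component G 1 0"
  shows "R (Suc e) f \<subseteq> component G (Suc e) f"
proof (rule order_trans[OF R_Suc_left], rule span_minimal[OF _ subspace_component], clarify)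
  fix u g assume "u \<in> R 1 0" "g \<in> R e f"
  then show "u * g \<in> component G (Suc e) f"
    using component_mult[of u G 1 0 g e f] assms by (auto simp: mult.commute)
qed

lemma component_full_right:
  assumes "R 0 1 \<subseteq> component G 0 1"
  shows "R e (Suc f) \<subseteq> component G e (Suc f)"
proof (rule order_trans[OF R_Suc_right], rule span_minimal[OF _ subspace_component], clarify)
  fix u g assume "u \<in> R 0 1" "g \<in> R e f"
  then show "u * g \<in> component G e (Suc f)"
    using component_mult[of u G 0 1 g e f] assms by (auto simp: mult.commute)
qed

lemma component_full:
  assumes "R 1 1 \<subseteq> component G 1 1"
  shows "R (Suc e) (Suc f) \<subseteq> component G (Suc e) (Suc f)"
proof -
  have 1: "R (Suc e) 1 \<subseteq> component G (Suc e) 1" for e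
  proof (induction e)
    case (Suc e)
    show ?case
    proof (rule order_trans[OF R_Suc_left], rule span_minimal[OF _ subspace_component], clarify)
      fix u g assume "u \<in> R 1 0" "g \<in> R (Suc e) 1"
      then show "u * g \<in> component G (Suc (Suc e)) 1"
        using component_mult[of g G "Suc e" 1 u 1 0] Suc by (auto simp: mult.commute)
    qed
  qed (use assms in simp)
  show ?thesis
  proof (induction f)
    case (Suc f)
    show ?case
    proof (rule order_trans[OF R_Suc_right], rule span_minimal[OF _ subspace_component], clarify)
      fix u g assume "u \<in> R 0 1" "g \<in> R (Suc e) (Suc f)"
      then show "u * g \<in> component G (Suc e) (Suc (Suc f))"
        using component_mult[of g G "Suc e" "Suc f" u 0 1] Suc by (auto simp: mult.commute)
    qed
  qed (use 1 in simp)
qed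

lemma hilb_full: "R e f \<subseteq> component G e f \<Longrightarrow> homogeneous G \<Longrightarrow> hilb G e f = 0"
  using component_subset[of G e f] by (simp add: hilb_def)

lemma hilb_0_0_le: "hilb G 0 0 \<le> 1"
proof -
  have "dim (R 0 0) \<le> card {1::'r}" by (rule dim_le_card[OF R_0_0]) simp
  then show ?thesis by (simp add: hilb_def)
qed

text \<open>The induction follows the Pascal recursion of \<open>nmon\<close>: one linear form is
  added, or one degree is dropped. Once a block has no free variable, the ideal contains everything
  of positive degree in that block.\<close>

lemma hilb_le_nmon:
  assumes "linear_system p q A B" "L \<subseteq> R 1 1"
  shows "hilb (sys A B L) e f \<le> int (nmon p e * nmon q f)"
  using assms
proof (induction "p + q + e + f" arbitrary: p q e f A B rule: less_induct)
  case less
  note hom = homogeneous_sys[OF less.prems]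
  show ?case
  proof (cases e)
    case e: (Suc e')
    show ?thesis
    proof (cases p)
      case 0
      have "R 1 0 \<subseteq> component (sys A B L) 1 0"
        using span_left[of q A B] span_subset_component(1)[of A B L] less.prems 0 by simp
      then show ?thesis using hilb_full[OF component_full_left hom] e 0 by simp
    next
      case p: (Suc p')
      then obtain x where x: "x \<in> R 1 0" "x \<notin> span A" using ex_left less.prems by blast
      have "hilb (sys (insert x A) B L) e f \<le> int (nmon p' e * nmon q f)"
        using less.hyps[of p' q e f] linear_system_insert_left[of p' q A B x] x p less.prems by simp
      moreover have "hilb (sys A B L) e' f \<le> int (nmon p e' * nmon q f)"
        using less.hyps[of p q e' f] e less.prems by simp
      ultimately show ?thesis using hilb_insert_le[OF hom x(1), of e' f] p e
        by (simp add: sys_insert algebra_simps)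
    qed
  next
    case e: 0
    show ?thesis
    proof (cases f)
      case 0 then show ?thesis using e hilb_0_0_le[of "sys A B L"] by simp
    next
      case f: (Suc f')
      show ?thesis
      proof (cases q)
        case 0
        have "R 0 1 \<subseteq> component (sys A B L) 0 1"
          using span_right[of p A B] span_subset_component(2)[of B A L] less.prems 0 by simp
        then show ?thesis using hilb_full[OF component_full_right hom] f 0 by simp
      next
        case q: (Suc q')
        then obtain y where y: "y \<in> R 0 1" "y \<notin> span B" using ex_right less.prems by blast
        have "hilb (sys A (insert y B) L) e f \<le> int (nmon p e * nmon q' f)"
          using less.hyps[of p q' e f] linear_system_insert_right[of p q' A B y] y q less.prems by simp
        moreover have "hilb (sys A B L) e f' \<le> int (nmon p e * nmon q f')"
          using less.hyps[of p q e f'] f less.prems by simp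
        ultimately show ?thesis using hilb_insert_le[OF hom y(1), of e f'] q f
          by (simp add: sys_insert algebra_simps)
      qed
    qed
  qed
qed

text \<open>For the lower bound the linear forms are added one at a time. Each step costs at most
  the Hilbert function of the previous quotient one degree lower, which \<open>hilb_le_nmon\<close>
  bounds from above.\<close>

lemma hilb_linear:
  assumes "linear_system p q A B"
  shows "hilb (sys A B {}) e f = int (nmon p e * nmon q f)"
proof (rule antisym)
  have left: "int (nmon p e * nmon Q f) \<le> hilb (sys A {} {}) e f"
    if "finite A" "A \<subseteq> R 1 0" "independent A" "card A + p = P" for A p e f
    using that
  proof (induction A arbitrary: p e f rule: finite_induct)
    case empty
    have "component (sys {} {} {}) e f = {0}" by (simp add: component_def sys_def)
    moreover have "dim {0} = 0" using dim_span[of "{}"] dim_eq_card_independent[OF independent_empty]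
      by (metis card.empty span_empty)
    ultimately show ?case using dim_R_ge[of e f] empty by (simp add: hilb_def flip: of_nat_mult)
  next
    case (insert x A)
    then have i: "independent A" "A \<subseteq> R 1 0" "card A + Suc p = P" by (auto simp: independent_insert)
    then have ls: "linear_system (Suc p) Q A {}"
      using insert by (simp add: linear_system_def independent_empty)
    show ?case
    proof (cases e)
      case 0
      then show ?thesis using insert.IH[OF i(2,1,3), of 0 f]
        by (simp add: sys_insert hilb_insert_low)
    next
      case (Suc e')
      then show ?thesis using insert.IH[OF i(2,1,3), of e f] hilb_le_nmon[OF ls, of "{}" e' f]
          hilb_insert_le[OF homogeneous_sys[OF ls], of "{}" x 1 0 e' f] insert.prems
        by (simp add: sys_insert algebra_simps)
    qed
  qed
  have "int (nmon p e * nmon q f) \<le> hilb (sys A B {}) e f"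
    if "finite B" "B \<subseteq> R 0 1" "independent B" "card B + q = Q" for B q
    using that
  proof (induction B arbitrary: q f rule: finite_induct)
    case empty
    then show ?case using left[of A p] assms by (simp add: linear_system_def)
  next
    case (insert y B)
    then have i: "independent B" "B \<subseteq> R 0 1" "card B + Suc q = Q" by (auto simp: independent_insert)
    then have ls: "linear_system p (Suc q) A B" using insert assms by (simp add: linear_system_def)
    show ?case
    proof (cases f)
      case 0
      then show ?thesis using insert.IH[OF i(2,1,3), of 0]
        by (simp add: sys_insert hilb_insert_low)
    next
      case (Suc f')
      then show ?thesis using insert.IH[OF i(2,1,3), of f] hilb_le_nmon[OF ls, of "{}" e f']
          hilb_insert_le[OF homogeneous_sys[OF ls], of "{}" y 0 1 e f'] insert.prems
        by (simp add: sys_insert algebra_simps)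
    qed
  qed
  then show "int (nmon p e * nmon q f) \<le> hilb (sys A B {}) e f"
    using assms by (simp add: linear_system_def)
qed (use hilb_le_nmon assms in blast)

lemma points_component:
  assumes "h \<in> points" "\<And>i j g. (i, j, g) \<in> G \<Longrightarrow> h g = 0" "x \<in> component G e f"
  shows "h x = 0"
  using assms(3) unfolding component_def
proof (rule points_span[OF assms(1), rotated], clarify)
  fix i j g r assume "(i, j, g) \<in> G"
  then show "h (g * r) = 0" using assms(2)[of i j g] by (simp add: points_mult[OF assms(1)])
qed

text \<open>With a single free variable \<open>x\<close> in the first block, every bilinear form is
  \<open>x * v\<close> modulo \<open>A\<close>, so the system amounts to the linear forms
  \<open>v\<close> in \<open>C\<close>. If these do not exhaust the second block, linear algebra
  alone provides a forbidden common zero.\<close>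

lemma nonsingular_1_left:
  assumes ls: "linear_system (Suc 0) q A B" and L: "L \<subseteq> R 1 1" and ns: "nonsingular A B L"
  shows "R 1 1 \<subseteq> component (sys A B L) 1 1"
proof -
  let ?I = "component (sys A B L) 1 1"
  obtain x where x: "x \<in> R 1 0" "x \<notin> span A" using ex_left ls by blast
  have spx: "span (insert x A) = R 1 0"
    using span_left linear_system_insert_left[OF ls x] by blast
  define C where "C = {v \<in> R 0 1. x * v \<in> ?I}"
  have C: "subspace C" unfolding C_def
    by (intro subspaceI) (auto simp: distrib_left scale_mult_right subspace_0 subspace_add subspace_scale
        subspace_R subspace_component)
  have split: "\<exists>v\<in>R 0 1. w - x * v \<in> component (sys A {} {}) 1 1" if "w \<in> R 1 1" for w
  proof -
    have "w \<in> span {u * g |u g. u \<in> R 1 0 \<and> g \<in> R 0 1}" using R_Suc_left[of 0 1] that by auto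
    then show ?thesis
    proof (induction rule: span_induct_alt)
      case base
      show ?case by (rule bexI[of _ 0]) (simp_all add: subspace_0 subspace_component subspace_R)
    next
      case (step c z y)
      then obtain v u g where v: "v \<in> R 0 1" "y - x * v \<in> component (sys A {} {}) 1 1"
        and z: "z = u * g" "u \<in> span (insert x A)" "g \<in> R 0 1" by (auto simp: spx)
      then obtain k where k: "u - scale k x \<in> span A" by (auto simp: span_insert)
      have "g * (u - scale k x) \<in> component (sys A {} {}) (1 + 0) (0 + 1)"
        using k span_subset_component(1)[of A "{}" "{}"] z by (intro component_mult) auto
      then have "scale c (g * (u - scale k x)) + (y - x * v) \<in> component (sys A {} {}) 1 1"
        using v by (simp add: subspace_add subspace_scale subspace_component)
      moreover have "scale c (g * (u - scale k x)) + (y - x * v) =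
          (scale c z + y) - x * (v + scale (c * k) g)"
        by (simp add: z algebra_simps scale_mult scale_mult_right scale_right_diff_distrib)
      ultimately show ?case
        using subspace_add[OF subspace_R v(1) subspace_scale[OF subspace_R z(3), of "c * k"]]
        by (intro bexI[of _ "v + scale (c * k) g"]) simp_all
    qed
  qed
  have sub: "component (sys A {} {}) 1 1 \<subseteq> ?I"
    by (rule component_mono) (auto simp: sys_def intro!: component_gen)
  have "C = R 0 1"
  proof (rule ccontr)
    assume "C \<noteq> R 0 1"
    then obtain v0 where v0: "v0 \<in> R 0 1" "v0 \<notin> C" by (auto simp: C_def)
    obtain \<psi> where \<psi>: "Vector_Spaces.linear scale (*) \<psi>" "\<And>y. y \<in> C \<Longrightarrow> \<psi> y = 0" "\<psi> v0 = 1"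
      using functional_ex[OF C v0(2)] by blast
    obtain \<phi> where \<phi>: "Vector_Spaces.linear scale (*) \<phi>" "\<And>y. y \<in> span A \<Longrightarrow> \<phi> y = 0" "\<phi> x = 1"
      using functional_ex[OF subspace_span x(2)] by blast
    \<comment> \<open>Both blocks of this point are nonzero; the rest of the argument checks that it
      is a common zero of the system.\<close>
    obtain h where h: "h \<in> points" "\<And>u. u \<in> R 1 0 \<Longrightarrow> h u = \<phi> u" "\<And>v. v \<in> R 0 1 \<Longrightarrow> h v = \<psi> v"
      using points_ex[OF \<phi>(1) \<psi>(1)] by blast
    have hA: "h u = 0" if "u \<in> A" for u
      using that linear_systemD(1)[OF ls] h(2)[of u] \<phi>(2)[of u] by (auto simp: span_base)
    have "B \<subseteq> C"
    proof
      fix y assume y: "y \<in> B"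
      have "x * y \<in> component (sys A B L) (0 + 1) (1 + 0)"
        using subsetD[OF span_subset_component(2) span_base[OF y]] x by (intro component_mult)
      then show "y \<in> C" using y linear_systemD(2)[OF ls] unfolding C_def by auto
    qed
    then have hB: "h u = 0" if "u \<in> B" for u
      using subsetD[OF _ that] linear_systemD(2)[OF ls] h(3)[of u] \<psi>(2)[of u] by simp
    have "h l = 0" if l: "l \<in> L" for l
    proof -
      obtain v where v: "v \<in> R 0 1" "l - x * v \<in> component (sys A {} {}) 1 1"
        using split[of l] l L by blast
      have "l \<in> ?I" using span_subset_component(3)[of L A B] span_base[OF l] by blast
      then have "l - (l - x * v) \<in> ?I" by (rule subspace_diff[OF subspace_component _ subsetD[OF sub v(2)]])
      then have "v \<in> C" using v by (simp add: C_def)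
      then have "h (x * v) = 0" using h(1,3) v \<psi>(2) by (simp add: points_mult)
      moreover have "h (l - x * v) = 0"
        by (rule points_component[OF h(1) _ v(2)]) (auto simp: sys_def dest: hA)
      ultimately show ?thesis using h(1) by (simp add: points_diff)
    qed
    then have "(\<forall>u\<in>R 1 0. h u = 0) \<or> (\<forall>v\<in>R 0 1. h v = 0)"
      using ns h(1) hA hB unfolding nonsingular_def by blast
    moreover have "h x \<noteq> 0" "h v0 \<noteq> 0" using h(2)[OF x(1)] h(3)[OF v0(1)] \<phi>(3) \<psi>(3) by simp_all
    ultimately show False using x(1) v0(1) by blast
  qed
  show ?thesis
  proof
    fix w assume "w \<in> R 1 1"
    then obtain v where v: "v \<in> R 0 1" "w - x * v \<in> component (sys A {} {}) 1 1" using split by blast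
    have "x * v \<in> ?I" using v \<open>C = R 0 1\<close> by (auto simp: C_def)
    then have "(w - x * v) + x * v \<in> ?I" by (rule subspace_add[OF subspace_component subsetD[OF sub v(2)]])
    then show "w \<in> ?I" by simp
  qed
qed

end


section \<open>Generic projections\<close>

context bigraded_algebra
begin

text \<open>The argument of \<open>nonsingular_1_left\<close> with the two blocks exchanged.\<close>

lemma nonsingular_1_right:
  assumes ls: "linear_system p (Suc 0) A B" and L: "L \<subseteq> R 1 1" and ns: "nonsingular A B L"
  shows "R 1 1 \<subseteq> component (sys A B L) 1 1"
proof -
  let ?I = "component (sys A B L) 1 1"
  obtain x where x: "x \<in> R 0 1" "x \<notin> span B" using ex_right ls by blast
  have spx: "span (insert x B) = R 0 1"
    using span_right linear_system_insert_right[OF ls x] by blast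
  define C where "C = {v \<in> R 1 0. x * v \<in> ?I}"
  have C: "subspace C" unfolding C_def
    by (intro subspaceI) (auto simp: distrib_left scale_mult_right subspace_0 subspace_add subspace_scale
        subspace_R subspace_component)
  have split: "\<exists>v\<in>R 1 0. w - x * v \<in> component (sys {} B {}) 1 1" if "w \<in> R 1 1" for w
  proof -
    have "w \<in> span {u * g |u g. u \<in> R 0 1 \<and> g \<in> R 1 0}" using R_Suc_right[of 1 0] that by auto
    then show ?thesis
    proof (induction rule: span_induct_alt)
      case base
      show ?case by (rule bexI[of _ 0]) (simp_all add: subspace_0 subspace_component subspace_R)
    next
      case (step c z y)
      then obtain v u g where v: "v \<in> R 1 0" "y - x * v \<in> component (sys {} B {}) 1 1"
        and z: "z = u * g" "u \<in> span (insert x B)" "g \<in> R 1 0" by (auto simp: spx)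
      then obtain k where k: "u - scale k x \<in> span B" by (auto simp: span_insert)
      have "g * (u - scale k x) \<in> component (sys {} B {}) (0 + 1) (1 + 0)"
        using k span_subset_component(2)[of B "{}" "{}"] z by (intro component_mult) auto
      then have "scale c (g * (u - scale k x)) + (y - x * v) \<in> component (sys {} B {}) 1 1"
        using v by (simp add: subspace_add subspace_scale subspace_component)
      moreover have "scale c (g * (u - scale k x)) + (y - x * v) =
          (scale c z + y) - x * (v + scale (c * k) g)"
        by (simp add: z algebra_simps scale_mult scale_mult_right scale_right_diff_distrib)
      ultimately show ?case
        using subspace_add[OF subspace_R v(1) subspace_scale[OF subspace_R z(3), of "c * k"]]
        by (intro bexI[of _ "v + scale (c * k) g"]) simp_all
    qed
  qed
  have sub: "component (sys {} B {}) 1 1 \<subseteq> ?I"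
    by (rule component_mono) (auto simp: sys_def intro!: component_gen)
  have "C = R 1 0"
  proof (rule ccontr)
    assume "C \<noteq> R 1 0"
    then obtain v0 where v0: "v0 \<in> R 1 0" "v0 \<notin> C" by (auto simp: C_def)
    obtain \<psi> where \<psi>: "Vector_Spaces.linear scale (*) \<psi>" "\<And>y. y \<in> C \<Longrightarrow> \<psi> y = 0" "\<psi> v0 = 1"
      using functional_ex[OF C v0(2)] by blast
    obtain \<phi> where \<phi>: "Vector_Spaces.linear scale (*) \<phi>" "\<And>y. y \<in> span B \<Longrightarrow> \<phi> y = 0" "\<phi> x = 1"
      using functional_ex[OF subspace_span x(2)] by blast
    obtain h where h: "h \<in> points" "\<And>u. u \<in> R 0 1 \<Longrightarrow> h u = \<phi> u" "\<And>v. v \<in> R 1 0 \<Longrightarrow> h v = \<psi> v"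
      using points_ex[OF \<psi>(1) \<phi>(1)] by blast
    have hB: "h u = 0" if "u \<in> B" for u
      using that linear_systemD(2)[OF ls] h(2)[of u] \<phi>(2)[of u] by (auto simp: span_base)
    have "A \<subseteq> C"
    proof
      fix y assume y: "y \<in> A"
      have "x * y \<in> component (sys A B L) (1 + 0) (0 + 1)"
        using subsetD[OF span_subset_component(1) span_base[OF y]] x by (intro component_mult)
      then show "y \<in> C" using y linear_systemD(1)[OF ls] unfolding C_def by auto
    qed
    then have hA: "h u = 0" if "u \<in> A" for u
      using subsetD[OF _ that] linear_systemD(1)[OF ls] h(3)[of u] \<psi>(2)[of u] by simp
    have "h l = 0" if l: "l \<in> L" for l
    proof -
      obtain v where v: "v \<in> R 1 0" "l - x * v \<in> component (sys {} B {}) 1 1"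
        using split[of l] l L by blast
      have "l \<in> ?I" using span_subset_component(3)[of L A B] span_base[OF l] by blast
      then have "l - (l - x * v) \<in> ?I" by (rule subspace_diff[OF subspace_component _ subsetD[OF sub v(2)]])
      then have "v \<in> C" using v by (simp add: C_def)
      then have "h (x * v) = 0" using h(1,3) v \<psi>(2) by (simp add: points_mult)
      moreover have "h (l - x * v) = 0"
        by (rule points_component[OF h(1) _ v(2)]) (auto simp: sys_def dest: hB)
      ultimately show ?thesis using h(1) by (simp add: points_diff)
    qed
    then have "(\<forall>u\<in>R 0 1. h u = 0) \<or> (\<forall>v\<in>R 1 0. h v = 0)"
      using ns h(1) hA hB unfolding nonsingular_def by blast
    moreover have "h x \<noteq> 0" "h v0 \<noteq> 0" using h(2)[OF x(1)] h(3)[OF v0(1)] \<phi>(3) \<psi>(3) by simp_all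
    ultimately show False using x(1) v0(1) by blast
  qed
  show ?thesis
  proof
    fix w assume "w \<in> R 1 1"
    then obtain v where v: "v \<in> R 1 0" "w - x * v \<in> component (sys {} B {}) 1 1" using split by blast
    have "x * v \<in> ?I" using v \<open>C = R 1 0\<close> by (auto simp: C_def)
    then have "(w - x * v) + x * v \<in> ?I" by (rule subspace_add[OF subspace_component subsetD[OF sub v(2)]])
    then show "w \<in> ?I" by simp
  qed
qed

section \<open>Monomials in bilinear forms, and projection from a point off their image\<close>

lemma R_power: "x \<in> R e f \<Longrightarrow> x ^ k \<in> R (k * e) (k * f)"
proof (induction k)
  case (Suc k)
  then show ?case using R_mult[of x e f "x ^ k"] by simp
qed (simp add: one_R)

lemma R_prod: "finite S \<Longrightarrow> (\<And>i. i \<in> S \<Longrightarrow> x i \<in> R e f) \<Longrightarrow> prod x S \<in> R (card S * e) (card S * f)"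
proof (induction S rule: finite_induct)
  case (insert i S)
  then show ?case using R_mult[of "x i" e f "prod x S"] by simp
qed (simp add: one_R)

lemma digit_monomial_R:
  assumes "\<And>i. i \<le> N \<Longrightarrow> x i \<in> R 1 1"
  shows "digit_monomial M x N \<nu> \<in> R (N * M) (N * M)"
proof -
  have "x (Suc i) ^ d * x 0 ^ (M - d) \<in> R M M" if "i < N" "d \<le> M" for i d
    using R_mult[OF R_power[OF assms[of "Suc i"], of d] R_power[OF assms[of 0], of "M - d"]] that by simp
  moreover have "\<nu> div (M + 1) ^ i mod (M + 1) \<le> M" for i
    using mod_less_divisor[of "M + 1" "\<nu> div (M + 1) ^ i"] by linarith
  ultimately have "digit_monomial M x N \<nu> \<in> R (card {..<N} * M) (card {..<N} * M)"
    unfolding digit_monomial_def by (intro R_prod) auto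
  then show ?thesis by simp
qed

lemma points_power: "h \<in> points \<Longrightarrow> h (x ^ k) = h x ^ k"
  by (induction k) (simp_all add: points_one points_mult)

lemma points_prod: "h \<in> points \<Longrightarrow> h (prod x S) = (\<Prod>i\<in>S. h (x i))"
  by (induction S rule: infinite_finite_induct) (simp_all add: points_one points_mult)

lemma points_digit_monomial: "h \<in> points \<Longrightarrow> h (digit_monomial M x N \<nu>) = digit_monomial M (\<lambda>i. h (x i)) N \<nu>"
  by (simp add: digit_monomial_def points_prod points_mult points_power)

text \<open>Codimensions at most add up in an intersection. This makes room for one relation that
  lies in two ideals at once.\<close>

lemma dim_Int_components:
  assumes "homogeneous G" "homogeneous G'"
  shows "int (dim (R e f)) \<le> hilb G e f + hilb G' e f + int (dim (component G e f \<inter> component G' e f))"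
proof -
  let ?C = "component G e f" and ?C' = "component G' e f"
  have "Vector_Spaces.linear scale scale (\<lambda>x. x)"
    by unfold_locales (simp_all add: algebra_simps)
  then have "dim (?C \<union> (\<lambda>x. x) ` ?C') + dim {w \<in> ?C'. w \<in> ?C} = dim ?C + dim ?C'"
    by (rule dim_Un_image) (simp_all add: fin_dim_component subspace_component assms)
  moreover have "{w \<in> ?C'. w \<in> ?C} = ?C \<inter> ?C'" by auto
  moreover have "dim (?C \<union> ?C') \<le> dim (R e f)"
    using component_subset[OF assms(1)] component_subset[OF assms(2)] span_superset[of "R e f"]
    by (intro dim_mono_fin fin_dim_R) blast
  ultimately show ?thesis by (simp add: hilb_def)
qed

text \<open>
  More than \<open>p + q - 1\<close> forms of bidegree \<open>(1, 1)\<close> map the zero set of a linear system into a proper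
  subcone: there are more monomials in the forms than the linear systems leave room for.
\<close>

lemma point_off_image:
  assumes l: "\<And>i. i \<le> N \<Longrightarrow> l i \<in> R 1 1"
    and ls: "linear_system p q A B" "linear_system p' q' A' B'"
    and pq: "0 < p" "0 < q" "p + q \<le> Suc N" "0 < p'" "0 < q'" "p' + q' \<le> Suc N"
  shows "\<exists>c. c 0 = (1 :: 'k) \<and> (\<forall>h\<in>points. \<forall>\<tau>. (\<forall>u\<in>A \<union> B. h u = 0) \<or> (\<forall>u\<in>A' \<union> B'. h u = 0) \<longrightarrow>
    (\<forall>i\<le>N. h (l i) = \<tau> * c i) \<longrightarrow> \<tau> = 0)"
proof -
  \<comment> \<open>This \<open>M\<close> gives 2 * (N * (M + 1))^(N - 1) = M * (M + 1)^(N - 1) < (M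
    + 1)^N. The left side dominates twice the Hilbert function of each linear system in bidegree
    \<open>(E, E)\<close>, and the right side is the number \<open>T\<close> of digit
    monomials.\<close>
  define M where "M = 2 * N ^ (N - 1)"
  define E where "E = N * M"
  define T where "T = (M + 1) ^ N"
  let ?C = "component (sys A B {}) E E" and ?C' = "component (sys A' B' {}) E E"
  have N: "N > 0" using pq by simp
  have bound: "2 * (nmon r E * nmon s E) < T" if rs: "0 < r" "0 < s" "r + s \<le> Suc N" for r s
  proof -
    obtain r' s' where r: "r = Suc r'" and s: "s = Suc s'" using rs by (metis gr0_implies_Suc)
    have "nmon r E * nmon s E \<le> (E + 1) ^ r' * (E + 1) ^ s'"
      unfolding r s by (intro mult_mono nmon_le) auto
    also have "\<dots> \<le> (E + 1) ^ (N - 1)"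
      unfolding power_add[symmetric] using rs r s by (intro power_increasing) auto
    also have "\<dots> \<le> (N * (M + 1)) ^ (N - 1)"
      using N by (intro power_mono) (auto simp: E_def)
    also have "2 * \<dots> = M * (M + 1) ^ (N - 1)"
      unfolding power_mult_distrib M_def by (simp add: mult_ac)
    also have "\<dots> < (M + 1) * (M + 1) ^ (N - 1)" by simp
    also have "\<dots> = T" using N by (simp add: T_def flip: power_Suc)
    finally show ?thesis by simp
  qed
  have hom: "homogeneous (sys A B {})" "homogeneous (sys A' B' {})"
    using homogeneous_sys ls by blast+
  have "int (dim (R E E)) \<le> int (nmon p E * nmon q E) + int (nmon p' E * nmon q' E) + int (dim (?C \<inter> ?C'))"
    using dim_Int_components[OF hom, of E E] by (simp add: hilb_linear[OF ls(1)] hilb_linear[OF ls(2)])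
  then have d: "dim (R E E) < T + dim (?C \<inter> ?C')"
    using bound[OF pq(1-3)] bound[OF pq(4-6)] by linarith
  have mon: "digit_monomial M l N \<nu> \<in> R E E" for \<nu>
    unfolding E_def by (rule digit_monomial_R) (rule l)
  have sub: "?C \<inter> ?C' \<subseteq> R E E" using component_subset[OF hom(1)] by blast
  \<comment> \<open>The relation lies in both ideals, so it vanishes at the zeros of either linear
    system.\<close>
  obtain \<gamma> where \<gamma>: "(\<Sum>\<nu><T. scale (\<gamma> \<nu>) (digit_monomial M l N \<nu>)) \<in> ?C \<inter> ?C'" "\<exists>\<nu><T. \<gamma> \<nu> \<noteq> 0"
    by (rule dependency[OF fin_dim_R subspace_R subspace_inter[OF subspace_component subspace_component] sub d mon])
  define F where "F x = (\<Sum>\<nu><T. \<gamma> \<nu> * digit_monomial M x N \<nu>)" for x :: "nat \<Rightarrow> 'k"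
  define \<pi> where "\<pi> = (\<Sum>\<nu><T. monom (\<gamma> \<nu>) \<nu>)"
  have "\<pi> \<noteq> 0"
  proof
    assume "\<pi> = 0"
    obtain \<nu> where \<nu>: "\<nu> < T" "\<gamma> \<nu> \<noteq> 0" using \<gamma>(2) by blast
    then have "coeff \<pi> \<nu> = \<gamma> \<nu>" by (simp add: \<pi>_def coeff_sum)
    then show False using \<open>\<pi> = 0\<close> \<nu>(2) by simp
  qed
  then have "finite {s. poly \<pi> s = 0}" by (rule poly_roots_finite)
  then have "{s. poly \<pi> s = 0} \<noteq> UNIV" using infinite_UNIV_alg_closed[where 'k = 'k] by auto
  then obtain s where s: "poly \<pi> s \<noteq> 0" by blast
  \<comment> \<open>Kronecker substitution turns the relation \<open>F\<close> into the nonzero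
    polynomial \<open>\<pi>\<close>, and \<open>s\<close> is not a root of it. So \<open>c\<close>
    is a point where \<open>F\<close> does not vanish, and as \<open>F\<close> is homogeneous, no
    nonzero multiple of \<open>c\<close> is in the image.\<close>
  define c where "c = (\<lambda>i. case i of 0 \<Rightarrow> 1 | Suc i \<Rightarrow> s ^ ((M + 1) ^ i))"
  have "F c = (\<Sum>\<nu><T. \<gamma> \<nu> * s ^ \<nu>)"
    unfolding F_def c_def T_def 
    by (intro sum.cong refl arg_cong2[of _ _ _ _ "(*)"] digit_monomial_kronecker) (simp only: lessThan_iff)
  also have "\<dots> = poly \<pi> s" by (simp add: \<pi>_def poly_sum poly_monom)
  finally have Fc: "F c \<noteq> 0" using s by simp
  show ?thesis
  proof (intro exI[of _ c] conjI ballI allI impI)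
    show "c 0 = 1" by (simp add: c_def)
    fix h \<tau> assume h: "h \<in> points" and zero: "(\<forall>u\<in>A \<union> B. h u = 0) \<or> (\<forall>u\<in>A' \<union> B'. h u = 0)"
      and \<tau>: "\<forall>i\<le>N. h (l i) = \<tau> * c i"
    let ?w = "\<Sum>\<nu><T. scale (\<gamma> \<nu>) (digit_monomial M l N \<nu>)"
    from zero have "h ?w = 0"
    proof
      assume z: "\<forall>u\<in>A \<union> B. h u = 0"
      show ?thesis by (rule points_component[OF h, of "sys A B {}" ?w E E]) (use z \<gamma>(1) in \<open>auto simp: sys_def\<close>)
    next
      assume z: "\<forall>u\<in>A' \<union> B'. h u = 0"
      show ?thesis by (rule points_component[OF h, of "sys A' B' {}" ?w E E]) (use z \<gamma>(1) in \<open>auto simp: sys_def\<close>)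
    qed
    moreover have "h ?w = F (\<lambda>i. h (l i))"
      using h by (simp add: F_def points_sum points_scale points_digit_monomial)
    moreover have "F (\<lambda>i. h (l i)) = F (\<lambda>i. \<tau> * c i)"
      unfolding F_def digit_monomial_def using \<tau> by (intro sum.cong prod.cong arg_cong2[of _ _ _ _ "(*)"] refl) auto
    moreover have "F (\<lambda>i. \<tau> * c i) = \<tau> ^ E * F c"
      by (simp add: F_def digit_monomial_scale E_def sum_distrib_left mult_ac)
    ultimately show "\<tau> = 0" using Fc by simp
  qed
qed

text \<open>The forms \<open>l'\<close> project the image of the forms \<open>l\<close> from the
  point \<open>c\<close>. A common zero of \<open>l'\<close> on either linear system is sent by
  \<open>l\<close> to a multiple of \<open>c\<close>, hence to 0 by the choice of \<open>c\<close>,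
  so no new zeros arise. Two linear systems are treated at once because the induction step cuts by a
  hyperplane in either block and needs the same \<open>l'\<close> for both.\<close>

lemma nonsingular_project:
  assumes l: "\<And>i. i \<le> N \<Longrightarrow> l i \<in> R 1 1"
    and ls: "linear_system p q A B" "linear_system p' q' A' B'"
    and pq: "0 < p" "0 < q" "p + q \<le> Suc N" "0 < p'" "0 < q'" "p' + q' \<le> Suc N"
    and ns: "nonsingular A B (l ` {..N})" "nonsingular A' B' (l ` {..N})"
  shows "\<exists>l'. l' ` {..<N} \<subseteq> span (l ` {..N}) \<and> l ` {..N} \<subseteq> span (insert (l 0) (l' ` {..<N})) \<and>
    nonsingular A B (l' ` {..<N}) \<and> nonsingular A' B' (l' ` {..<N})"
proof -
  have "\<exists>c. c 0 = (1 :: 'k) \<and> (\<forall>h\<in>points. \<forall>\<tau>. (\<forall>u\<in>A \<union> B. h u = 0) \<or> (\<forall>u\<in>A' \<union> B'. h u = 0) \<longrightarrow>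
      (\<forall>i\<le>N. h (l i) = \<tau> * c i) \<longrightarrow> \<tau> = 0)"
    by (rule point_off_image[OF _ ls pq]) (rule l)
  then obtain c where c: "c 0 = (1 :: 'k)"
    and c0: "\<forall>h\<in>points. \<forall>\<tau>. (\<forall>u\<in>A \<union> B. h u = 0) \<or> (\<forall>u\<in>A' \<union> B'. h u = 0) \<longrightarrow>
      (\<forall>i\<le>N. h (l i) = \<tau> * c i) \<longrightarrow> \<tau> = 0"
    by (elim exE conjE)
  define l' where "l' i = l (Suc i) - scale (c (Suc i)) (l 0)" for i
  have zero: "h (l i) = 0" if h: "h \<in> points" "(\<forall>u\<in>A \<union> B. h u = 0) \<or> (\<forall>u\<in>A' \<union> B'. h u = 0)"
    and hl: "\<forall>u\<in>l' ` {..<N}. h u = 0" and i: "i \<le> N" for h i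
  proof -
    have eq: "h (l j) = h (l 0) * c j" if "j \<le> N" for j
    proof (cases j)
      case 0 then show ?thesis using c by simp
    next
      case (Suc k)
      then have "h (l' k) = 0" using hl that by auto
      then show ?thesis using h(1) Suc by (simp add: l'_def points_diff points_scale)
    qed
    then have "h (l 0) = 0" using c0 h by blast
    then show ?thesis using eq[OF i] by simp
  qed
  have "l' ` {..<N} \<subseteq> span (l ` {..N})"
    by (auto simp: l'_def intro!: span_diff span_scale intro: span_base)
  moreover have "l ` {..N} \<subseteq> span (insert (l 0) (l' ` {..<N}))"
  proof clarify
    fix i assume i: "i \<le> N"
    show "l i \<in> span (insert (l 0) (l' ` {..<N}))"
    proof (cases i)
      case (Suc k)
      then have "l' k + scale (c i) (l 0) \<in> span (insert (l 0) (l' ` {..<N}))"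
        using i by (intro span_add span_scale span_base) auto
      then show ?thesis using Suc by (simp add: l'_def)
    qed (auto intro: span_base)
  qed
  moreover have "nonsingular A B (l' ` {..<N})"
    using ns(1) zero unfolding nonsingular_def by blast
  moreover have "nonsingular A' B' (l' ` {..<N})"
    using ns(2) zero unfolding nonsingular_def by blast
  ultimately show ?thesis by (intro exI[of _ l'] conjI)
qed

lemma nonsingular_mono:
  assumes "nonsingular A B L" "L \<subseteq> span L'"
  shows "nonsingular A B L'"
  unfolding nonsingular_def
proof (intro ballI impI)
  fix h assume h: "h \<in> points" "\<forall>u\<in>A \<union> B \<union> L'. h u = 0"
  have "h u = 0" if "u \<in> A \<union> B \<union> L" for u
  proof (cases "u \<in> L")
    case True
    then show ?thesis using points_span[OF h(1), of L' u] h(2) assms(2) by blast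
  qed (use that h(2) in blast)
  then show "(\<forall>u\<in>R 1 0. h u = 0) \<or> (\<forall>v\<in>R 0 1. h v = 0)"
    using assms(1) h(1) unfolding nonsingular_def by simp
qed

lemma nonsingular_reduce:
  assumes ls: "linear_system p q A B" "0 < p" "0 < q" and L: "finite L" "L \<subseteq> R 1 1" "nonsingular A B L"
  shows "\<exists>l. l ` {..<p + q - 1} \<subseteq> span L \<and> nonsingular A B (l ` {..<p + q - 1})"
proof -
  define m where "m = p + q - 1"
  have spL: "span L \<subseteq> R 1 1" by (rule span_minimal[OF L(2) subspace_R])
  obtain f and n :: nat where f: "L = f ` {i. i < n}"
    using finite_imp_nat_seg_image_inj_on[OF L(1)] by (elim exE conjE)
  \<comment> \<open>Padding with zero forms covers the case of fewer than \<open>p + q - 1\<close>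
    forms.\<close>
  define N where "N = max m n"
  define l where "l i = (if i < n then f i else 0)" for i
  have "L \<subseteq> l ` {..<N}"
  proof
    fix u assume "u \<in> L"
    then obtain i where "i < n" "u = f i" unfolding f by blast
    then show "u \<in> l ` {..<N}" by (intro image_eqI[of _ _ i]) (simp_all add: l_def N_def)
  qed
  then have "nonsingular A B (l ` {..<N})"
    by (intro nonsingular_mono[OF L(3)] order_trans[OF _ span_superset])
  moreover have "l ` {..<N} \<subseteq> span L"
    unfolding f l_def by (auto intro: span_base span_zero)
  moreover have "m \<le> N" by (simp add: N_def)
  ultimately have "\<exists>l. l ` {..<N} \<subseteq> span L \<and> nonsingular A B (l ` {..<N})" by blast
  with \<open>m \<le> N\<close> have "\<exists>l. l ` {..<m} \<subseteq> span L \<and> nonsingular A B (l ` {..<m})"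
  proof (induction N rule: dec_induct)
    case (step N)
    then obtain l where l: "l ` {..<Suc N} \<subseteq> span L" "nonsingular A B (l ` {..<Suc N})" by blast
    have eq: "{..<Suc N} = {..N}" by auto
    have lR: "l i \<in> R 1 1" if "i \<le> N" for i using l(1) spL that by (auto simp: eq)
    have pqN: "p + q \<le> Suc N" using step(1) by (simp add: m_def)
    have "\<exists>l'. l' ` {..<N} \<subseteq> span (l ` {..N}) \<and> l ` {..N} \<subseteq> span (insert (l 0) (l' ` {..<N})) \<and>
        nonsingular A B (l' ` {..<N}) \<and> nonsingular A B (l' ` {..<N})"
      by (rule nonsingular_project[OF _ ls(1) ls(1) ls(2,3) pqN ls(2,3) pqN l(2)[unfolded eq] l(2)[unfolded eq]])
        (rule lR)
    then obtain l' where "l' ` {..<N} \<subseteq> span (l ` {..N})" "nonsingular A B (l' ` {..<N})" by blast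
    moreover from this have "l' ` {..<N} \<subseteq> span L"
      using span_mono[OF l(1)] unfolding eq span_span by blast
    ultimately show ?case using step.IH by blast
  qed
  then show ?thesis unfolding m_def .
qed

end


section \<open>Hilbert functions of nonsingular systems\<close>

context bigraded_algebra
begin

text \<open>The base of the induction. The ideal contains all bilinear forms, so the quotient
  survives only where one degree is 0, and there the bound for linear systems suffices. The
  comparison of \<open>e\<close> and \<open>f\<close> is what makes \<open>ehilb\<close> vanish
  elsewhere.\<close>

lemma hilb_nonsingular_1:
  assumes ls: "linear_system p q A B" and L: "L \<subseteq> R 1 1" and ns: "nonsingular A B L"
    and c: "p = Suc 0 \<and> f \<le> e \<or> q = Suc 0 \<and> e \<le> f"
  shows "hilb (sys A B L) e f \<le> ehilb (p + q - 1) p q e f"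
proof (cases "e = 0 \<or> f = 0")
  case True
  then show ?thesis using hilb_le_nmon[OF ls L, of e f] by auto
next
  case False
  then obtain e' f' where ef: "e = Suc e'" "f = Suc f'" by (metis not0_implies_Suc)
  have "R 1 1 \<subseteq> component (sys A B L) 1 1"
    using c nonsingular_1_left[OF _ L ns] nonsingular_1_right[OF _ L ns] ls by metis
  then have "hilb (sys A B L) e f = 0"
    unfolding ef by (intro hilb_full component_full homogeneous_sys[OF ls L])
  moreover have "ehilb (p + q - 1) p q e f = 0"
    using c ehilb_1_left[of f e q q] ehilb_1_right[of e f p p] ef by auto
  ultimately show ?thesis by simp
qed

lemma nonsingular_insert:
  "nonsingular A B L \<Longrightarrow> nonsingular (insert x A) B L" "nonsingular A B L \<Longrightarrow> nonsingular A (insert y B) L"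
  by (auto simp: nonsingular_def)

lemma component_insert_fullD:
  assumes "homogeneous G" "u \<in> R i j" "hilb (insert (i, j, u) G) (e + i) (f + j) \<le> 0" "z \<in> R (e + i) (f + j)"
  obtains w where "w \<in> R e f" "z - u * w \<in> component G (e + i) (f + j)"
proof -
  interpret m: Vector_Spaces.linear scale scale "(*) u" by (rule linear_mult)
  have "homogeneous (insert (i, j, u) G)" using assms(1,2) by (auto simp: homogeneous_def)
  then have "z \<in> component (insert (i, j, u) G) (e + i) (f + j)" using hilb_le_0D assms(3,4) by blast
  then obtain a b where "a \<in> span (component G (e + i) (f + j))" "b \<in> span ((*) u ` R e f)" "z = a + b"
    unfolding component_insert span_Un by blast
  moreover from this obtain w where "w \<in> R e f" "b = u * w"
    unfolding m.span_image iffD2[OF span_eq_iff subspace_R] by blast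
  ultimately show thesis
    using that[of w] unfolding iffD2[OF span_eq_iff subspace_component] by simp
qed

text \<open>
  In large degrees every linear form outside \<open>B\<close> acts surjectively on the quotient, so the Hilbert
  function decreases. Where it is stationary and positive, a pencil of linear forms has a member that
  is not injective, because the field is algebraically closed.
\<close>

lemma hilb_eventually_0:
  assumes right: "\<And>A B L f. linear_system p (Suc q) A B \<Longrightarrow> finite L \<Longrightarrow> L \<subseteq> R 1 1 \<Longrightarrow> nonsingular A B L \<Longrightarrow>
      F \<le> f \<Longrightarrow> hilb (sys A B L) (Suc f) (Suc f) \<le> 0"
    and left: "\<And>A B L f. linear_system p' (Suc (Suc q)) A B \<Longrightarrow> finite L \<Longrightarrow> L \<subseteq> R 1 1 \<Longrightarrow> nonsingular A B L \<Longrightarrow>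
      F \<le> f \<Longrightarrow> hilb (sys A B L) (Suc f) f \<le> 0"
    and p: "p = Suc p'" and ls: "linear_system p (Suc (Suc q)) A B"
    and L: "finite L" "L \<subseteq> R 1 1" "nonsingular A B L"
  shows "\<exists>F. \<forall>f\<ge>F. hilb (sys A B L) f f = 0"
proof -
  define G where "G = sys A B L"
  have hom: "homogeneous G" unfolding G_def by (rule homogeneous_sys[OF ls L(2)])
  have surj_y: "hilb (insert (0, 1, y) G) (Suc f) (Suc f) \<le> 0" if "y \<in> R 0 1" "y \<notin> span B" "F \<le> f" for y f
    using right[OF linear_system_insert_right[OF ls that(1,2)] L(1,2) nonsingular_insert(2)[OF L(3)] that(3)]
    by (simp add: G_def sys_insert)
  obtain x where x: "x \<in> R 1 0" "x \<notin> span A" using ex_left[OF ls[unfolded p]] by blast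
  have surj_x: "hilb (insert (1, 0, x) G) (Suc f) f \<le> 0" if "F \<le> f" for f
    using left[OF linear_system_insert_left[OF ls[unfolded p] x] L(1,2) nonsingular_insert(1)[OF L(3)] that]
    by (simp add: G_def sys_insert)
  obtain y0 where y0: "y0 \<in> R 0 1" "y0 \<notin> span B" using ex_right ls by blast
  obtain y1 where y1: "y1 \<in> R 0 1" "y1 \<notin> span (insert y0 B)"
    using ex_right linear_system_insert_right[OF ls y0] by blast
  have y1B: "y1 \<notin> span B" using y1(2) span_mono[of B "insert y0 B"] by blast
  have le_x: "hilb G (Suc f) f \<le> hilb G f f" if "F \<le> f" for f
    using hilb_insert_le[OF hom x(1), of f f] surj_x[OF that] by simp
  have le_y: "hilb G (Suc f) (Suc f) \<le> hilb G (Suc f) f" if "F \<le> f" for f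
    using hilb_insert_le[OF hom y0(1), of "Suc f" f] surj_y[OF y0 that] by simp
  \<comment> \<open>Beyond \<open>F\<close> the Hilbert function does not increase along
    \<open>(f, f)\<close>, \<open>(Suc f, f)\<close>, \<open>(Suc f, Suc f)\<close>. At a minimum on
    the diagonal both steps are therefore equalities, and surjective multiplications become
    injective.\<close>
  define f1 where "f1 = (ARG_MIN (\<lambda>f. nat (hilb G f f)) f. F \<le> f)"
  have f1: "F \<le> f1" "\<And>f. F \<le> f \<Longrightarrow> nat (hilb G f1 f1) \<le> nat (hilb G f f)"
    using arg_min_nat_lemma[of "\<lambda>f. F \<le> f" F "\<lambda>f. nat (hilb G f f)"] by (auto simp: f1_def)
  have "hilb G f1 f1 \<le> hilb G (Suc f1) (Suc f1)"
    using f1(2)[of "Suc f1"] f1(1) hilb_nonneg[OF hom, of "Suc f1" "Suc f1"] by simp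
  then have eq: "hilb G (Suc f1) f1 = hilb G (Suc f1) (Suc f1)" "hilb G f1 f1 = hilb G (Suc f1) f1"
    using le_x[OF f1(1)] le_y[OF f1(1)] by auto
  have inj: "r \<in> component G (Suc f1) f1"
    if "y \<in> R 0 1" "y \<notin> span B" "r \<in> R (Suc f1) f1" "y * r \<in> component G (Suc f1) (Suc f1)" for y r
    using hilb_insert_injD[OF hom that(1), of "Suc f1" f1 r] surj_y[OF that(1,2) f1(1)] eq that(3,4) by simp
  have "hilb G f1 f1 = 0"
  proof (rule ccontr)
    assume pos: "hilb G f1 f1 \<noteq> 0"
    let ?W = "R (Suc f1) f1" and ?W1 = "component G (Suc f1) f1" and ?U = "component G (Suc f1) (Suc f1)"
    have "?W1 \<noteq> ?W" using pos eq by (auto simp: hilb_def)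
    then obtain w0 where w0: "w0 \<in> ?W" "w0 \<notin> ?W1" using component_subset[OF hom] by blast
    have "\<exists>w'\<in>?W. y0 * w - y1 * w' \<in> ?U" if w: "w \<in> ?W" for w
    proof -
      have "y0 * w \<in> R (Suc f1 + 0) (f1 + 1)" using R_mult[OF y0(1) w] by simp
      then show ?thesis
        using component_insert_fullD[OF hom y1(1), of "Suc f1" f1 "y0 * w"] surj_y[OF y1(1) y1B f1(1)] by auto
    qed
    \<comment> \<open>\<open>T w\<close> is a quotient of \<open>y0 * w\<close> by \<open>y1\<close>
      modulo the ideal. It is a mere choice and need not be linear; only the orbit of
      \<open>w0\<close> is used.\<close>
    then obtain T where T: "\<And>w. w \<in> ?W \<Longrightarrow> T w \<in> ?W" "\<And>w. w \<in> ?W \<Longrightarrow> y0 * w - y1 * T w \<in> ?U" by metis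
    define w where "w i = (T ^^ i) w0" for i
    have wW: "w i \<in> ?W" for i by (induction i) (simp_all add: w_def w0 T)
    have wS: "y0 * w i - y1 * w (Suc i) \<in> ?U" for i using T(2)[OF wW[of i]] by (simp add: w_def)
    obtain \<tau> d and t :: nat where v: "(\<Sum>i<t. scale (d i) (w i)) \<notin> ?W1"
      and dep: "(\<Sum>i<t. scale (d i) (w (Suc i) - scale \<tau> (w i))) \<in> ?W1"
    proof (rule shift_eigenvector[of ?W ?W1 w])
      fix t :: nat and c :: "nat \<Rightarrow> 'k" assume "0 < t"
      then show "\<exists>\<tau> d. d (t - 1) = 1 \<and> c 0 = - \<tau> * d 0 \<and> (\<forall>i>0. i < t \<longrightarrow> c i = d (i - 1) - \<tau> * d i)"
        by (rule monic_root_factor[of t c]) blast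
    qed (use wW w0 in \<open>simp_all add: fin_dim_R subspace_R subspace_component component_subset[OF hom] w_def\<close>)
    let ?v = "\<Sum>i<t. scale (d i) (w i)" and ?y = "y0 - scale \<tau> y1"
    \<comment> \<open>Modulo the ideal \<open>y0 * w i\<close> equals \<open>y1 * w (Suc i)\<close>,
      so the eigenvector \<open>?v\<close> of the shift is killed by the member
      \<open>y0 - \<tau> y1\<close> of the pencil.\<close>
    have "?y * ?v = (\<Sum>i<t. scale (d i) (y0 * w i - y1 * w (Suc i))) +
        y1 * (\<Sum>i<t. scale (d i) (w (Suc i) - scale \<tau> (w i)))"
      by (simp add: sum_distrib_left scale_mult scale_mult_right algebra_simps flip: sum.distrib)
    moreover have "y1 * (\<Sum>i<t. scale (d i) (w (Suc i) - scale \<tau> (w i))) \<in> ?U"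
      using component_mult[OF dep y1(1)] by simp
    ultimately have "?y * ?v \<in> ?U"
      using wS by (simp add: subspace_add subspace_sum subspace_scale subspace_component)
    moreover have "?y \<in> R 0 1"
      using y0 y1 by (simp add: subspace_diff subspace_scale subspace_R)
    moreover have "?y \<notin> span B"
    proof
      assume y: "?y \<in> span B"
      show False
      proof (cases "\<tau> = 0")
        case True then show ?thesis using y y0 by simp
      next
        case False
        have "y0 - ?y \<in> span (insert y0 B)"
          by (rule span_diff[OF span_base subsetD[OF span_mono y]]) auto
        then have "scale \<tau> y1 \<in> span (insert y0 B)" by simp
        from span_scale[OF this, of "inverse \<tau>"] show ?thesis using False y1 by simp
      qed
    qed
    moreover have "?v \<in> ?W" using wW by (intro subspace_sum subspace_scale subspace_R)
    ultimately show False using inj v by blast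
  qed
  have "hilb G f f = 0" if "f1 \<le> f" for f
    using that
  proof (induction f rule: dec_induct)
    case base show ?case by fact
  next
    case (step f)
    then show ?case using le_x[of f] le_y[of f] f1(1) hilb_nonneg[OF hom, of "Suc f" "Suc f"] by simp
  qed
  then show ?thesis unfolding G_def by blast
qed

lemma hilb_forms_le:
  assumes ls: "linear_system p q A B" and l: "\<And>i. i < n \<Longrightarrow> l i \<in> R 1 1" and t: "t < n"
  shows "hilb (sys A B (l ` {..<t})) (Suc e) (Suc f) \<le>
    hilb (sys A B (l ` {..<Suc t})) (Suc e) (Suc f) + hilb (sys A B (l ` {..<t})) e f"
proof -
  have "homogeneous (sys A B (l ` {..<t}))" using l t by (intro homogeneous_sys[OF ls]) auto
  from hilb_insert_le[OF this l[OF t], of e f] show ?thesis by (simp add: lessThan_Suc sys_insert)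
qed

lemma hilb_forms_low: "hilb (sys A B (l ` {..<Suc t})) e 0 = hilb (sys A B (l ` {..<t})) e 0"
  by (simp add: lessThan_Suc sys_insert hilb_insert_low)

text \<open>The sandwich along the diagonal with offset \<open>c\<close>: the values without
  bilinear forms are exact by \<open>hilb_linear\<close>, so an upper bound after the last form is
  automatically attained.\<close>

lemma hilb_eq_ehilb:
  assumes ls: "linear_system p q A B" and l: "\<And>i. i < n \<Longrightarrow> l i \<in> R 1 1"
    and top: "\<And>f. hilb (sys A B (l ` {..<n})) (f + c) f \<le> ehilb n p q (f + c) f"
  shows "hilb (sys A B (l ` {..<n})) (f + c) f = ehilb n p q (f + c) f"
proof (rule difference_sandwich[where M = n and h = "\<lambda>t f. hilb (sys A B (l ` {..<t})) (f + c) f"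
      and E = "\<lambda>t f. ehilb t p q (f + c) f"])
  fix t f assume "t < n"
  then show "hilb (sys A B (l ` {..<t})) (Suc f + c) (Suc f) \<le>
      hilb (sys A B (l ` {..<Suc t})) (Suc f + c) (Suc f) + hilb (sys A B (l ` {..<t})) (f + c) f"
    using hilb_forms_le[where l = l and n = n and t = t and e = "f + c" and f = f, OF ls l] by simp
qed (use top hilb_linear[OF ls] in \<open>simp_all add: hilb_forms_low\<close>)

text \<open>The two hyperplane sections have one variable less, and \<open>n\<close> forms are the
  number that the induction hypothesis expects for them. It bounds the quotient by the first
  \<open>n\<close> forms, the sandwich makes these bounds exact, and the last form
  \<open>l 0\<close> is then shown to be injective.\<close>

lemma hilb_nonsingular_step:
  assumes right: "\<And>A B L f. linear_system (Suc (Suc p)) (Suc q) A B \<Longrightarrow> finite L \<Longrightarrow> L \<subseteq> R 1 1 \<Longrightarrow>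
      nonsingular A B L \<Longrightarrow> hilb (sys A B L) f f \<le> ehilb (p + q + 2) (Suc (Suc p)) (Suc q) f f"
    and left: "\<And>A B L f. linear_system (Suc p) (Suc (Suc q)) A B \<Longrightarrow> finite L \<Longrightarrow> L \<subseteq> R 1 1 \<Longrightarrow>
      nonsingular A B L \<Longrightarrow> hilb (sys A B L) (Suc f) f \<le> ehilb (p + q + 2) (Suc p) (Suc (Suc q)) (Suc f) f"
    and ls: "linear_system (Suc (Suc p)) (Suc (Suc q)) A B"
    and L: "finite L" "L \<subseteq> R 1 1" "nonsingular A B L"
  shows "hilb (sys A B L) f f \<le> ehilb (p + q + 3) (Suc (Suc p)) (Suc (Suc q)) f f"
    and "hilb (sys A B L) (Suc f) f \<le> ehilb (p + q + 3) (Suc (Suc p)) (Suc (Suc q)) (Suc f) f"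
proof -
  \<comment> \<open>The system is reduced to \<open>Suc n\<close> forms, which is one less than the
    total number of variables.\<close>
  define n where "n = p + q + 2"
  obtain x where x: "x \<in> R 1 0" "x \<notin> span A" using ex_left ls by blast
  obtain y where y: "y \<in> R 0 1" "y \<notin> span B" using ex_right ls by blast
  note lsx = linear_system_insert_left[OF ls x] and lsy = linear_system_insert_right[OF ls y]
  have "\<exists>l. l ` {..<Suc (Suc p) + Suc (Suc q) - 1} \<subseteq> span L \<and>
      nonsingular A B (l ` {..<Suc (Suc p) + Suc (Suc q) - 1})"
    by (rule nonsingular_reduce[OF ls zero_less_Suc zero_less_Suc L])
  moreover have "{..<Suc (Suc p) + Suc (Suc q) - 1} = {..n}" unfolding n_def by auto
  ultimately obtain l where l: "l ` {..n} \<subseteq> span L" "nonsingular A B (l ` {..n})" by auto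
  have spL: "span L \<subseteq> R 1 1" by (rule span_minimal[OF L(2) subspace_R])
  have lR: "l i \<in> R 1 1" if "i \<le> n" for i using l(1) spL that by auto
  have "\<exists>l'. l' ` {..<n} \<subseteq> span (l ` {..n}) \<and> l ` {..n} \<subseteq> span (insert (l 0) (l' ` {..<n})) \<and>
    nonsingular (insert x A) B (l' ` {..<n}) \<and> nonsingular A (insert y B) (l' ` {..<n})"
    by (rule nonsingular_project[OF _ lsx lsy])
      (use lR nonsingular_insert[OF l(2)] in \<open>simp_all add: n_def\<close>)
  then obtain l' where l': "l' ` {..<n} \<subseteq> span (l ` {..n})" "l ` {..n} \<subseteq> span (insert (l 0) (l' ` {..<n}))"
    "nonsingular (insert x A) B (l' ` {..<n})" "nonsingular A (insert y B) (l' ` {..<n})" by blast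
  have l'L: "l' ` {..<n} \<subseteq> span L" using l'(1) span_mono[OF l(1)] unfolding span_span by blast
  have l'R: "l' i \<in> R 1 1" if "i < n" for i using l'L spL that by auto
  then have l'R': "l' ` {..<n} \<subseteq> R 1 1" by auto
  have l0: "l 0 \<in> R 1 1" using lR by simp
  define G where "G = sys A B (l' ` {..<n})"
  define J where "J = insert (1, 1, l 0) G"
  have hom: "homogeneous G" unfolding G_def by (rule homogeneous_sys[OF ls l'R'])
  have J: "J = sys A B (insert (l 0) (l' ` {..<n}))" by (simp add: J_def G_def sys_insert)
  let ?p = "Suc (Suc p)" and ?q = "Suc (Suc q)"
  have ux: "hilb (insert (1, 0, x) G) (Suc f) f \<le> ehilb n (Suc p) ?q (Suc f) f" for f
    using left[OF lsx _ l'R' l'(3), of f] by (simp add: G_def sys_insert n_def)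
  have uy: "hilb (insert (0, 1, y) G) f f \<le> ehilb n ?p (Suc q) f f" for f
    using right[OF lsy _ l'R' l'(4), of f] by (simp add: G_def sys_insert n_def)
  \<comment> \<open>Climbing the staircase: multiplication by \<open>x\<close> leads from
    \<open>(f, f)\<close> to \<open>(Suc f, f)\<close> and multiplication by \<open>y\<close> on to
    \<open>(Suc f, Suc f)\<close>. The off-diagonal degree is there so that each step involves one
    linear form.\<close>
  have upper: "hilb G f f \<le> ehilb n ?p ?q f f \<and> hilb G (Suc f) f \<le> ehilb n ?p ?q (Suc f) f" for f
  proof (induction f)
    case 0
    have "hilb G 0 0 \<le> ehilb n ?p ?q 0 0" using hilb_0_0_le[of G] by simp
    then show ?case
      using hilb_insert_le[OF hom x(1), of 0 0] ux[of 0] by (simp add: ehilb_left del: ehilb_0)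
  next
    case (Suc f)
    have "hilb G (Suc f) (Suc f) \<le> ehilb n ?p ?q (Suc f) (Suc f)"
      using hilb_insert_le[OF hom y(1), of "Suc f" f] uy[of "Suc f"] Suc
      by (simp add: ehilb_right[of n ?p "Suc q"])
    then show ?case
      using hilb_insert_le[OF hom x(1), of "Suc f" "Suc f"] ux[of "Suc f"]
      by (simp add: ehilb_left[of n "Suc p" ?q "Suc f"])
  qed
  have exact: "hilb G f f = ehilb n ?p ?q f f" "hilb G (Suc f) f = ehilb n ?p ?q (Suc f) f" for f
    using hilb_eq_ehilb[where c = 0 and f = f and n = n and l = l', OF ls l'R]
      hilb_eq_ehilb[where c = 1 and f = f and n = n and l = l', OF ls l'R] upper by (simp_all add: G_def)
  \<comment> \<open>With exact values the count leaves no room for a kernel, so \<open>x\<close> and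
    \<open>y\<close> are nonzerodivisors along the staircase.\<close>
  have inj_x: "r \<in> component G f f" if "r \<in> R f f" "x * r \<in> component G (Suc f) f" for f r
    using hilb_insert_injD[OF hom x(1), of f f r] ux[of f] that
    by (simp add: exact ehilb_left[of n "Suc p" ?q f])
  have inj_y: "r \<in> component G (Suc f) f" if "r \<in> R (Suc f) f" "y * r \<in> component G (Suc f) (Suc f)" for f r
    using hilb_insert_injD[OF hom y(1), of "Suc f" f r] uy[of "Suc f"] that
    by (simp add: exact ehilb_right[of n ?p "Suc q" "Suc f"])
  have nsJ: "nonsingular A B (insert (l 0) (l' ` {..<n}))" by (rule nonsingular_mono[OF l(2) l'(2)])
  have "\<exists>F. \<forall>f\<ge>F. hilb J f f = 0"
    unfolding J
  proof (rule hilb_eventually_0[where F = "Suc n", OF _ _ refl ls _ _ nsJ])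
    fix A B L f assume *: "linear_system ?p (Suc q) A B" "finite L" "L \<subseteq> R 1 1" "nonsingular A B L" "Suc n \<le> f"
    show "hilb (sys A B L) (Suc f) (Suc f) \<le> 0"
      using right[OF *(1-4), of "Suc f"] *(5) ehilb_eq_0[of ?p "Suc q" n "Suc f" "Suc f"] by (simp add: n_def)
  next
    fix A B L f assume *: "linear_system (Suc p) ?q A B" "finite L" "L \<subseteq> R 1 1" "nonsingular A B L" "Suc n \<le> f"
    show "hilb (sys A B L) (Suc f) f \<le> 0"
      using left[OF *(1-4), of f] *(5) ehilb_eq_0[of "Suc p" ?q n "Suc f" f] by (simp add: n_def)
  qed (use l0 l'R' in auto)
  then obtain F where F: "\<And>f. F \<le> f \<Longrightarrow> hilb J f f = 0" by blast
  define F' where "F' = max F (Suc n)"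
  \<comment> \<open>In large degree both \<open>J\<close> and the expected function vanish, so
    multiplication by \<open>l 0\<close> is surjective between quotients of equal dimension and
    hence injective.\<close>
  have large: "r \<in> component G f f"
    if "F' \<le> f" "r \<in> R f f" "l 0 * r \<in> component G (Suc f) (Suc f)" for f r
  proof -
    have "ehilb (Suc n) ?p ?q (Suc f) (Suc f) = 0"
      using that(1) by (intro ehilb_eq_0) (auto simp: n_def F'_def)
    then show ?thesis
      using hilb_insert_injD[OF hom l0, of f f r] F[of "Suc f"] that by (simp add: exact J_def F'_def)
  qed
  \<comment> \<open>Multiplying \<open>r\<close> by \<open>x\<close> and \<open>y\<close> moves it
    one step up the diagonal, where injectivity is known, and \<open>x\<close> and \<open>y\<close>
    can be cancelled again.\<close>
  have down: "r \<in> component G f f"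
    if inj: "\<And>r. r \<in> R (Suc f) (Suc f) \<Longrightarrow> l 0 * r \<in> component G (Suc (Suc f)) (Suc (Suc f)) \<Longrightarrow>
        r \<in> component G (Suc f) (Suc f)"
      and r: "r \<in> R f f" "l 0 * r \<in> component G (Suc f) (Suc f)" for f r
  proof -
    have xr: "x * r \<in> R (Suc f) f" using R_mult[OF x(1) r(1)] by simp
    have "y * (x * r) \<in> R (Suc f) (Suc f)" using R_mult[OF y(1) xr] by simp
    moreover have "x * (l 0 * r) \<in> component G (Suc (Suc f)) (Suc f)"
      using component_mult[OF r(2) x(1)] by simp
    then have "y * (x * (l 0 * r)) \<in> component G (Suc (Suc f)) (Suc (Suc f))"
      using component_mult[OF _ y(1), of "x * (l 0 * r)" G "Suc (Suc f)" "Suc f"] by simp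
    then have "l 0 * (y * (x * r)) \<in> component G (Suc (Suc f)) (Suc (Suc f))" by (simp add: mult_ac)
    ultimately have "y * (x * r) \<in> component G (Suc f) (Suc f)" by (rule inj)
    then show ?thesis using inj_x[OF r(1)] inj_y[OF xr] by blast
  qed
  have inj: "r \<in> component G f f" if "r \<in> R f f" "l 0 * r \<in> component G (Suc f) (Suc f)" for f r
  proof (cases "F' \<le> f")
    case True then show ?thesis using large that by blast
  next
    case False
    then have "f \<le> F'" by simp
    then have "\<forall>r. r \<in> R f f \<longrightarrow> l 0 * r \<in> component G (Suc f) (Suc f) \<longrightarrow> r \<in> component G f f"
    proof (induction rule: inc_induct)
      case base show ?case using large by blast
    next
      case (step f) then show ?case using down[of f] by blast
    qed
    then show ?thesis using that by blast
  qed
  have inj': "r \<in> component G (Suc f) f" if r: "r \<in> R (Suc f) f" "l 0 * r \<in> component G (Suc (Suc f)) (Suc f)" for f r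
  proof -
    have "y * r \<in> R (Suc f) (Suc f)" using R_mult[OF y(1) r(1)] by simp
    moreover have "y * (l 0 * r) \<in> component G (Suc (Suc f)) (Suc (Suc f))"
      using component_mult[OF r(2) y(1)] by simp
    then have "l 0 * (y * r) \<in> component G (Suc (Suc f)) (Suc (Suc f))" by (simp add: mult_ac)
    ultimately have "y * r \<in> component G (Suc f) (Suc f)" by (rule inj)
    then show ?thesis using inj_y[OF r(1)] by blast
  qed
  have J1: "hilb J f f = ehilb (Suc n) ?p ?q f f" for f
  proof (cases f)
    case 0 then show ?thesis by (simp add: J_def hilb_insert_low exact)
  next
    case (Suc g)
    then show ?thesis using hilb_insert_inj[OF hom l0, of g g] inj by (simp add: J_def exact)
  qed
  have J2: "hilb J (Suc f) f = ehilb (Suc n) ?p ?q (Suc f) f" for f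
  proof (cases f)
    case 0 then show ?thesis by (simp add: J_def hilb_insert_low exact)
  next
    case (Suc g)
    then show ?thesis using hilb_insert_inj[OF hom l0, of "Suc g" g] inj' by (simp add: J_def exact)
  qed
  \<comment> \<open>All forms of \<open>J\<close> are combinations of the original ones, so the
    original ideal is at least as large and its quotient at most as large.\<close>
  have "insert (l 0) (l' ` {..<n}) \<subseteq> component (sys A B L) 1 1"
    using l(1) l'L span_subset_component(3)[of L A B] by auto
  then have "hilb (sys A B L) e f \<le> hilb J e f" for e f
    unfolding J by (intro hilb_antimono homogeneous_sys[OF ls L(2)])
      (auto simp: sys_def intro: component_gen)
  from this[of f f] this[of "Suc f" f] J1[of f] J2[of f]
  show "hilb (sys A B L) f f \<le> ehilb (p + q + 3) ?p ?q f f"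
    "hilb (sys A B L) (Suc f) f \<le> ehilb (p + q + 3) ?p ?q (Suc f) f"
    by (simp_all add: n_def eval_nat_numeral)
qed

text \<open>The restriction \<open>1 < q\<close> off the diagonal is essential: for
  \<open>p = 2\<close>, \<open>q = 1\<close>, \<open>f = 1\<close> the right-hand side is
  -1.\<close>

lemma hilb_nonsingular:
  assumes "linear_system p q A B" "0 < p" "0 < q" "finite L" "L \<subseteq> R 1 1" "nonsingular A B L"
  shows "hilb (sys A B L) f f \<le> ehilb (p + q - 1) p q f f"
    and "1 < q \<Longrightarrow> hilb (sys A B L) (Suc f) f \<le> ehilb (p + q - 1) p q (Suc f) f"
proof -
  have "hilb (sys A B L) f f \<le> ehilb (p + q - 1) p q f f \<and>
      (1 < q \<longrightarrow> hilb (sys A B L) (Suc f) f \<le> ehilb (p + q - 1) p q (Suc f) f)"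
    using assms
  proof (induction "p + q" arbitrary: p q A B L f rule: less_induct)
    case less
    show ?case
    proof (cases "p = 1 \<or> q = 1")
      case True
      then show ?thesis
        using hilb_nonsingular_1[OF less.prems(1,5,6), of f f]
          hilb_nonsingular_1[OF less.prems(1,5,6), of f "Suc f"] by auto
    next
      case False
      then obtain p' q' where pq: "p = Suc (Suc p')" "q = Suc (Suc q')"
        using less.prems(2,3) by (metis One_nat_def gr0_implies_Suc not0_implies_Suc)
      have right: "hilb (sys A B L) f f \<le> ehilb (p' + q' + 2) (Suc (Suc p')) (Suc q') f f"
        if "linear_system (Suc (Suc p')) (Suc q') A B" "finite L" "L \<subseteq> R 1 1" "nonsingular A B L" for A B L f
        using less.hyps[OF _ that(1) _ _ that(2-4), of f] by (simp add: pq eval_nat_numeral)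
      have left: "hilb (sys A B L) (Suc f) f \<le> ehilb (p' + q' + 2) (Suc p') (Suc (Suc q')) (Suc f) f"
        if "linear_system (Suc p') (Suc (Suc q')) A B" "finite L" "L \<subseteq> R 1 1" "nonsingular A B L" for A B L f
        using less.hyps[OF _ that(1) _ _ that(2-4), of f] by (simp add: pq eval_nat_numeral)
      show ?thesis
        using hilb_nonsingular_step[OF right left less.prems(1)[unfolded pq] less.prems(4-6), of f]
        by (simp add: pq eval_nat_numeral)
    qed
  qed
  then show "hilb (sys A B L) f f \<le> ehilb (p + q - 1) p q f f"
    "1 < q \<Longrightarrow> hilb (sys A B L) (Suc f) f \<le> ehilb (p + q - 1) p q (Suc f) f" by simp_all
qed

text \<open>
  If the forms vanish at all points of \<open>T\<close>, then the evaluations at these points are linearly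
  independent functionals on the quotient in large degrees.
\<close>

lemma card_points_le:
  fixes n :: nat
  assumes ls: "linear_system p q A B" and pq: "0 < p" "0 < q"
    and l: "\<And>i. i \<le> n \<Longrightarrow> l i \<in> R 1 1" and ns: "nonsingular A B (l ` {..n})"
    and T: "finite T" "T \<subseteq> points"
    and zero: "\<forall>h\<in>T. \<forall>u\<in>A \<union> B \<union> l ` {..<n}. h u = 0"
    and sep: "\<forall>h\<in>T. \<exists>g\<in>R 1 1. h g \<noteq> 0"
      "\<forall>h\<in>T. \<forall>h'\<in>T. h \<noteq> h' \<longrightarrow> (\<exists>g\<in>R 1 1. h g \<noteq> 0 \<and> h' g = 0)"
  shows "card T \<le> 2 ^ (p + q - 2)"
proof -
  define G where "G = sys A B (l ` {..<n})"
  have lR: "l ` {..<n} \<subseteq> R 1 1" "l ` {..n} \<subseteq> R 1 1"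
    by (rule image_subsetI, rule l, force)+
  have hom: "homogeneous G" unfolding G_def by (rule homogeneous_sys[OF ls lR(1)])
  \<comment> \<open>Large enough for a product of \<open>card T - 1\<close> separating forms and for
    the range in which \<open>ehilb_le\<close> applies.\<close>
  define f where "f = card T + p + q"
  have hT: "h g = 0" if "h \<in> T" "g \<in> component G f f" for h g
    by (rule points_component[of h G g f f]) (use that T zero in \<open>auto simp: G_def sys_def\<close>)
  have "\<exists>g\<in>R f f. h g \<noteq> 0 \<and> (\<forall>h'\<in>T - {h}. h' g = 0)" if h: "h \<in> T" for h
  proof -
    obtain g0 where g0: "g0 \<in> R 1 1" "h g0 \<noteq> 0" using sep(1) h by blast
    have "\<exists>g. g \<in> R 1 1 \<and> h g \<noteq> 0 \<and> h' g = 0" if "h' \<in> T - {h}" for h'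
    proof -
      have "h' \<in> T" "h \<noteq> h'" using that by auto
      then show ?thesis using bspec[OF bspec[OF sep(2) h]] by blast
    qed
    then obtain g where g: "\<And>h'. h' \<in> T - {h} \<Longrightarrow> g h' \<in> R 1 1 \<and> h (g h') \<noteq> 0 \<and> h' (g h') = 0" by metis
    \<comment> \<open>The product of the separating forms vanishes at every other point; the power
      of \<open>g0\<close>, nonzero at \<open>h\<close>, fills up the bidegree to
      \<open>(f, f)\<close>.\<close>
    define w where "w = g0 ^ (f - card (T - {h})) * prod g (T - {h})"
    have c: "card (T - {h}) \<le> f" unfolding f_def using card_mono[OF T(1), of "T - {h}"] by auto
    have "prod g (T - {h}) \<in> R (card (T - {h}) * 1) (card (T - {h}) * 1)"
      using g T by (intro R_prod) auto
    then have "w \<in> R f f"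
      unfolding w_def using R_mult[OF R_power[OF g0(1), of "f - card (T - {h})"]] c by fastforce
    moreover have hp: "h \<in> points" using h T by auto
    then have "h w \<noteq> 0" using g0 g T by (simp add: w_def points_mult points_power points_prod)
    moreover have "h' w = 0" if h': "h' \<in> T - {h}" for h'
    proof -
      have "h' \<in> points" using h' T by auto
      moreover have "(\<Prod>i\<in>T - {h}. h' (g i)) = 0" using h' g[OF h'] T by (intro prod_zero) auto
      ultimately show ?thesis by (simp add: w_def points_mult points_prod)
    qed
    ultimately show ?thesis by blast
  qed
  then obtain w where w: "\<And>h. h \<in> T \<Longrightarrow> w h \<in> R f f" "\<And>h. h \<in> T \<Longrightarrow> h (w h) \<noteq> 0"
    "\<And>h h'. h \<in> T \<Longrightarrow> h' \<in> T \<Longrightarrow> h' \<noteq> h \<Longrightarrow> h' (w h) = 0" by (metis Diff_iff singletonD)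
  have dim: "dim (component G f f \<union> w ` S) = dim (component G f f) + card S" if "S \<subseteq> T" for S
    using finite_subset[OF that T(1)] that
  proof (induction S rule: finite_induct)
    case (insert h S)
    have "w h \<notin> span (component G f f \<union> w ` S)"
    proof
      assume *: "w h \<in> span (component G f f \<union> w ` S)"
      have "h (w h) = 0"
      proof (rule points_span[OF _ _ *])
        fix g assume "g \<in> component G f f \<union> w ` S"
        then show "h g = 0"
        proof
          assume "g \<in> w ` S"
          then obtain h' where "h' \<in> S" "g = w h'" by blast
          then show ?thesis using w(3)[of h' h] insert by auto
        qed (use hT insert in blast)
      qed (use insert T in blast)
      then show False using w(2) insert by simp
    qed
    moreover have "component G f f \<union> w ` insert h S = insert (w h) (component G f f \<union> w ` S)" by auto
    moreover have "fin_dim (component G f f \<union> w ` S)"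
      using insert by (intro fin_dim_Un fin_dim_component[OF hom] fin_dim_finite) auto
    ultimately show ?case using insert dim_insert_fin by simp
  qed simp
  have "dim (component G f f \<union> w ` T) \<le> dim (R f f)"
    using component_subset[OF hom, of f f] w(1) span_superset[of "R f f"]
    by (intro dim_mono_fin fin_dim_R) blast
  then have "int (card T) \<le> hilb G f f" using dim[of T] by (simp add: hilb_def)
  \<comment> \<open>Leaving out the form \<open>l n\<close> costs at most a sum along the diagonal.
    Subadditivity alone gives this, so \<open>l n\<close> need not be regular and \<open>n\<close>
    need not be tied to \<open>p + q\<close>.\<close>
  also have "\<dots> \<le> (\<Sum>g\<le>f. hilb (sys A B (l ` {..<Suc n})) g g)"
  proof -
    have "hilb G g g \<le> (\<Sum>g\<le>g. hilb (sys A B (l ` {..<Suc n})) g g)" for g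
    proof (induction g)
      case 0 show ?case using hilb_forms_low[of A B l n 0] by (simp add: G_def)
    next
      case (Suc g)
      have "hilb G (Suc g) (Suc g) \<le> hilb (sys A B (l ` {..<Suc n})) (Suc g) (Suc g) + hilb G g g"
        unfolding G_def by (rule hilb_forms_le[where n = "Suc n", OF ls]) (simp_all only: less_Suc_eq_le l le_refl)
      then show ?case using Suc by simp
    qed
    then show ?thesis .
  qed
  also have "\<dots> \<le> (\<Sum>g\<le>f. ehilb (p + q - 1) p q g g)"
  proof (rule sum_mono)
    fix g
    show "hilb (sys A B (l ` {..<Suc n})) g g \<le> ehilb (p + q - 1) p q g g"
      unfolding lessThan_Suc_atMost by (rule hilb_nonsingular(1)[OF ls pq _ lR(2) ns]) simp
  qed
  also have "\<dots> = ehilb (p + q - 2) p q f f"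
  proof -
    have "p + q - 1 = Suc (p + q - 2)" using pq by linarith
    then show ?thesis by (simp only: sum_ehilb_diag)
  qed
  also have "\<dots> \<le> 2 ^ (p + q - 2)" using pq by (intro ehilb_le) (auto simp: f_def)
  finally show ?thesis by (metis of_nat_le_iff of_nat_numeral of_nat_power)
qed

end


section \<open>Bihomogeneous polynomial functions\<close>

declare plus_fun_apply [simp del] times_fun_apply [simp del] zero_fun_apply [simp del] one_fun_apply [simp del]

lemmas fun_apply = plus_fun_apply times_fun_apply zero_fun_apply one_fun_apply

definition fscale :: "'k \<Rightarrow> ('z \<Rightarrow> 'k::field) \<Rightarrow> 'z \<Rightarrow> 'k" where
  "fscale c F = (\<lambda>z. c * F z)"

lemma fscale_apply: "fscale c F z = c * F z"
  by (simp add: fscale_def)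

interpretation fs: lin_space fscale
  by unfold_locales (simp_all add: fun_eq_iff fscale_apply fun_apply algebra_simps)

lemma fscale_mult_left: "fscale c F * G = fscale c (F * G)"
  by (rule ext) (simp only: fscale_apply fun_apply mult.assoc)

lemma fscale_mult_right: "F * fscale c G = fscale c (F * G)"
  by (rule ext) (simp only: fscale_apply fun_apply mult.left_commute)

lemma fspan_mult:
  assumes "x \<in> fs.span S" "y \<in> fs.span T" "\<And>s t. s \<in> S \<Longrightarrow> t \<in> T \<Longrightarrow> s * t \<in> fs.span U"
  shows "x * y \<in> fs.span U"
  using assms(1)
proof (induction rule: fs.span_induct_alt)
  case (step c s x)
  have "s * y \<in> fs.span U"
    using assms(2)
  proof (induction rule: fs.span_induct_alt)
    case (step d t y)
    then show ?case using assms(3)[OF \<open>s \<in> S\<close>, of t]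
      by (simp add: distrib_left fscale_mult_right fs.span_add fs.span_scale)
  qed (simp add: fs.span_zero)
  then show ?case using step by (simp add: distrib_right fscale_mult_left fs.span_add fs.span_scale)
qed (simp add: fs.span_zero)

definition coord :: "nat \<Rightarrow> (nat \<Rightarrow> 'k) \<Rightarrow> 'k" where
  "coord i z = z i"

primrec monomials :: "nat set \<Rightarrow> nat \<Rightarrow> ((nat \<Rightarrow> 'k::field) \<Rightarrow> 'k) set" where
  "monomials I 0 = {1}"
| "monomials I (Suc e) = (\<lambda>(i, g). coord i * g) ` (I \<times> monomials I e)"

definition bigens :: "nat \<Rightarrow> nat \<Rightarrow> nat \<Rightarrow> nat \<Rightarrow> ((nat \<Rightarrow> 'k::field) \<Rightarrow> 'k) set" where
  "bigens P Q e f = (\<lambda>(g, h). g * h) ` (monomials {..<P} e \<times> monomials {P..<P + Q} f)"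

text \<open>Polynomial functions instead of formal polynomials: over an infinite field nothing is
  lost, and points are plain evaluations. Only the first \<open>P + Q\<close> coordinates of an
  argument enter.\<close>

definition bihom :: "nat \<Rightarrow> nat \<Rightarrow> nat \<Rightarrow> nat \<Rightarrow> ((nat \<Rightarrow> 'k::field) \<Rightarrow> 'k) set" where
  "bihom P Q e f = fs.span (bigens P Q e f)"

lemma monomials_Suc_I: "i \<in> I \<Longrightarrow> g \<in> monomials I e \<Longrightarrow> coord i * g \<in> monomials I (Suc e)"
  unfolding monomials.simps by (rule image_eqI[of _ _ "(i, g)"]) simp_all

lemma monomials_Suc_E:
  assumes "x \<in> monomials I (Suc e)"
  obtains i g where "x = coord i * g" "i \<in> I" "g \<in> monomials I e"
  using assms unfolding monomials.simps by (elim imageE SigmaE) simp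

lemma bigens_I: "g \<in> monomials {..<P} e \<Longrightarrow> h \<in> monomials {P..<P + Q} f \<Longrightarrow> g * h \<in> bigens P Q e f"
  unfolding bigens_def by (rule image_eqI[of _ _ "(g, h)"]) simp_all

lemma bigens_E:
  assumes "x \<in> bigens P Q e f"
  obtains g h where "x = g * h" "g \<in> monomials {..<P} e" "h \<in> monomials {P..<P + Q} f"
  using assms unfolding bigens_def by (elim imageE SigmaE) simp

lemma monomials_mult: "g \<in> monomials I e \<Longrightarrow> h \<in> monomials I e' \<Longrightarrow> g * h \<in> monomials I (e + e')"
proof (induction e arbitrary: g)
  case (Suc e)
  from Suc.prems(1) obtain i g' where *: "g = coord i * g'" "i \<in> I" "g' \<in> monomials I e"
    by (rule monomials_Suc_E)
  from monomials_Suc_I[OF *(2) Suc.IH[OF *(3) Suc.prems(2)]] show ?case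
    unfolding *(1) mult.assoc by simp
qed simp

lemma finite_monomials: "finite I \<Longrightarrow> finite (monomials I e)"
  by (induction e) simp_all

lemma monomials_power: "i \<in> I \<Longrightarrow> coord i ^ a \<in> monomials I a"
  by (induction a) (simp_all only: power.simps monomials.simps(1) singletonI monomials_Suc_I)

lemma monomials_prod:
  assumes "finite J" "\<And>j. j \<in> J \<Longrightarrow> \<kappa> j \<in> I"
  shows "(\<Prod>j\<in>J. coord (\<kappa> j) ^ a j) \<in> monomials I (\<Sum>j\<in>J. a j)"
  using assms by (induction J rule: finite_induct) (simp_all add: monomials_mult monomials_power)

lemma bigens_0_0: "bigens P Q 0 0 = {1}"
  by (simp add: bigens_def)

lemma bigens_1_0: "bigens P Q 1 0 = coord ` {..<P}"
  by (simp add: bigens_def image_image image_iff set_eq_iff)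

lemma bigens_0_1: "bigens P Q 0 1 = coord ` {P..<P + Q}"
  by (simp add: bigens_def image_image image_iff set_eq_iff)

lemma finite_bigens: "finite (bigens P Q e f)"
  unfolding bigens_def by (intro finite_imageI finite_cartesian_product finite_monomials) simp_all

lemma bigens_mult:
  assumes "x \<in> bigens P Q e f" "y \<in> bigens P Q e' f'"
  shows "x * y \<in> bigens P Q (e + e') (f + f')"
proof -
  from assms(1) obtain g h where 1: "x = g * h" "g \<in> monomials {..<P} e" "h \<in> monomials {P..<P + Q} f"
    by (rule bigens_E)
  from assms(2) obtain g' h' where 2: "y = g' * h'" "g' \<in> monomials {..<P} e'" "h' \<in> monomials {P..<P + Q} f'"
    by (rule bigens_E)
  have "x * y = (g * g') * (h * h')" unfolding 1(1) 2(1) by (simp only: mult_ac)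
  then show ?thesis using bigens_I[OF monomials_mult[OF 1(2) 2(2)] monomials_mult[OF 1(3) 2(3)]] by simp
qed

section \<open>Kronecker substitution and the independence of monomials\<close>

fun digits_value :: "nat \<Rightarrow> nat list \<Rightarrow> nat" where
  "digits_value b [] = 0"
| "digits_value b (a # l) = a + b * digits_value b l"

lemma digits_value_sum: "digits_value b l = (\<Sum>i<length l. b ^ i * l ! i)"
  by (induction l) (simp_all add: sum.lessThan_Suc_shift sum_distrib_left mult_ac del: sum.lessThan_Suc)

lemma digits_value_append: "digits_value b (l @ m) = digits_value b l + b ^ length l * digits_value b m"
  by (induction l) (simp_all add: algebra_simps)

lemma digits_value_inj:
  "length l = length m \<Longrightarrow> \<forall>a\<in>set l. a < b \<Longrightarrow> \<forall>a\<in>set m. a < b \<Longrightarrow> digits_value b l = digits_value b m \<Longrightarrow> l = m"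
proof (induction l m rule: list_induct2)
  case (Cons x l y m)
  have "x = (x + b * digits_value b l) mod b" using Cons.prems(1) by simp
  also have "\<dots> = (y + b * digits_value b m) mod b" using Cons.prems(3) by simp
  also have "\<dots> = y" using Cons.prems(2) by simp
  finally have "x = y" .
  moreover have "b > 0" using Cons.prems(1) by auto
  ultimately show ?case using Cons by simp
qed simp

definition list_mono :: "nat \<Rightarrow> nat \<Rightarrow> nat list \<times> nat list \<Rightarrow> (nat \<Rightarrow> 'k::field) \<Rightarrow> 'k" where
  "list_mono P Q m = (\<Prod>i<P. coord i ^ (fst m ! i)) * (\<Prod>j<Q. coord (P + j) ^ (snd m ! j))"

lemma prod_fun_apply: "(\<Prod>i\<in>S. F i) z = (\<Prod>i\<in>S. F i z)" for F :: "_ \<Rightarrow> _ \<Rightarrow> 'k::field"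
  by (induction S rule: infinite_finite_induct) (simp_all add: fun_apply)

lemma power_fun_apply: "(F ^ n) z = F z ^ n" for F :: "_ \<Rightarrow> 'k::field"
  by (induction n) (simp_all add: fun_apply)

lemma sum_fun_apply: "(\<Sum>i\<in>S. F i) z = (\<Sum>i\<in>S. F i z)" for F :: "_ \<Rightarrow> _ \<Rightarrow> 'k::field"
  by (induction S rule: infinite_finite_induct) (simp_all add: fun_apply)

lemma list_mono_kronecker:
  assumes "length (fst m) = P" "length (snd m) = Q"
  shows "list_mono P Q m (\<lambda>i. s ^ (b ^ i)) = s ^ digits_value b (fst m @ snd m)"
  using assms
  by (simp add: list_mono_def fun_apply prod_fun_apply power_fun_apply coord_def digits_value_append
      digits_value_sum[of b "fst m"] digits_value_sum[of b "snd m"] power_add sum_distrib_left mult_ac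
      flip: power_mult power_sum)

lemma list_mono_bihom:
  assumes "length (fst m) = P" "length (snd m) = Q"
  shows "(list_mono P Q m :: (nat \<Rightarrow> 'k::field) \<Rightarrow> 'k) \<in> bihom P Q (sum_list (fst m)) (sum_list (snd m))"
proof -
  let ?M = "list_mono P Q m :: (nat \<Rightarrow> 'k) \<Rightarrow> 'k"
  have "(\<Prod>i<P. coord i ^ (fst m ! i) :: (nat \<Rightarrow> 'k) \<Rightarrow> 'k) \<in> monomials {..<P} (\<Sum>i<P. fst m ! i)"
    by (rule monomials_prod) auto
  moreover have "(\<Prod>j<Q. coord (P + j) ^ (snd m ! j) :: (nat \<Rightarrow> 'k) \<Rightarrow> 'k) \<in> monomials {P..<P + Q} (\<Sum>j<Q. snd m ! j)"
    by (rule monomials_prod) auto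
  ultimately have "?M \<in> bigens P Q (\<Sum>i<P. fst m ! i) (\<Sum>j<Q. snd m ! j)"
    unfolding list_mono_def by (rule bigens_I)
  moreover have "(\<Sum>i<P. fst m ! i) = sum_list (fst m)" "(\<Sum>j<Q. snd m ! j) = sum_list (snd m)"
    using assms by (simp_all add: sum_list_sum_nth atLeast0LessThan)
  ultimately have "?M \<in> bigens P Q (sum_list (fst m)) (sum_list (snd m))" by simp
  then show ?thesis by (simp add: bihom_def fs.span_base)
qed

lemma poly_eqI_infinite:
  fixes p q :: "'k::alg_closed_field poly"
  assumes "\<And>s. poly p s = poly q s" shows "p = q"
proof -
  have "{s. poly (p - q) s = 0} = UNIV" using assms by auto
  then have "p - q = 0" using infinite_UNIV_alg_closed[where 'k = 'k] poly_roots_finite[of "p - q"] by auto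
  then show ?thesis by simp
qed

text \<open>Substituting \<open>s ^ (b ^ i)\<close> for the \<open>i\<close>-th coordinate sends
  distinct monomials to distinct powers of \<open>s\<close>. A linear relation thus becomes a
  polynomial with the same coefficients that vanishes on an infinite field.\<close>

lemma dim_bihom_ge:
  "nmon P e * nmon Q f \<le> fs.dim (bihom P Q e f :: ((nat \<Rightarrow> 'k::alg_closed_field) \<Rightarrow> 'k) set)"
proof -
  define S where "S = {l :: nat list. length l = P \<and> sum_list l = e} \<times> {l. length l = Q \<and> sum_list l = f}"
  have cardS: "card S = nmon P e * nmon Q f"
    by (simp add: S_def card_cartesian_product card_length_sum_list nmon_def)
  \<comment> \<open>This exceeds every exponent, so the exponents are digits in base
    \<open>b\<close>.\<close>
  define b where "b = Suc (e + f)"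
  define \<kappa> where "\<kappa> m = digits_value b (fst m @ snd m)" for m
  let ?M = "list_mono P Q :: _ \<Rightarrow> (nat \<Rightarrow> 'k) \<Rightarrow> 'k"
  let ?B = "bihom P Q e f :: ((nat \<Rightarrow> 'k) \<Rightarrow> 'k) set"
  have kron: "?M m (\<lambda>i. s ^ (b ^ i)) = s ^ \<kappa> m" if "m \<in> S" for m s
    using that list_mono_kronecker[of m P Q] by (auto simp: S_def \<kappa>_def)
  have S: "length (fst m) = P" "length (snd m) = Q" "sum_list (fst m) = e" "sum_list (snd m) = f"
    if "m \<in> S" for m
    using that by (simp_all add: S_def mem_Times_iff)
  have small: "\<forall>a\<in>set (fst m @ snd m). a < b" if "m \<in> S" for m
  proof
    fix a assume "a \<in> set (fst m @ snd m)"
    then consider "a \<in> set (fst m)" | "a \<in> set (snd m)" by auto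
    then show "a < b"
    proof cases
      case 1 from member_le_sum_list[OF this] show ?thesis using S[OF that] by (simp add: b_def)
    next
      case 2 from member_le_sum_list[OF this] show ?thesis using S[OF that] by (simp add: b_def)
    qed
  qed
  have \<kappa>: "m = m'" if m: "m \<in> S" "m' \<in> S" "\<kappa> m = \<kappa> m'" for m m'
  proof -
    have "fst m @ snd m = fst m' @ snd m'"
      by (rule digits_value_inj[OF _ small[OF m(1)] small[OF m(2)]])
        (simp_all add: S[OF m(1)] S[OF m(2)] m(3)[unfolded \<kappa>_def])
    then show ?thesis using S(1)[OF m(1)] S(1)[OF m(2)] by (simp add: prod_eq_iff)
  qed
  have inj: "inj_on ?M S"
  proof (rule inj_onI)
    fix m m' assume *: "m \<in> S" "m' \<in> S" "?M m = ?M m'"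
    have "monom 1 (\<kappa> m) = (monom 1 (\<kappa> m') :: 'k poly)"
      using kron[OF *(1)] kron[OF *(2)] *(3) by (intro poly_eqI_infinite) (simp add: poly_monom)
    from arg_cong[OF this, of degree] have "\<kappa> m = \<kappa> m'" by (simp add: degree_monom_eq)
    then show "m = m'" using \<kappa> * by blast
  qed
  have fin: "finite S"
  proof -
    have "finite {l :: nat list. length l = n \<and> sum_list l = k}" for n k
      by (rule finite_subset[OF _ finite_lists_length_eq[of "{..k}" n]])
        (auto intro: member_le_sum_list)
    then show ?thesis by (simp add: S_def)
  qed
  have coeff_zero: "c v = 0" if sum: "(\<Sum>v\<in>?M ` S. fscale (c v) v) = 0" and v: "v \<in> ?M ` S" for c v
  proof -
    from v obtain m where m: "m \<in> S" "v = ?M m" by blast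
    define p where "p = (\<Sum>m\<in>S. monom (c (?M m)) (\<kappa> m))"
    have "poly p s = 0" for s
    proof -
      have "poly p s = (\<Sum>m\<in>S. c (?M m) * s ^ \<kappa> m)" by (simp add: p_def poly_sum poly_monom)
      also have "\<dots> = (\<Sum>m\<in>S. fscale (c (?M m)) (?M m)) (\<lambda>i. s ^ (b ^ i))"
        by (simp add: sum_fun_apply kron fscale_apply)
      also have "(\<Sum>m\<in>S. fscale (c (?M m)) (?M m)) = 0"
        using sum by (simp add: sum.reindex[OF inj])
      finally show ?thesis by (simp add: zero_fun_apply)
    qed
    then have "p = 0" by (intro poly_eqI_infinite) simp
    then have "coeff p (\<kappa> m) = 0" by simp
    moreover have "coeff p (\<kappa> m) = (\<Sum>m'\<in>S. if m' = m then c (?M m') else 0)"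
      unfolding p_def coeff_sum using \<kappa> m by (intro sum.cong) auto
    ultimately show ?thesis using fin m by simp
  qed
  have "fs.independent (?M ` S)"
  proof
    assume "fs.dependent (?M ` S)"
    then obtain c v where "v \<in> ?M ` S" "c v \<noteq> 0" "(\<Sum>v\<in>?M ` S. fscale (c v) v) = 0"
      unfolding fs.dependent_finite[OF finite_imageI[OF fin]] by (elim exE conjE bexE)
    then show False using coeff_zero[of c v] by simp
  qed
  then have "card (?M ` S) = fs.dim (?M ` S)" by (simp add: fs.dim_eq_card_independent)
  also have "\<dots> \<le> fs.dim ?B"
  proof (rule fs.dim_mono_fin)
    have "?M m \<in> ?B" if "m \<in> S" for m
      using list_mono_bihom[OF S(1,2)[OF that]] S(3,4)[OF that] by simp
    then show "?M ` S \<subseteq> fs.span ?B" by (intro image_subsetI fs.span_base)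
    show "fs.fin_dim ?B"
      unfolding bihom_def by (intro fs.fin_dim_span fs.fin_dim_finite finite_bigens)
  qed
  finally show ?thesis using cardS by (simp add: card_image[OF inj])
qed

lemma bigraded_bihom:
  "bigraded_algebra fscale (bihom P Q :: _ \<Rightarrow> _ \<Rightarrow> ((nat \<Rightarrow> 'k::alg_closed_field) \<Rightarrow> 'k) set) P Q
    (range (\<lambda>z F. F z))"
proof (unfold_locales, goal_cases)
  case 1 show ?case by (rule fscale_mult_left)
next
  case 2 show ?case by (simp add: bihom_def)
next
  case 3 show ?case unfolding bihom_def by (intro fs.fin_dim_span fs.fin_dim_finite finite_bigens)
next
  case 4 show ?case by (simp add: bihom_def bigens_0_0 fs.span_base)
next
  case 5 show ?case by (simp add: bihom_def bigens_0_0)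
next
  case (6 x e f y e' f')
  then show ?case unfolding bihom_def by (rule fspan_mult) (intro fs.span_base bigens_mult)
next
  case (7 e f)
  have "(bigens P Q (Suc e) f :: ((nat \<Rightarrow> 'k) \<Rightarrow> 'k) set) \<subseteq> {u * g |u g. u \<in> bihom P Q 1 0 \<and> g \<in> bihom P Q e f}"
  proof
    fix x :: "(nat \<Rightarrow> 'k) \<Rightarrow> 'k" assume "x \<in> bigens P Q (Suc e) f"
    then obtain g0 h where g0: "x = g0 * h" "g0 \<in> monomials {..<P} (Suc e)" and h: "h \<in> monomials {P..<P + Q} f"
      by (rule bigens_E)
    from g0(2) obtain i g where g: "g0 = coord i * g" "i \<in> {..<P}" "g \<in> monomials {..<P} e"
      by (rule monomials_Suc_E)
    have *: "x = coord i * (g * h)" unfolding g0(1) g(1) by (rule mult.assoc)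
    have "g * h \<in> bihom P Q e f" unfolding bihom_def by (intro fs.span_base bigens_I g h)
    moreover have "(coord i :: (nat \<Rightarrow> 'k) \<Rightarrow> 'k) \<in> bihom P Q 1 0"
      unfolding bihom_def bigens_1_0 by (intro fs.span_base imageI g)
    ultimately show "x \<in> {u * g |u g. u \<in> bihom P Q 1 0 \<and> g \<in> bihom P Q e f}" using * by blast
  qed
  then show ?case unfolding bihom_def[of P Q "Suc e" f] by (rule fs.span_mono)
next
  case (8 e f)
  have "(bigens P Q e (Suc f) :: ((nat \<Rightarrow> 'k) \<Rightarrow> 'k) set) \<subseteq> {u * g |u g. u \<in> bihom P Q 0 1 \<and> g \<in> bihom P Q e f}"
  proof
    fix x :: "(nat \<Rightarrow> 'k) \<Rightarrow> 'k" assume "x \<in> bigens P Q e (Suc f)"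
    then obtain g h0 where h0: "x = g * h0" "h0 \<in> monomials {P..<P + Q} (Suc f)" and g: "g \<in> monomials {..<P} e"
      by (rule bigens_E) blast
    from h0(2) obtain j h where h: "h0 = coord j * h" "j \<in> {P..<P + Q}" "h \<in> monomials {P..<P + Q} f"
      by (rule monomials_Suc_E)
    have "g * h \<in> bihom P Q e f" unfolding bihom_def by (intro fs.span_base bigens_I g h)
    moreover have "(coord j :: (nat \<Rightarrow> 'k) \<Rightarrow> 'k) \<in> bihom P Q 0 1"
      unfolding bihom_def bigens_0_1 by (intro fs.span_base imageI h)
    moreover have "x = coord j * (g * h)" unfolding h0(1) h(1) by (rule mult.left_commute)
    ultimately show "x \<in> {u * g |u g. u \<in> bihom P Q 0 1 \<and> g \<in> bihom P Q e f}" by blast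
  qed
  then show ?case unfolding bihom_def[of P Q e "Suc f"] by (rule fs.span_mono)
next
  case 9 show ?case by (rule dim_bihom_ge)
next
  case 10
  have "fs.dim (bihom P Q 1 0 :: ((nat \<Rightarrow> 'k) \<Rightarrow> 'k) set) \<le> card (coord ` {..<P} :: ((nat \<Rightarrow> 'k) \<Rightarrow> 'k) set)"
    unfolding bihom_def bigens_1_0 by (intro fs.dim_le_card) auto
  also have "\<dots> \<le> P" using card_image_le[of "{..<P}" coord] by simp
  finally show ?case .
next
  case 11
  have "fs.dim (bihom P Q 0 1 :: ((nat \<Rightarrow> 'k) \<Rightarrow> 'k) set) \<le> card (coord ` {P..<P + Q} :: ((nat \<Rightarrow> 'k) \<Rightarrow> 'k) set)"
    unfolding bihom_def bigens_0_1 by (intro fs.dim_le_card) auto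
  also have "\<dots> \<le> Q" using card_image_le[of "{P..<P + Q}" coord] by simp
  finally show ?case .
next
  case 12 then show ?case by (auto simp: fun_apply)
next
  case 13 then show ?case by (auto simp: fscale_apply)
next
  case 14 then show ?case by (auto simp: fun_apply)
next
  case 15 then show ?case by (auto simp: fun_apply)
next
  case (16 \<phi> \<psi>)
  interpret \<phi>: Vector_Spaces.linear fscale "(*)" \<phi> by fact
  interpret \<psi>: Vector_Spaces.linear fscale "(*)" \<psi> by fact
  \<comment> \<open>Linear forms are determined by their values on coordinates, so these values are
    the coordinates of the required point.\<close>
  define z where "z i = (if i < P then \<phi> (coord i) else \<psi> (coord i))" for i
  have "u z = \<phi> u" if "u \<in> bihom P Q 1 0" for u
    using that unfolding bihom_def bigens_1_0
  proof (induction rule: fs.span_induct_alt)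
    case base show ?case by (rule trans[OF zero_fun_apply \<phi>.zero[symmetric]])
  next
    case (step c x y)
    have "(fscale c x + y) z = c * x z + y z" by (simp only: fun_apply fscale_apply)
    moreover have "x z = \<phi> x" using step(1) by (auto simp: coord_def z_def)
    ultimately show ?case using step(2) by (simp only: \<phi>.add \<phi>.scale)
  qed
  moreover have "v z = \<psi> v" if "v \<in> bihom P Q 0 1" for v
    using that unfolding bihom_def bigens_0_1
  proof (induction rule: fs.span_induct_alt)
    case base show ?case by (rule trans[OF zero_fun_apply \<psi>.zero[symmetric]])
  next
    case (step c x y)
    have "(fscale c x + y) z = c * x z + y z" by (simp only: fun_apply fscale_apply)
    moreover have "x z = \<psi> x" using step(1) by (auto simp: coord_def z_def)
    ultimately show ?case using step(2) by (simp only: \<psi>.add \<psi>.scale)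
  qed
  ultimately show ?case by (intro bexI[of _ "\<lambda>F. F z"]) auto
qed


section \<open>Pairs of factors in given subspaces\<close>

lemma (in lin_space) dual_basis:
  assumes "finite B" "independent B"
  shows "\<exists>D. (\<forall>b. Vector_Spaces.linear scale (*) (D b)) \<and>
    (\<forall>b\<in>B. \<forall>b'\<in>B. D b b' = (if b = b' then 1 else 0)) \<and> (\<forall>z\<in>span B. z = (\<Sum>b\<in>B. scale (D b z) b))"
proof -
  interpret vs: vector_space "(*) :: 'a \<Rightarrow> 'a \<Rightarrow> 'a"
    by unfold_locales (simp_all add: algebra_simps)
  interpret pair: vector_space_pair scale "(*) :: 'a \<Rightarrow> 'a \<Rightarrow> 'a" ..
  have "\<exists>g. Vector_Spaces.linear scale (*) g \<and> (\<forall>b'\<in>B. g b' = (if b = b' then 1 else 0))" for b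
    using pair.linear_independent_extend[OF assms(2), of "\<lambda>b'. if b = b' then 1 else 0"] by simp
  then obtain D where D: "\<And>b. Vector_Spaces.linear scale (*) (D b)"
    "\<And>b b'. b' \<in> B \<Longrightarrow> D b b' = (if b = b' then 1 else 0)" by metis
  have "z = (\<Sum>b\<in>B. scale (D b z) b)" if "z \<in> span B" for z
    using that
  proof (induction rule: span_induct_alt)
    case base
    have "D b 0 = 0" for b using module_hom.zero[OF D(1)[of b, unfolded module_hom_iff_linear[symmetric]]] .
    then show ?case by simp
  next
    case (step c x y)
    have "D b (scale c x + y) = c * D b x + D b y" for b
    proof -
      interpret Db: Vector_Spaces.linear scale "(*)" "D b" by (rule D(1))
      show ?thesis by (simp add: Db.add Db.scale)
    qed
    then have "(\<Sum>b\<in>B. scale (D b (scale c x + y)) b) =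
        (\<Sum>b\<in>B. scale c (scale (D b x) b)) + (\<Sum>b\<in>B. scale (D b y) b)"
      by (simp add: scale_left_distrib sum.distrib)
    also have "(\<Sum>b\<in>B. scale c (scale (D b x) b)) = scale c (\<Sum>b\<in>B. if b = x then b else 0)"
      using step(1) by (simp add: scale_sum_right D(2)) (intro sum.cong, auto simp: D(2))
    also have "(\<Sum>b\<in>B. if b = x then b else 0) = x" using assms(1) step(1) by simp
    finally show ?case using step(2) by simp
  qed
  then show ?thesis using D by (intro exI[of _ D]) auto
qed

lemma (in lin_space) indexed_basis:
  assumes "fin_dim X" "subspace X"
  shows "\<exists>b D. (\<forall>i < dim X. b i \<in> X) \<and> (\<forall>i. Vector_Spaces.linear scale (*) (D i)) \<and>
    (\<forall>i < dim X. \<forall>j < dim X. D i (b j) = (if i = j then 1 else 0)) \<and>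
    (\<forall>x\<in>X. x = (\<Sum>i<dim X. scale (D i x) (b i)))"
proof -
  obtain B where B: "B \<subseteq> X" "independent B" "finite B" "X \<subseteq> span B" "card B = dim X"
    using fin_dim_basis[OF assms(1)] .
  obtain D where D: "\<And>b. Vector_Spaces.linear scale (*) (D b)"
    "\<And>b b'. b \<in> B \<Longrightarrow> b' \<in> B \<Longrightarrow> D b b' = (if b = b' then 1 else 0)"
    "\<And>z. z \<in> span B \<Longrightarrow> z = (\<Sum>b\<in>B. scale (D b z) b)"
    using dual_basis[OF B(3,2)] by blast
  obtain b where b: "bij_betw b {..<dim X} B"
    using ex_bij_betw_nat_finite[OF B(3)] B(5) by (auto simp: atLeast0LessThan)
  have bB: "b i \<in> B" if "i < dim X" for i using bij_betwE[OF b] that by auto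
  have "D (b i) (b j) = (if i = j then 1 else 0)" if "i < dim X" "j < dim X" for i j
    using D(2)[OF bB[OF that(1)] bB[OF that(2)]] bij_betw_imp_inj_on[OF b] that by (auto simp: inj_on_def)
  moreover have "x = (\<Sum>i<dim X. scale (D (b i) x) (b i))" if "x \<in> X" for x
    using D(3)[of x] that B(4) sum.reindex_bij_betw[OF b, of "\<lambda>b. scale (D b x) b"] by auto
  ultimately show ?thesis
    using bB B(1) D(1) by (intro exI[of _ b] exI[of _ "\<lambda>i. D (b i)"]) blast
qed

text \<open>Coordinates for a basis that ends with \<open>a\<close>: an element of \<open>Z\<close>
  is a multiple of \<open>a\<close> iff the first \<open>n\<close> of them vanish. The last one is
  the bilinear form that the points are allowed to violate.\<close>

lemma (in lin_space) indexed_basis_extending: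
  assumes "fin_dim Z" "subspace Z" "a \<in> Z" "a \<noteq> 0"
  shows "\<exists>(n :: nat) D. (\<forall>i :: nat. Vector_Spaces.linear scale (*) (D i)) \<and>
    (\<forall>i<n. D i a = 0) \<and> D n a = 1 \<and> (\<forall>z\<in>Z. (\<forall>i\<le>n. D i z = 0) \<longrightarrow> z = 0)"
proof -
  have "independent {a}" using assms(4) by simp
  then obtain B where B: "{a} \<subseteq> B" "B \<subseteq> Z" "independent B" "Z \<subseteq> span B"
    using maximal_independent_subset_extend[of "{a}" Z] assms(3) by auto
  obtain C where C: "finite C" "Z \<subseteq> span C" using assms(1) fin_dim_def by blast
  have fB: "finite B" using independent_span_bound[OF C(1) B(3)] B(2) C(2) by blast
  obtain D where D: "\<And>b. Vector_Spaces.linear scale (*) (D b)"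
    "\<And>b b'. b \<in> B \<Longrightarrow> b' \<in> B \<Longrightarrow> D b b' = (if b = b' then 1 else 0)"
    "\<And>z. z \<in> span B \<Longrightarrow> z = (\<Sum>b\<in>B. scale (D b z) b)"
    using dual_basis[OF fB B(3)] by blast
  define n where "n = card (B - {a})"
  obtain b where b: "bij_betw b {..<n} (B - {a})"
    using ex_bij_betw_nat_finite[of "B - {a}"] fB by (auto simp: atLeast0LessThan n_def)
  define b' where "b' i = (if i < n then b i else a)" for i
  have im: "B \<subseteq> b' ` {..n}"
  proof
    fix x assume x: "x \<in> B"
    show "x \<in> b' ` {..n}"
    proof (cases "x = a")
      case True then show ?thesis by (intro image_eqI[of _ _ n]) (simp_all add: b'_def)
    next
      case False
      then have "x \<in> b ` {..<n}" using x b by (simp add: bij_betw_def)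
      then obtain i where "i < n" "x = b i" by blast
      then show ?thesis by (intro image_eqI[of _ _ i]) (simp_all add: b'_def)
    qed
  qed
  have aB: "a \<in> B" using B(1) by simp
  have "D (b' i) a = 0" if "i < n" for i
    using that bij_betwE[OF b] D(2)[of "b i" a] aB by (auto simp: b'_def)
  moreover have "D (b' n) a = 1" using D(2)[OF aB aB] by (simp add: b'_def)
  moreover have "z = 0" if "z \<in> Z" "\<forall>i\<le>n. D (b' i) z = 0" for z
  proof -
    have "D x z = 0" if "x \<in> B" for x using im that \<open>\<forall>i\<le>n. D (b' i) z = 0\<close> by blast
    moreover have "z = (\<Sum>b\<in>B. scale (D b z) b)" using D(3) that(1) B(4) by blast
    ultimately show ?thesis by simp
  qed
  ultimately show ?thesis using D(1) by (intro exI[of _ n] exI[of _ "\<lambda>i. D (b' i)"]) blast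
qed

lemma bihom_coord_mult:
  assumes "i < P" "j < Q"
  shows "coord i * coord (P + j) \<in> bihom P Q 1 1"
proof -
  have "coord i * 1 \<in> monomials {..<P} (Suc 0)" "coord (P + j) * 1 \<in> monomials {P..<P + Q} (Suc 0)"
    using assms by (intro monomials_Suc_I; simp)+
  then have "(coord i * 1) * (coord (P + j) * 1) \<in> bigens P Q 1 1"
    unfolding One_nat_def by (rule bigens_I)
  then show ?thesis unfolding bihom_def mult_1_right by (rule fs.span_base)
qed

locale alg_closed_domain = lin_space scale + assoc_algebra scale
  for scale :: "'k::alg_closed_field \<Rightarrow> 'a::ring_1 \<Rightarrow> 'a" +
  assumes integral: "(x :: 'a) * y = 0 \<Longrightarrow> x = 0 \<or> y = 0"
begin

text \<open>
  The coordinates of a pair of factors \<open>(x, y)\<close> form a point, and the equation \<open>x * y = a\<close> up to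
  scalars says that all but one of the bilinear forms given by the coordinates of the product vanish.
\<close>

lemma card_factor_pairs:
  assumes X: "fin_dim X" "subspace X" and Y: "fin_dim Y" "subspace Y" and Z: "fin_dim Z" "subspace Z"
    and XYZ: "\<And>x y. x \<in> X \<Longrightarrow> y \<in> Y \<Longrightarrow> x * y \<in> Z" and a: "a \<noteq> 0"
    and T: "finite T" "\<And>x y. (x, y) \<in> T \<Longrightarrow> x \<in> X \<and> y \<in> Y \<and> x * y = a"
    and indep: "\<And>x y x' y' c. (x, y) \<in> T \<Longrightarrow> (x', y') \<in> T \<Longrightarrow> x = scale c x' \<Longrightarrow> (x, y) = (x', y')"
  shows "card T \<le> 2 ^ (dim X + dim Y - 2)"
proof (cases "T = {}")
  case False
  define p q where "p = dim X" and "q = dim Y"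
  obtain x0 y0 where xy0: "(x0, y0) \<in> T" using False by auto
  then have xy0': "x0 \<in> X" "y0 \<in> Y" "x0 * y0 = a" using T(2) by blast+
  then have aZ: "a \<in> Z" using XYZ by blast
  obtain bx :: "nat \<Rightarrow> 'a" and Dx :: "nat \<Rightarrow> 'a \<Rightarrow> 'k" where bx: "\<And>i. i < p \<Longrightarrow> bx i \<in> X" "\<And>i. Vector_Spaces.linear scale (*) (Dx i)"
    "\<And>i j. i < p \<Longrightarrow> j < p \<Longrightarrow> Dx i (bx j) = (if i = j then 1 else 0)"
    "\<And>x. x \<in> X \<Longrightarrow> x = (\<Sum>i<p. scale (Dx i x) (bx i))"
    using indexed_basis[OF X] unfolding p_def[symmetric] by blast
  obtain bY :: "nat \<Rightarrow> 'a" and Dy :: "nat \<Rightarrow> 'a \<Rightarrow> 'k" where bY: "\<And>i. i < q \<Longrightarrow> bY i \<in> Y" "\<And>i. Vector_Spaces.linear scale (*) (Dy i)"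
    "\<And>i j. i < q \<Longrightarrow> j < q \<Longrightarrow> Dy i (bY j) = (if i = j then 1 else 0)"
    "\<And>y. y \<in> Y \<Longrightarrow> y = (\<Sum>i<q. scale (Dy i y) (bY i))"
    using indexed_basis[OF Y] unfolding q_def[symmetric] by blast
  obtain n :: nat and Dz :: "nat \<Rightarrow> 'a \<Rightarrow> 'k" where Dz: "\<And>i. Vector_Spaces.linear scale (*) (Dz i)" "\<And>i. i < n \<Longrightarrow> Dz i a = 0"
    "Dz n a = 1" "\<And>z. z \<in> Z \<Longrightarrow> (\<And>i. i \<le> n \<Longrightarrow> Dz i z = 0) \<Longrightarrow> z = 0"
    using indexed_basis_extending[OF Z aZ a] by blast
  interpret B: bigraded_algebra fscale "bihom p q :: _ \<Rightarrow> _ \<Rightarrow> ((nat \<Rightarrow> 'k) \<Rightarrow> 'k) set" p q "range (\<lambda>z F. F z)"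
    by (rule bigraded_bihom)
  \<comment> \<open>The form \<open>l i\<close> has the structure constants of the product as
    coefficients: it computes the \<open>i\<close>-th coordinate of \<open>x * y\<close> from those
    of \<open>x\<close> and \<open>y\<close>.\<close>
  define l :: "nat \<Rightarrow> (nat \<Rightarrow> 'k) \<Rightarrow> 'k"
    where "l i = (\<Sum>j<p. \<Sum>k<q. fscale (Dz i (bx j * bY k)) (coord j * coord (p + k)))" for i
  have lR: "l i \<in> bihom p q 1 1" for i
    unfolding l_def by (intro fs.subspace_sum fs.subspace_scale B.subspace_R bihom_coord_mult) simp_all
  define fx where "fx z = (\<Sum>j<p. scale (z j) (bx j))" for z :: "nat \<Rightarrow> 'k"
  define fy where "fy z = (\<Sum>k<q. scale (z (p + k)) (bY k))" for z :: "nat \<Rightarrow> 'k"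
  have fxX: "fx z \<in> X" for z
    unfolding fx_def by (intro subspace_sum subspace_scale X(2) bx(1)) simp
  have fyY: "fy z \<in> Y" for z
    unfolding fy_def by (intro subspace_sum subspace_scale Y(2) bY(1)) simp
  have l_eval: "l i z = Dz i (fx z * fy z)" for i z
  proof -
    interpret D: Vector_Spaces.linear scale "(*)" "Dz i" by (rule Dz(1))
    have "l i z = (\<Sum>j<p. \<Sum>k<q. Dz i (bx j * bY k) * (z j * z (p + k)))"
      unfolding l_def sum_fun_apply fscale_apply times_fun_apply coord_def ..
    also have "\<dots> = Dz i (\<Sum>j<p. \<Sum>k<q. scale (z j * z (p + k)) (bx j * bY k))"
      unfolding D.sum D.scale by (intro sum.cong refl mult.commute)
    also have "(\<Sum>j<p. \<Sum>k<q. scale (z j * z (p + k)) (bx j * bY k)) = fx z * fy z"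
      unfolding fx_def fy_def sum_product by (simp only: scale_mult_left scale_mult_right scale_scale mult.commute[of "z (p + _)"])
    finally show ?thesis .
  qed
  have Dx_fx: "Dx j (fx z) = z j" if "j < p" for j z
  proof -
    interpret D: Vector_Spaces.linear scale "(*)" "Dx j" by (rule bx(2))
    have "Dx j (fx z) = (\<Sum>i<p. if j = i then z i else 0)"
      unfolding fx_def D.sum D.scale using bx(3) that by (intro sum.cong) auto
    then show ?thesis using that by simp
  qed
  have Dy_fy: "Dy k (fy z) = z (p + k)" if "k < q" for k z
  proof -
    interpret D: Vector_Spaces.linear scale "(*)" "Dy k" by (rule bY(2))
    have "Dy k (fy z) = (\<Sum>i<q. if k = i then z (p + i) else 0)"
      unfolding fy_def D.sum D.scale using bY(3) that by (intro sum.cong) auto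
    then show ?thesis using that by simp
  qed
  have lin0: "f 0 = 0" if "Vector_Spaces.linear scale (*) f" for f :: "'a \<Rightarrow> 'k"
  proof -
    interpret D: Vector_Spaces.linear scale "(*)" f by (rule that)
    show ?thesis by (rule D.zero)
  qed
  \<comment> \<open>The absence of zero divisors enters here: if all coordinates of the product
    vanish, one of the factors is 0.\<close>
  have ns: "B.nonsingular {} {} (l ` {..n})"
    unfolding B.nonsingular_def
  proof (intro ballI impI)
    fix h :: "((nat \<Rightarrow> 'k) \<Rightarrow> 'k) \<Rightarrow> 'k"
    assume h: "h \<in> range (\<lambda>z F. F z)" and hl: "\<forall>u\<in>{} \<union> {} \<union> l ` {..n}. h u = 0"
    then obtain z where z: "h = (\<lambda>F. F z)" by blast
    have "fx z * fy z = 0"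
      using hl by (intro Dz(4) XYZ fxX fyY) (simp add: z l_eval)
    from integral[OF this] consider "fx z = 0" | "fy z = 0" by blast
    then show "(\<forall>u\<in>bihom p q 1 0. h u = 0) \<or> (\<forall>v\<in>bihom p q 0 1. h v = 0)"
    proof cases
      case 1
      have "h u = 0" if u: "u \<in> bihom p q 1 0" for u
      proof (rule B.points_span[OF h])
        show "u \<in> fs.span (coord ` {..<p})" using u unfolding bihom_def bigens_1_0 .
        fix g :: "(nat \<Rightarrow> 'k) \<Rightarrow> 'k" assume "g \<in> coord ` {..<p}"
        then obtain j where "j < p" "g = coord j" by blast
        then show "h g = 0" using Dx_fx[of j z] 1 lin0[OF bx(2)] by (simp add: z coord_def)
      qed
      then show ?thesis by blast
    next
      case 2
      have "h u = 0" if u: "u \<in> bihom p q 0 1" for u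
      proof (rule B.points_span[OF h])
        show "u \<in> fs.span (coord ` {p..<p + q})" using u unfolding bihom_def bigens_0_1 .
        fix g :: "(nat \<Rightarrow> 'k) \<Rightarrow> 'k" assume "g \<in> coord ` {p..<p + q}"
        then obtain j where "p \<le> j" "j < p + q" "g = coord j" by auto
        then show "h g = 0" using Dy_fy[of "j - p" z] 2 lin0[OF bY(2)] by (simp add: z coord_def)
      qed
      then show ?thesis by blast
    qed
  qed
  define zc where "zc t i = (if i < p then Dx i (fst t) else Dy (i - p) (snd t))" for t i
  have fx_zc: "fx (zc (x, y)) = x" and fy_zc: "fy (zc (x, y)) = y" if "(x, y) \<in> T" for x y
  proof -
    have "x \<in> X" "y \<in> Y" using T(2) that by blast+
    then show "fx (zc (x, y)) = x" "fy (zc (x, y)) = y"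
      using bx(4)[of x] bY(4)[of y] by (simp_all add: fx_def fy_def zc_def)
  qed
  have l_zc: "l i (zc (x, y)) = Dz i a" if "(x, y) \<in> T" for i x y
    using fx_zc[OF that] fy_zc[OF that] T(2)[OF that] by (simp add: l_eval)
  define ev where "ev t = (\<lambda>F :: (nat \<Rightarrow> 'k) \<Rightarrow> 'k. F (zc t))" for t
  have sep: "\<exists>g\<in>bihom p q 1 1. ev (x, y) g \<noteq> 0 \<and> ev (x', y') g = 0"
    if t: "(x, y) \<in> T" "(x', y') \<in> T" "(x, y) \<noteq> (x', y')" for x y x' y'
  proof -
    let ?z = "zc (x, y)" and ?z' = "zc (x', y')"
    have nz: "x \<noteq> 0" "y \<noteq> 0" "x' \<noteq> 0" using T(2)[OF t(1)] T(2)[OF t(2)] a by auto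
    obtain k where k: "k < q" "?z (p + k) \<noteq> 0"
    proof (rule ccontr)
      assume "\<not> thesis"
      then have "fy ?z = 0" unfolding fy_def using that by (intro sum.neutral) auto
      then show False using nz fy_zc[OF t(1)] by simp
    qed
    obtain i where i: "i < p" "?z' i \<noteq> 0"
    proof (rule ccontr)
      assume "\<not> thesis"
      then have "fx ?z' = 0" unfolding fx_def using that by (intro sum.neutral) auto
      then show False using nz fx_zc[OF t(2)] by simp
    qed
    \<comment> \<open>Since \<open>x\<close> is not a multiple of \<open>x'\<close>, some 2 by 2
      minor of their coordinates is nonzero, and the nonzero coordinate \<open>i\<close> of
      \<open>x'\<close> may be kept fixed in it.\<close>
    obtain j where j: "j < p" "?z' i * ?z j - ?z' j * ?z i \<noteq> 0"
    proof (rule ccontr)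
      assume n: "\<not> thesis"
      note th = that
      have "?z j = ?z i / ?z' i * ?z' j" if j: "j < p" for j
      proof -
        have "?z' i * ?z j - ?z' j * ?z i = 0" using n th[OF j] by blast
        then show ?thesis using i(2) by (simp add: field_simps)
      qed
      then have "fx ?z = scale (?z i / ?z' i) (fx ?z')"
        unfolding fx_def by (simp add: scale_sum_right)
      then have "x = scale (?z i / ?z' i) x'" unfolding fx_zc[OF t(1)] fx_zc[OF t(2)] .
      from indep[OF t(1,2) this] show False using t(3) by blast
    qed
    \<comment> \<open>A linear form vanishing at \<open>x'\<close> but not at \<open>x\<close>,
      times a coordinate that is nonzero at \<open>y\<close>, which makes it bilinear.\<close>
    define g where "g = fscale (?z' i) (coord j * coord (p + k)) - fscale (?z' j) (coord i * coord (p + k))"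
    have "g \<in> bihom p q 1 1"
      unfolding g_def by (intro fs.subspace_diff fs.subspace_scale B.subspace_R bihom_coord_mult i(1) j(1) k(1))
    moreover have g: "g z = (?z' i * z j - ?z' j * z i) * z (p + k)" for z
    proof -
      have "g z = ?z' i * (z j * z (p + k)) - ?z' j * (z i * z (p + k))"
        unfolding g_def fun_diff_def fscale_apply times_fun_apply coord_def ..
      then show ?thesis by (simp add: algebra_simps)
    qed
    ultimately show ?thesis using j(2) k(2) by (intro bexI[of _ g]) (simp_all add: ev_def)
  qed
  have inj: "inj_on ev T"
  proof (rule inj_onI)
    fix t t' assume t: "t \<in> T" "t' \<in> T" "ev t = ev t'"
    show "t = t'"
    proof (rule ccontr)
      assume "t \<noteq> t'"
      then show False using sep[of "fst t" "snd t" "fst t'" "snd t'"] t by auto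
    qed
  qed
  have "card (ev ` T) \<le> 2 ^ (p + q - 2)"
  proof (rule B.card_points_le[where A = "{}" and B = "{}" and l = l and n = n])
    show "B.linear_system p q {} {}" by (simp add: B.linear_system_def fs.independent_empty)
    show "0 < p"
    proof (rule ccontr)
      assume "\<not> 0 < p"
      then show False using bx(4)[OF xy0'(1)] xy0' a by simp
    qed
    show "0 < q"
    proof (rule ccontr)
      assume "\<not> 0 < q"
      then show False using bY(4)[OF xy0'(2)] xy0' a by simp
    qed
    show "l i \<in> bihom p q 1 1" for i by (rule lR)
    show "B.nonsingular {} {} (l ` {..n})" by (rule ns)
    show "finite (ev ` T)" using T(1) by simp
    show "ev ` T \<subseteq> range (\<lambda>z F. F z)" by (auto simp: ev_def)
    show "\<forall>h\<in>ev ` T. \<forall>u\<in>{} \<union> {} \<union> l ` {..<n}. h u = 0"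
      using l_zc Dz(2) by (auto simp: ev_def)
    show "\<forall>h\<in>ev ` T. \<exists>g\<in>bihom p q 1 1. h g \<noteq> 0"
    proof
      fix h assume "h \<in> ev ` T"
      then obtain x y where "(x, y) \<in> T" "h = ev (x, y)" by auto
      then show "\<exists>g\<in>bihom p q 1 1. h g \<noteq> 0"
        using l_zc[of x y n] Dz(3) by (intro bexI[OF _ lR[of n]]) (simp add: ev_def)
    qed
    show "\<forall>h\<in>ev ` T. \<forall>h'\<in>ev ` T. h \<noteq> h' \<longrightarrow> (\<exists>g\<in>bihom p q 1 1. h g \<noteq> 0 \<and> h' g = 0)"
    proof (intro ballI impI)
      fix h h' assume h: "h \<in> ev ` T" "h' \<in> ev ` T" "h \<noteq> h'"
      then obtain x y x' y' where "(x, y) \<in> T" "(x', y') \<in> T" "h = ev (x, y)" "h' = ev (x', y')" by auto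
      then show "\<exists>g\<in>bihom p q 1 1. h g \<noteq> 0 \<and> h' g = 0" using sep h(3) by blast
    qed
  qed
  then show ?thesis by (simp add: card_image[OF inj] p_def q_def)
qed simp

end


section \<open>Degrees and factorizations\<close>

locale fd_domain_filtration = lin_space scale + fd_algebra_filtration scale V
  for scale :: "'k::alg_closed_field \<Rightarrow> 'a::ring_1 \<Rightarrow> 'a" and V :: "nat \<Rightarrow> 'a set" +
  assumes nc_domain_gr: "nc_domain (gr V)"
begin

lemma fin_dim_V: "fin_dim (V n)"
  using finite_dim_V[of n] unfolding fin_dim_def by auto

text \<open>The filtration axioms do not state this; it comes from the unit of \<open>gr V\<close>
  lying in the carrier. In degree 0 the cosets are singletons, so the representative is 1
  itself.\<close>

lemma one_V: "1 \<in> V 0"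
proof -
  interpret gr: nc_domain "gr V" by (rule nc_domain_gr)
  have "\<one>\<^bsub>gr V\<^esub> \<in> gr_of ` reps" using gr.one_closed unfolding carrier_gr .
  then obtain F where F: "F \<in> reps" "gr_of 1 = gr_of F" unfolding one_gr by blast
  from fun_cong[OF F(2), of 0] have "gr_coset V 0 1 = gr_coset V 0 (fps_nth F 0)"
    by (simp add: gr_of_def)
  then have "1 - fps_nth F 0 \<in> below V 0" unfolding gr_coset_eq_iff .
  then have "1 = fps_nth F 0" by (simp add: below_def)
  moreover have "fps_nth F 0 \<in> V 0" using F(1) by (simp add: reps_def)
  ultimately show ?thesis by (simp only:)
qed

lemma gr_of_eq_zero: "gr_of F = gr_of 0 \<longleftrightarrow> (\<forall>n. fps_nth F n \<in> below V n)"
  by (simp add: gr_of_def fun_eq_iff gr_coset_eq_iff)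

text \<open>The two elements are placed in their degrees as series with one term. The product in
  \<open>gr V\<close> is then concentrated in degree \<open>i + j\<close>, where it is the class of
  \<open>x * y\<close>.\<close>

lemma mult_not_below:
  assumes x: "x \<in> V i" "x \<notin> below V i" and y: "y \<in> V j" "y \<notin> below V j"
  shows "x * y \<notin> below V (i + j)"
proof
  interpret gr: nc_domain "gr V" by (rule nc_domain_gr)
  assume xy: "x * y \<in> below V (i + j)"
  define F where "F = Abs_fps (\<lambda>n. if n = i then x else 0)"
  define G where "G = Abs_fps (\<lambda>n. if n = j then y else 0)"
  have F: "F \<in> reps" and G: "G \<in> reps"
    using x(1) y(1) V_zero by (simp_all add: F_def G_def reps_def)
  have "fps_nth (F * G) n = (if n = i + j then x * y else 0)" for n
  proof -
    have "fps_nth (F * G) n = (\<Sum>k=0..n. if k = i then (if n - k = j then x * y else 0) else 0)"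
      unfolding fps_mult_nth by (intro sum.cong) (auto simp: F_def G_def)
    then show ?thesis by (auto simp: sum.delta)
  qed
  then have "gr_of (F * G) = gr_of 0" using xy below_zero by (simp add: gr_of_eq_zero)
  then have "gr_of F \<otimes>\<^bsub>gr V\<^esub> gr_of G = \<zero>\<^bsub>gr V\<^esub>" by (simp add: mult_gr[OF F G] zero_gr)
  then have "gr_of F = gr_of 0 \<or> gr_of G = gr_of 0"
    using gr.integral[of "gr_of F" "gr_of G"] F G unfolding carrier_gr zero_gr by blast
  then have "fps_nth F i \<in> below V i \<or> fps_nth G j \<in> below V j"
    unfolding gr_of_eq_zero by blast
  then show False using x y by (simp add: F_def G_def)
qed

section \<open>The degree function, units, and growth\<close>

definition deg :: "'a \<Rightarrow> nat" where
  "deg x = (LEAST n. x \<in> V n)"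

lemma deg_V: "x \<in> V (deg x)"
proof -
  have "x \<in> (\<Union>n. V n)" unfolding Union_V by (rule UNIV_I)
  then obtain n where "x \<in> V n" by (rule UN_E)
  then show ?thesis unfolding deg_def by (rule LeastI)
qed

lemma deg_le: "x \<in> V n \<Longrightarrow> deg x \<le> n"
  unfolding deg_def by (rule Least_le)

lemma deg_not_below: "x \<noteq> 0 \<Longrightarrow> x \<notin> below V (deg x)"
  using deg_le[of x "deg x - 1"] by (cases "deg x") (auto simp: below_def)

lemma degI:
  assumes "x \<in> V n" "x \<notin> below V n"
  shows "deg x = n"
proof (rule ccontr)
  assume "deg x \<noteq> n"
  then have "deg x < n" using deg_le[OF assms(1)] by simp
  then obtain m where "n = Suc m" "deg x \<le> m" by (cases n) auto
  then show False using assms(2) deg_V[of x] V_mono[of "deg x" m] by (auto simp: below_def)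
qed

lemma deg_mult: "x \<noteq> 0 \<Longrightarrow> y \<noteq> 0 \<Longrightarrow> deg (x * y) = deg x + deg y"
  by (intro degI V_mult deg_V mult_not_below deg_not_below)

lemma mult_eq_0: "(x :: 'a) * y = 0 \<Longrightarrow> x = 0 \<or> y = 0"
  using mult_not_below[OF deg_V deg_not_below deg_V deg_not_below, of x y] below_zero by auto

sublocale alg_closed_domain scale
  by unfold_locales (rule mult_eq_0)

lemma deg_one: "deg 1 = 0"
  using deg_le[OF one_V] by simp

text \<open>A finite-dimensional domain over an algebraically closed field is the field itself: the
  powers of \<open>x\<close> are dependent, a linear factor \<open>x - \<tau>\<close> annihilates a
  nonzero element, and hence it is 0.\<close>

lemma V_0_scalar:
  assumes "x \<in> V 0"
  shows "\<exists>c. x = scale c 1"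
proof -
  have pow: "x ^ i \<in> V 0" for i
  proof (induction i)
    case (Suc i)
    from V_mult[OF assms Suc] show ?case by simp
  qed (simp add: one_V)
  obtain \<tau> d and t :: nat where v: "(\<Sum>i<t. scale (d i) (x ^ i)) \<notin> {0}"
    and dep: "(\<Sum>i<t. scale (d i) (x ^ Suc i - scale \<tau> (x ^ i))) \<in> {0}"
  proof (rule shift_eigenvector[of "V 0" "{0}" "\<lambda>i. x ^ i"])
    fix t :: nat and c :: "nat \<Rightarrow> 'k" assume "0 < t"
    then show "\<exists>\<tau> d. d (t - 1) = 1 \<and> c 0 = - \<tau> * d 0 \<and> (\<forall>i>0. i < t \<longrightarrow> c i = d (i - 1) - \<tau> * d i)"
      by (rule monic_root_factor[of t c]) blast
  qed (use fin_dim_V subspace_V V_zero pow in auto)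
  have "(x - scale \<tau> 1) * (\<Sum>i<t. scale (d i) (x ^ i)) = (\<Sum>i<t. scale (d i) (x ^ Suc i - scale \<tau> (x ^ i)))"
    unfolding sum_distrib_left
    by (intro sum.cong refl) (simp add: left_diff_distrib scale_mult_left scale_mult_right scale_right_diff_distrib)
  then have "x - scale \<tau> 1 = 0" using mult_eq_0[of "x - scale \<tau> 1"] v dep by auto
  then show ?thesis by auto
qed

lemma scalar_central_unit: "c \<noteq> 0 \<Longrightarrow> central_unit (scale c 1)"
  unfolding central_unit_def unit_def
  by (intro conjI exI[of _ "scale (inverse c) 1"] allI) (simp_all add: scale_mult_left scale_mult_right)

text \<open>Degrees add up to \<open>deg 1 = 0\<close>, so units lie in \<open>V 0\<close>, which
  consists of scalars. In particular every unit is central.\<close>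

lemma unit_iff_deg: "x \<noteq> 0 \<Longrightarrow> unit x \<longleftrightarrow> deg x = 0"
proof
  assume "x \<noteq> 0" "unit x"
  then obtain u where u: "x * u = 1" unfolding unit_def by blast
  then have "u \<noteq> 0" by auto
  then show "deg x = 0" using deg_mult[OF \<open>x \<noteq> 0\<close>, of u] u deg_one by simp
next
  assume "x \<noteq> 0" "deg x = 0"
  then obtain c where "x = scale c 1" using V_0_scalar deg_V[of x] by auto
  then show "unit x" using scalar_central_unit[of c] \<open>x \<noteq> 0\<close> by (auto simp: central_unit_def)
qed

lemma not_unit_deg: "x \<noteq> 0 \<Longrightarrow> \<not> unit x \<longleftrightarrow> 0 < deg x"
  using unit_iff_deg by auto

lemma growth_mono: "n \<le> m \<Longrightarrow> growth n \<le> growth m"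
  unfolding growth_def using V_mono[of n m] span_superset[of "V m"] by (intro dim_mono_fin fin_dim_V) blast

text \<open>If \<open>y\<close> has degree \<open>j\<close>, then \<open>V j\<close> and \<open>V i * y\<close> meet only in the multiples of \<open>y\<close>.\<close>

lemma growth_add:
  assumes "y \<noteq> 0"
  shows "growth i + growth (deg y) \<le> Suc (growth (i + deg y))"
proof -
  let ?j = "deg y"
  have "Vector_Spaces.linear scale scale (\<lambda>x. x * y)"
    by unfold_locales (simp_all add: distrib_right scale_mult_left algebra_simps)
  from dim_Un_image[OF this fin_dim_V[of ?j] subspace_V fin_dim_V[of i] subspace_V]
  have "dim (V ?j \<union> (\<lambda>x. x * y) ` V i) + dim {w \<in> V i. w * y \<in> V ?j} = dim (V ?j) + dim (V i)" .
  moreover have "dim (V ?j \<union> (\<lambda>x. x * y) ` V i) \<le> dim (V (i + ?j))"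
  proof (rule dim_mono_fin[OF _ fin_dim_V])
    have "(\<lambda>x. x * y) ` V i \<subseteq> V (i + ?j)" using V_mult deg_V by blast
    moreover have "V ?j \<subseteq> V (i + ?j)" by (rule V_mono) simp
    ultimately show "V ?j \<union> (\<lambda>x. x * y) ` V i \<subseteq> span (V (i + ?j))" using span_superset by blast
  qed
  moreover have "dim {w \<in> V i. w * y \<in> V ?j} \<le> card {1 :: 'a}"
  proof (rule dim_le_card)
    show "{w \<in> V i. w * y \<in> V ?j} \<subseteq> span {1}"
    proof
      fix w assume w: "w \<in> {w \<in> V i. w * y \<in> V ?j}"
      show "w \<in> span {1}"
      proof (cases "w = 0")
        case False
        then have "deg w = 0" using deg_le[of "w * y" ?j] deg_mult[OF False assms] w by simp
        then obtain c where "w = scale c 1" using V_0_scalar deg_V[of w] by auto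
        then show ?thesis by (simp add: span_scale span_base)
      qed (simp add: span_zero)
    qed
  qed simp
  ultimately show ?thesis by (simp add: growth_def)
qed

section \<open>Pairs of factors with prescribed degree of the first\<close>

definition factor_pairs :: "'a \<Rightarrow> nat \<Rightarrow> 'a list set" where
  "factor_pairs a i = {[x, y] |x y. x * y = a \<and> deg x = i}"

lemma factor_pairsD:
  assumes "[x, y] \<in> factor_pairs a i" "a \<noteq> 0"
  shows "x * y = a" "deg x = i" "x \<noteq> 0" "y \<noteq> 0" "deg a = i + deg y"
proof -
  show xy: "x * y = a" "deg x = i" using assms(1) by (simp_all add: factor_pairs_def)
  show "x \<noteq> 0" "y \<noteq> 0" using xy(1) assms(2) by auto
  from deg_mult[OF this] show "deg a = i + deg y" using xy by simp
qed

lemma card_pairs_le: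
  assumes "a \<noteq> 0" "finite T" and "\<And>x y. (x, y) \<in> T \<Longrightarrow> x \<in> V i \<and> y \<in> V j \<and> x * y = a"
    and "\<And>x y x' y' c. (x, y) \<in> T \<Longrightarrow> (x', y') \<in> T \<Longrightarrow> x = scale c x' \<Longrightarrow> (x, y) = (x', y')"
  shows "card T \<le> 2 ^ (dim (V i) + dim (V j) - 2)"
  by (rule card_factor_pairs[where X = "V i" and Y = "V j" and Z = "V (i + j)" and a = a and T = T])
    (rule fin_dim_V subspace_V V_mult assms | assumption)+

text \<open>Inequivalent pairs have nonproportional first factors, so
  \<open>card_factor_pairs\<close> applies to them. The exponent then shrinks by
  \<open>growth_add\<close>.\<close>

lemma card_factor_pairs_le:
  assumes a: "a \<noteq> 0" and T: "finite T" "T \<subseteq> factor_pairs a i"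
    and ineq: "\<forall>s\<in>T. \<forall>t\<in>T. s \<noteq> t \<longrightarrow> (s, t) \<notin> fact_equiv"
  shows "card T \<le> 2 ^ (growth (deg a) - 1)"
proof (cases "T = {}")
  case False
  then obtain x0 y0 where xy0: "[x0, y0] \<in> T" using T(2) by (force simp: factor_pairs_def)
  note xy0' = factor_pairsD[OF subsetD[OF T(2) xy0] a]
  define j where "j = deg y0"
  have d: "deg a = i + j" using xy0'(5) by (simp add: j_def)
  define T' where "T' = (\<lambda>xs. (xs ! 0, xs ! 1)) ` T"
  have T': "[x, y] \<in> T" if xy: "(x, y) \<in> T'" for x y
  proof -
    obtain xs where xs: "xs \<in> T" "x = xs ! 0" "y = xs ! 1" using xy by (auto simp: T'_def)
    have "xs \<in> factor_pairs a i" using T(2) xs(1) by (rule subsetD)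
    then obtain x' y' where "xs = [x', y']" unfolding factor_pairs_def by blast
    then have "xs = [x, y]" using xs(2,3) by simp
    then show ?thesis using xs(1) by (simp only:)
  qed
  have inj: "inj_on (\<lambda>xs. (xs ! 0, xs ! 1)) T"
  proof (rule inj_onI)
    fix xs ys assume *: "xs \<in> T" "ys \<in> T" "(xs ! 0, xs ! 1) = (ys ! 0, ys ! 1)"
    obtain x y where "xs = [x, y]" using subsetD[OF T(2) *(1)] unfolding factor_pairs_def by blast
    moreover obtain x' y' where "ys = [x', y']" using subsetD[OF T(2) *(2)] unfolding factor_pairs_def by blast
    ultimately show "xs = ys" using *(3) by simp
  qed
  have mem: "x \<in> V i \<and> y \<in> V j \<and> x * y = a" if xy: "(x, y) \<in> T'" for x y
  proof -
    note f = factor_pairsD[OF subsetD[OF T(2) T'[OF xy]] a]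
    have "deg x = i" "deg y = j" using f(2,5) d by simp_all
    then show ?thesis using f(1) deg_V[of x] deg_V[of y] by simp
  qed
  have eq: "(x, y) = (x', y')" if xy: "(x, y) \<in> T'" "(x', y') \<in> T'" and c: "x = scale c x'" for x y x' y' c
  proof -
    note f = factor_pairsD[OF subsetD[OF T(2) T'[OF xy(1)]] a]
    note f' = factor_pairsD[OF subsetD[OF T(2) T'[OF xy(2)]] a]
    have "c \<noteq> 0" using c f(3) by auto
    \<comment> \<open>Cancelling \<open>x'\<close> forces the second factors to differ by the
      inverse scalar, so the pairs are equivalent.\<close>
    have "x' * scale c y = x * y" using c by (simp add: scale_mult_left scale_mult_right)
    then have "x' * (scale c y - y') = 0" using f(1) f'(1) by (simp add: right_diff_distrib)
    then have y': "y' = scale c y" using mult_eq_0[of x' "scale c y - y'"] f'(3) by auto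
    have "x' = scale (inverse c) 1 * x" using \<open>c \<noteq> 0\<close> by (simp add: c scale_mult_left)
    moreover have "y' = scale c 1 * y" by (simp add: y' scale_mult_left)
    moreover have "central_unit (scale c 1)" "central_unit (scale (inverse c) 1)"
      using scalar_central_unit \<open>c \<noteq> 0\<close> by simp_all
    ultimately have "([x, y], [x', y']) \<in> fact_equiv"
      unfolding fact_equiv_def by auto
    moreover have "[x, y] \<noteq> [x', y'] \<longrightarrow> ([x, y], [x', y']) \<notin> fact_equiv"
      by (rule bspec[OF bspec[OF ineq T'[OF xy(1)]] T'[OF xy(2)]])
    ultimately have "[x, y] = [x', y']" by (simp only: not_not simp_thms)
    then show ?thesis by simp
  qed
  have "finite T'" unfolding T'_def using T(1) by (rule finite_imageI)
  have "card T' \<le> 2 ^ (dim (V i) + dim (V j) - 2)"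
    using a \<open>finite T'\<close> mem eq by (rule card_pairs_le)
  also have "card T' = card T" unfolding T'_def by (rule card_image[OF inj])
  also have "2 ^ (dim (V i) + dim (V j) - 2) \<le> (2 :: nat) ^ (growth (deg a) - 1)"
    using growth_add[OF xy0'(4), of i] unfolding d j_def[symmetric]
    by (intro power_increasing) (simp_all add: growth_def)
  finally show ?thesis .
qed simp

lemma fact_equiv_Cons:
  "(x # xs, y # ys) \<in> fact_equiv \<longleftrightarrow> (\<exists>u. central_unit u \<and> y = u * x) \<and> (xs, ys) \<in> fact_equiv"
  by (simp add: fact_equiv_def)

lemma fact_equiv_refl: "(xs, xs) \<in> fact_equiv"
  unfolding fact_equiv_def by (simp add: list_all2_same) (auto intro!: exI[of _ 1] simp: central_unit_def unit_def)

lemma fact_equiv_sym: "(xs, ys) \<in> fact_equiv \<Longrightarrow> (ys, xs) \<in> fact_equiv"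
  using equiv_fact_equiv unfolding equiv_def by (blast dest: symD)

lemma fact_equiv_trans: "(xs, ys) \<in> fact_equiv \<Longrightarrow> (ys, zs) \<in> fact_equiv \<Longrightarrow> (xs, zs) \<in> fact_equiv"
  using equiv_fact_equiv unfolding equiv_def by (blast dest: transD)

text \<open>Sets of pairwise inequivalent pairs have bounded size, so one of maximal size exists,
  and by maximality it meets every class.\<close>

lemma factor_pairs_transversal:
  assumes a: "a \<noteq> 0"
  shows "\<exists>T. finite T \<and> T \<subseteq> factor_pairs a i \<and> card T \<le> 2 ^ (growth (deg a) - 1) \<and>
    (\<forall>s\<in>factor_pairs a i. \<exists>t\<in>T. (t, s) \<in> fact_equiv)"
proof -
  define S where "S T \<longleftrightarrow> finite T \<and> T \<subseteq> factor_pairs a i \<and> (\<forall>s\<in>T. \<forall>t\<in>T. s \<noteq> t \<longrightarrow> (s, t) \<notin> fact_equiv)" for T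
  have "S {}" by (simp add: S_def)
  moreover have bound: "card T \<le> 2 ^ (growth (deg a) - 1)" if "S T" for T
    using card_factor_pairs_le[OF a, of T i] that unfolding S_def by blast
  then have "\<forall>T. S T \<longrightarrow> card T < Suc (2 ^ (growth (deg a) - 1))" by (simp add: less_Suc_eq_le)
  ultimately obtain T where T: "S T" "\<And>T'. S T' \<Longrightarrow> card T' \<le> card T"
    using ex_has_greatest_nat[of S "{}" card] by blast
  have "\<exists>t\<in>T. (t, s) \<in> fact_equiv" if s: "s \<in> factor_pairs a i" for s
  proof (rule ccontr)
    assume n: "\<not> (\<exists>t\<in>T. (t, s) \<in> fact_equiv)"
    then have "s \<notin> T" using fact_equiv_refl by blast
    moreover have "S (insert s T)"
      using T(1) s n fact_equiv_sym unfolding S_def by auto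
    ultimately show False using T(2)[of "insert s T"] T(1) by (simp add: S_def)
  qed
  then show ?thesis using T(1) bound[OF T(1)] unfolding S_def by blast
qed

section \<open>Factorizations of arbitrary length\<close>

lemma factorization_nonzero:
  assumes "xs \<in> factorizations a" "a \<noteq> 0"
  shows "xs \<noteq> []" "prod_list xs = a" "\<forall>x\<in>set xs. x \<noteq> 0 \<and> 0 < deg x"
proof -
  show 1: "xs \<noteq> []" "prod_list xs = a" using assms(1) by (simp_all add: factorizations_def)
  have "x \<noteq> 0" if "x \<in> set xs" for x
  proof
    assume "x = 0"
    then have "prod_list xs = 0" using that by (induction xs) auto
    then show False using 1 assms(2) by simp
  qed
  then show "\<forall>x\<in>set xs. x \<noteq> 0 \<and> 0 < deg x"
    using assms(1) not_unit_deg by (auto simp: factorizations_def)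
qed

lemma prod_list_deg:
  assumes "\<forall>x\<in>set xs. x \<noteq> 0 \<and> 0 < deg x"
  shows "prod_list xs \<noteq> 0 \<and> length xs \<le> deg (prod_list xs)"
  using assms
proof (induction xs)
  case (Cons x xs)
  then show ?case using deg_mult[of x "prod_list xs"] mult_eq_0[of x "prod_list xs"] by auto
qed simp

lemma factorizations_deg_0:
  assumes "a \<noteq> 0" "deg a = 0"
  shows "factorizations a = {}"
proof -
  have False if "xs \<in> factorizations a" for xs
    using factorization_nonzero[OF that assms(1)] prod_list_deg[of xs] assms(2) by simp
  then show ?thesis by blast
qed

lemma factor_pair_nonunit:
  assumes "[x, y] \<in> factor_pairs a i" "a \<noteq> 0" "0 < i" "i < deg a"
  shows "\<not> unit x" "\<not> unit y" "0 < deg y" "deg y = deg a - i"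
  using factor_pairsD[OF assms(1,2)] assms(3,4) not_unit_deg by auto

text \<open>Non-units have positive degree, which leaves \<open>deg a - 1\<close> choices for the
  degree of the first factor.\<close>

lemma factorizations2_transversal:
  assumes a: "a \<noteq> 0"
  shows "\<exists>T. finite T \<and> T \<subseteq> factorizations2 a \<and> card T \<le> (deg a - 1) * 2 ^ (growth (deg a) - 1) \<and>
    (\<forall>s\<in>factorizations2 a. \<exists>t\<in>T. (t, s) \<in> fact_equiv)"
proof -
  obtain T where T: "\<And>i. finite (T i)" "\<And>i. T i \<subseteq> factor_pairs a i" "\<And>i. card (T i) \<le> 2 ^ (growth (deg a) - 1)"
    "\<And>i s. s \<in> factor_pairs a i \<Longrightarrow> \<exists>t\<in>T i. (t, s) \<in> fact_equiv"
    using factor_pairs_transversal[OF a] by metis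
  let ?T = "\<Union>i\<in>{1..<deg a}. T i"
  have "card ?T \<le> (\<Sum>i\<in>{1..<deg a}. card (T i))" by (rule card_UN_le) simp
  also have "\<dots> \<le> (\<Sum>i\<in>{1..<deg a}. 2 ^ (growth (deg a) - 1))" by (rule sum_mono) (rule T(3))
  finally have "card ?T \<le> (deg a - 1) * 2 ^ (growth (deg a) - 1)" by simp
  moreover have "?T \<subseteq> factorizations2 a"
  proof
    fix xs assume "xs \<in> ?T"
    then obtain i where "i \<in> {1..<deg a}" "xs \<in> T i" by blast
    then have i: "0 < i" "i < deg a" "xs \<in> factor_pairs a i" using subsetD[OF T(2)] by simp_all
    then obtain x y where xy: "xs = [x, y]" "x * y = a" by (auto simp: factor_pairs_def)
    show "xs \<in> factorizations2 a"
      using factor_pair_nonunit[OF i(3)[unfolded xy(1)] a i(1,2)] xy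
      by (simp add: factorizations2_def factorizations_def)
  qed
  moreover have "\<exists>t\<in>?T. (t, s) \<in> fact_equiv" if s: "s \<in> factorizations2 a" for s
  proof -
    have sf: "s \<in> factorizations a" and "length s = 2" using s by (simp_all add: factorizations2_def)
    then obtain x y where xy: "s = [x, y]" by (auto simp: numeral_2_eq_2 length_Suc_conv)
    note f = factorization_nonzero[OF sf a]
    have "deg a = deg x + deg y" "s \<in> factor_pairs a (deg x)"
      using f xy deg_mult[of x y] by (auto simp: factor_pairs_def)
    moreover from this have "deg x \<in> {1..<deg a}" using f xy by auto
    ultimately show ?thesis using T(4)[of s "deg x"] by blast
  qed
  ultimately show ?thesis using T(1) by (intro exI[of _ ?T]) blast
qed

text \<open>The solution of the recursion N(d) = 1 + \<Sum> c N(d - i), in which 1 stands for the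
  factorization with a single factor and \<open>c\<close> bounds the first factors of degree
  \<open>i\<close>.\<close>

lemma geometric_sum:
  assumes "0 < d"
  shows "1 + (\<Sum>i\<in>{1..<d}. c * (1 + c) ^ (d - i - 1)) = (1 + c :: nat) ^ (d - 1)"
  using assms
proof (induction d)
  case (Suc d)
  show ?case
  proof (cases "d = 0")
    case False
    have "(\<Sum>i\<in>{1..<Suc d}. c * (1 + c) ^ (Suc d - i - 1)) =
        c * (1 + c) ^ (d - 1) + (\<Sum>i\<in>{Suc 1..<Suc d}. c * (1 + c) ^ (Suc d - i - 1))"
      using False by (subst sum.atLeast_Suc_lessThan) auto
    also have "(\<Sum>i\<in>{Suc 1..<Suc d}. c * (1 + c) ^ (Suc d - i - 1)) = (\<Sum>i\<in>{1..<d}. c * (1 + c) ^ (d - i - 1))"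
      by (subst sum.shift_bounds_Suc_ivl) simp
    finally have "1 + (\<Sum>i\<in>{1..<Suc d}. c * (1 + c) ^ (Suc d - i - 1)) = c * (1 + c) ^ (d - 1) + (1 + c) ^ (d - 1)"
      using Suc.IH False by simp
    also have "\<dots> = (1 + c) ^ d" using False by (cases d) simp_all
    finally show ?thesis by simp
  qed simp
qed simp

text \<open>A fixed \<open>g\<close> replaces \<open>growth (deg a)\<close> so that the same
  constant serves all smaller degrees in the recursion.\<close>

lemma factorizations_transversal:
  assumes "a \<noteq> 0" "0 < deg a" "growth (deg a) \<le> g"
  shows "\<exists>T. finite T \<and> T \<subseteq> factorizations a \<and> card T \<le> (1 + 2 ^ (g - 1)) ^ (deg a - 1) \<and>
    (\<forall>s\<in>factorizations a. \<exists>t\<in>T. (t, s) \<in> fact_equiv)"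
  using assms
proof (induction "deg a" arbitrary: a rule: less_induct)
  case less
  note a = less.prems(1)
  define d where "d = deg a"
  define c :: nat where "c = 2 ^ (g - 1)"
  obtain T where T: "\<And>i. finite (T i)" "\<And>i. T i \<subseteq> factor_pairs a i" "\<And>i. card (T i) \<le> 2 ^ (growth (deg a) - 1)"
    "\<And>i s. s \<in> factor_pairs a i \<Longrightarrow> \<exists>t\<in>T i. (t, s) \<in> fact_equiv"
    using factor_pairs_transversal[OF a] by metis
  have Tc: "card (T i) \<le> c" for i
  proof -
    have "(2::nat) ^ (growth (deg a) - 1) \<le> c" unfolding c_def using less.prems(3) by (intro power_increasing) auto
    then show ?thesis using T(3)[of i] by simp
  qed
  have "\<exists>C. finite C \<and> C \<subseteq> factorizations y \<and> card C \<le> (1 + c) ^ (deg y - 1) \<and>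
      (\<forall>s\<in>factorizations y. \<exists>t\<in>C. (t, s) \<in> fact_equiv)" if "y \<noteq> 0" "0 < deg y" "deg y < d" for y
    using less.hyps[of y] that less.prems(3) growth_mono[of "deg y" "deg a"] unfolding c_def d_def by simp
  then obtain C where C: "\<And>y. y \<noteq> 0 \<Longrightarrow> 0 < deg y \<Longrightarrow> deg y < d \<Longrightarrow>
    finite (C y) \<and> C y \<subseteq> factorizations y \<and> card (C y) \<le> (1 + c) ^ (deg y - 1) \<and>
      (\<forall>s\<in>factorizations y. \<exists>t\<in>C y. (t, s) \<in> fact_equiv)" by metis
  have pair: "[xs ! 0, xs ! 1] \<in> factor_pairs a i" if "xs \<in> T i" for xs i
    using that T(2)[of i] by (auto simp: factor_pairs_def)
  have Cy: "finite (C (xs ! 1)) \<and> C (xs ! 1) \<subseteq> factorizations (xs ! 1) \<and> card (C (xs ! 1)) \<le> (1 + c) ^ (d - i - 1) \<and>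
      (\<forall>s\<in>factorizations (xs ! 1). \<exists>t\<in>C (xs ! 1). (t, s) \<in> fact_equiv)"
    if "xs \<in> T i" "i \<in> {1..<d}" for xs i
    using C[of "xs ! 1"] factor_pairsD[OF pair[OF that(1)] a] that(2) by (simp add: d_def)
  define U where "U i = (\<Union>xs\<in>T i. (#) (xs ! 0) ` C (xs ! 1))" for i
  define W where "W = insert [a] (\<Union>i\<in>{1..<d}. U i)"
  have finU: "finite (U i)" if "i \<in> {1..<d}" for i
    unfolding U_def using T(1) Cy that by blast
  have cardU: "card (U i) \<le> c * (1 + c) ^ (d - i - 1)" if i: "i \<in> {1..<d}" for i
  proof -
    have "card (U i) \<le> (\<Sum>xs\<in>T i. card ((#) (xs ! 0) ` C (xs ! 1)))"
      unfolding U_def by (rule card_UN_le[OF T(1)])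
    also have "\<dots> \<le> (\<Sum>xs\<in>T i. (1 + c) ^ (d - i - 1))"
    proof (rule sum_mono)
      fix xs assume xs: "xs \<in> T i"
      have "card ((#) (xs ! 0) ` C (xs ! 1)) \<le> card (C (xs ! 1))"
        using Cy[OF xs i] by (intro card_image_le) blast
      then show "card ((#) (xs ! 0) ` C (xs ! 1)) \<le> (1 + c) ^ (d - i - 1)" using Cy[OF xs i] by simp
    qed
    also have "\<dots> = card (T i) * (1 + c) ^ (d - i - 1)" by simp
    also have "\<dots> \<le> c * (1 + c) ^ (d - i - 1)" using Tc by (intro mult_right_mono) auto
    finally show ?thesis .
  qed
  have "card W \<le> 1 + card (\<Union>i\<in>{1..<d}. U i)"
    unfolding W_def using finU by (subst card_insert_if) auto
  also have "card (\<Union>i\<in>{1..<d}. U i) \<le> (\<Sum>i\<in>{1..<d}. card (U i))" by (rule card_UN_le) simp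
  also have "\<dots> \<le> (\<Sum>i\<in>{1..<d}. c * (1 + c) ^ (d - i - 1))" by (rule sum_mono) (rule cardU)
  finally have "card W \<le> 1 + (\<Sum>i\<in>{1..<d}. c * (1 + c) ^ (d - i - 1))" by simp
  also have "\<dots> = (1 + c) ^ (d - 1)" using less.prems(2) by (intro geometric_sum) (simp add: d_def)
  finally have "card W \<le> (1 + 2 ^ (g - 1)) ^ (deg a - 1)" by (simp add: c_def d_def)
  moreover have "finite W" unfolding W_def using finU by simp
  moreover have "W \<subseteq> factorizations a"
  proof
    fix s assume "s \<in> W"
    then consider "s = [a]" | i where "i \<in> {1..<d}" "s \<in> U i" unfolding W_def by blast
    then show "s \<in> factorizations a"
    proof cases
      case 1 then show ?thesis using not_unit_deg[OF a] less.prems(2) by (simp add: factorizations_def)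
    next
      case 2
      then obtain xs ys where xs: "xs \<in> T i" "ys \<in> C (xs ! 1)" "s = xs ! 0 # ys" unfolding U_def by blast
      then have "ys \<in> factorizations (xs ! 1)" using Cy[OF xs(1) 2(1)] by blast
      then show ?thesis
        using factor_pairsD(1)[OF pair[OF xs(1)] a] factor_pair_nonunit(1)[OF pair[OF xs(1)] a] 2(1) xs(3)
        by (simp add: factorizations_def d_def)
    qed
  qed
  moreover have "\<exists>t\<in>W. (t, s) \<in> fact_equiv" if s: "s \<in> factorizations a" for s
  proof -
    note f = factorization_nonzero[OF s a]
    obtain z rest where z: "s = z # rest" using f(1) by (cases s) auto
    show ?thesis
    proof (cases rest)
      case Nil
      then have "s = [a]" using z f(2) by simp
      then show ?thesis using fact_equiv_refl[of s] by (auto simp: W_def)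
    next
      case (Cons h tl)
      define b where "b = prod_list rest"
      have zb: "z * b = a" "z \<noteq> 0" "0 < deg z" using f z by (simp_all add: b_def)
      have b: "b \<noteq> 0" "0 < deg b" using prod_list_deg[of rest] f(3) z Cons by (auto simp: b_def)
      define i where "i = deg z"
      have i: "i \<in> {1..<d}" using zb b deg_mult[of z b] by (auto simp: i_def d_def)
      have "[z, b] \<in> factor_pairs a i" using zb by (simp add: factor_pairs_def i_def)
      then obtain xs where xs: "xs \<in> T i" "(xs, [z, b]) \<in> fact_equiv" using T(4) by blast
      obtain x y where xy: "xs = [x, y]" using xs(1) T(2)[of i] by (auto simp: factor_pairs_def)
      \<comment> \<open>The chosen representative has second factor \<open>y = w * b\<close>, not
        \<open>b\<close>. The given factorization of \<open>b\<close> is carried over to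
        \<open>y\<close> by absorbing the central unit \<open>w\<close> into its first
        factor.\<close>
      from fact_equiv_sym[OF xs(2)] obtain w where w: "central_unit w" "y = w * b"
        unfolding xy fact_equiv_Cons by blast
      from xs(2) have zx: "\<exists>u. central_unit u \<and> z = u * x" unfolding xy fact_equiv_Cons by blast
      have "w \<noteq> 0" using w(1) by (auto simp: central_unit_def unit_def)
      then have dw: "deg w = 0" using w(1) unit_iff_deg by (simp add: central_unit_def)
      have h: "h \<noteq> 0" "0 < deg h" "\<forall>x\<in>set tl. \<not> unit x"
        using f(3) z Cons s by (auto simp: factorizations_def)
      have "w * h \<noteq> 0" using mult_eq_0[of w h] \<open>w \<noteq> 0\<close> h(1) by blast
      moreover have "0 < deg (w * h)" using deg_mult[OF \<open>w \<noteq> 0\<close> h(1)] h(2) dw by simp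
      ultimately have "\<not> unit (w * h)" using not_unit_deg by blast
      then have "w * h # tl \<in> factorizations y"
        using h(3) w(2) Cons by (simp add: factorizations_def b_def mult.assoc)
      moreover have "xs ! 1 = y" by (simp add: xy)
      ultimately obtain ys where ys: "ys \<in> C y" "(ys, w * h # tl) \<in> fact_equiv"
        using Cy[OF xs(1) i] by auto
      have "(rest, w * h # tl) \<in> fact_equiv"
        unfolding Cons fact_equiv_Cons using w(1) fact_equiv_refl by blast
      then have "(ys, rest) \<in> fact_equiv" using ys(2) fact_equiv_sym fact_equiv_trans by blast
      then have "(x # ys, s) \<in> fact_equiv" using zx unfolding z fact_equiv_Cons by blast
      moreover have "x # ys \<in> U i" unfolding U_def using xs(1) ys(1) by (auto simp: xy intro!: bexI[of _ xs])
      ultimately show ?thesis using i unfolding W_def by blast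
    qed
  qed
  ultimately show ?case by (intro exI[of _ W]) blast
qed

end

lemma fact_classes_bound:
  assumes "finite T" "T \<subseteq> S" "\<forall>s\<in>S. \<exists>t\<in>T. (t, s) \<in> fact_equiv"
  shows "finite (fact_classes S) \<and> card (fact_classes S) \<le> card T"
proof -
  let ?r = "fact_equiv \<inter> S \<times> S"
  have eq: "equiv UNIV (fact_equiv :: ('a list \<times> 'a list) set)" by (rule equiv_fact_equiv)
  have "fact_classes S \<subseteq> (\<lambda>t. ?r `` {t}) ` T"
  proof
    fix X assume "X \<in> fact_classes S"
    then obtain s where s: "s \<in> S" "X = ?r `` {s}" unfolding fact_classes_def quotient_def by blast
    then obtain t where t: "t \<in> T" "(t, s) \<in> fact_equiv" using assms(3) by blast
    have "t \<in> S" using t(1) assms(2) by blast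
    have "fact_equiv `` {t} = fact_equiv `` {s}" by (rule equiv_class_eq[OF eq t(2)])
    then have "?r `` {t} = ?r `` {s}" using s(1) \<open>t \<in> S\<close> by blast
    then show "X \<in> (\<lambda>t. ?r `` {t}) ` T" using s t by blast
  qed
  then show ?thesis
    using assms(1) by (meson card_image_le card_mono finite_imageI finite_subset le_trans)
qed

theorem theorem1p4:
  fixes scale :: "'k::alg_closed_field \<Rightarrow> 'a::ring_1 \<Rightarrow> 'a"
    and V :: "nat \<Rightarrow> 'a set" and n :: nat and a :: 'a
  assumes "fd_algebra_filtration scale V"
    and "nc_domain (gr V)"
    and "a \<in> V n" and "a \<noteq> 0"
  shows "finite (fact_classes (factorizations2 a)) \<and>
      real (card (fact_classes (factorizations2 a)))
        \<le> real n / 4 * 4 ^ algebra_filtration.growth scale V n \<and>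
      finite (fact_classes (factorizations a)) \<and>
      card (fact_classes (factorizations a))
        \<le> 2 ^ (n * algebra_filtration.growth scale V n)"
proof -
  interpret fd_algebra_filtration scale V by fact
  interpret fd_domain_filtration scale V
    by (intro fd_domain_filtration.intro fd_domain_filtration_axioms.intro lin_space.intro
        vector_space_axioms assms(1,2))
  define g where "g = growth n"
  have d: "deg a \<le> n" by (rule deg_le) fact
  have gd: "growth (deg a) \<le> g" unfolding g_def by (rule growth_mono[OF d])
  \<comment> \<open>Positivity of \<open>g\<close> keeps the truncated exponent \<open>g - 1\<close>
    honest in both final estimates.\<close>
  have "growth (deg a) \<noteq> 0"
  proof
    assume "growth (deg a) = 0"
    then have "{0} = V (deg a)"
      by (intro subspace_eq_if_dim_le) (simp_all add: fin_dim_V V_zero growth_def)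
    with deg_V[of a] have "a \<in> {0}" by (simp only:)
    then show False using \<open>a \<noteq> 0\<close> by simp
  qed
  then have g: "0 < g" using gd by simp
  obtain T2 where T2: "finite T2" "T2 \<subseteq> factorizations2 a" "card T2 \<le> (deg a - 1) * 2 ^ (growth (deg a) - 1)"
    "\<forall>s\<in>factorizations2 a. \<exists>t\<in>T2. (t, s) \<in> fact_equiv"
    using factorizations2_transversal[OF \<open>a \<noteq> 0\<close>] by blast
  note c2 = fact_classes_bound[OF T2(1,2,4)]
  have "card (fact_classes (factorizations2 a)) \<le> n * 2 ^ (g - 1)"
  proof -
    have "(deg a - 1) * 2 ^ (growth (deg a) - 1) \<le> n * 2 ^ (g - 1)"
      using d gd by (intro mult_le_mono power_increasing) auto
    then show ?thesis using c2 T2(3) by linarith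
  qed
  then have "real (card (fact_classes (factorizations2 a))) \<le> real (n * 2 ^ (g - 1))"
    by (simp only: of_nat_le_iff)
  also have "\<dots> = real n * 2 ^ (g - 1)" by simp
  \<comment> \<open>The count obtained so far has base 2; the stated bound is
    \<open>n * 4 ^ (g - 1)\<close>.\<close>
  also have "\<dots> \<le> real n * 4 ^ (g - 1)" by (intro mult_left_mono power_mono) auto
  also have "\<dots> = real n / 4 * 4 ^ g" using g by (cases g) simp_all
  finally have 2: "real (card (fact_classes (factorizations2 a))) \<le> real n / 4 * 4 ^ g" .
  have "\<exists>T. finite T \<and> T \<subseteq> factorizations a \<and> card T \<le> 2 ^ (n * g) \<and>
    (\<forall>s\<in>factorizations a. \<exists>t\<in>T. (t, s) \<in> fact_equiv)"
  proof (cases "deg a = 0")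
    case True
    then show ?thesis using factorizations_deg_0[OF \<open>a \<noteq> 0\<close>] by (intro exI[of _ "{}"]) simp
  next
    case False
    then obtain T where T: "finite T" "T \<subseteq> factorizations a" "card T \<le> (1 + 2 ^ (g - 1)) ^ (deg a - 1)"
      "\<forall>s\<in>factorizations a. \<exists>t\<in>T. (t, s) \<in> fact_equiv"
      using factorizations_transversal[OF \<open>a \<noteq> 0\<close> _ gd] by blast
    have "1 + 2 ^ (g - 1) \<le> (2::nat) ^ g" using g by (cases g) simp_all
    then have "(1 + 2 ^ (g - 1)) ^ (deg a - 1) \<le> ((2::nat) ^ g) ^ (deg a - 1)" by (rule power_mono) simp
    also have "\<dots> \<le> (2 ^ g) ^ n" using d by (intro power_increasing) auto
    also have "\<dots> = 2 ^ (n * g)" by (simp add: power_mult[symmetric] mult.commute)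
    finally show ?thesis using T by (intro exI[of _ T]) (blast intro: order_trans)
  qed
  then obtain T where T: "finite T" "T \<subseteq> factorizations a" "card T \<le> 2 ^ (n * g)"
    "\<forall>s\<in>factorizations a. \<exists>t\<in>T. (t, s) \<in> fact_equiv" by blast
  from fact_classes_bound[OF T(1,2,4)] T(3) c2 2 show ?thesis unfolding g_def by linarith
qed

end
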